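(* Let $\mathcal{E}$ be any one of the three families of deformed equations ${\rm H1}^\sigma_\epsilon$, ${\rm H2}^\sigma_\epsilon$, ${\rm H3}^\sigma_\epsilon$, with $\sigma\in\{1,-1\}$. The equation $$\mathcal{E}(u_{n,m},u_{n+1,m},u_{n,m+1},u_{n+1,m+1};n,m;\alpha,\beta;\sigma)=0\qquad(\ast)$$ admits two local three-point generalized symmetries, with generators $$\mathbf{v}_n=\mathrm{R}^{[0]}_n\,\partial_{u_{n,m}},\qquad \mathrm{R}^{[0]}_n=\frac{f(u_{n,m},u_{n+1,m};\alpha)}{u_{n+1,m}-u_{n-1,m}}-\frac12 f_{,u_{n+1,m}}(u_{n,m},u_{n+1,m};\alpha),$$ $$\mathbf{v}_m=\mathrm{R}^{[0]}_m\,\partial_{u_{n,m}},\qquad \mathrm{R}^{[0]}_m=\frac{f(u_{n,m},u_{n,m+1};\beta)}{u_{n,m+1}-u_{n,m-1}}-\frac12 f_{,u_{n,m+1}}(u_{n,m},u_{n,m+1};\beta).$$ Moreover, the generator of any five-point extended generalized symmetry of $(\ast)$ is necessarily a vector field of the form $$\mathbf{v}=a(n;\alpha,\beta)\,\mathbf{v}_n+b(m;\alpha,\beta)\,\mathbf{v}_m+\tfrac12\,\psi(n,m,u_{n,m};\alpha,\beta)\,\partial_{u_{n,m}}+\xi(n,m;\alpha,\beta)\,\partial_\alpha+\zeta(n,m;\alpha,\beta)\,\partial_\beta,$$ where the functions $a,b,\psi,\xi,\zeta$ are determined through the infinitesimal symmetry criterion.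
   Context: Let $\epsilon,\delta$ be complex constants, $\alpha,\beta$ the (complex, generic) lattice parameters, $\sigma\in\{1,-1\}$. Put $$\mathcal{X}_{n,m}=\frac{1+\sigma(-1)^{n+m}}{2},\qquad \mathcal{Y}_{n,m}=\frac{1-\sigma(-1)^{n+m}}{2}.$$ The polynomial $\mathcal{E}(x_1,x_2,x_3,x_4;n,m;\alpha,\beta;\sigma)$ and the polynomial $f(u,x;\alpha)$ (which depends also on $n,m,\sigma$ through $\mathcal{X}_{n,m},\mathcal{Y}_{n,m}$) are: - ${\rm H1}^\sigma_\epsilon$: $\mathcal{E}=(x_1-x_4)(x_2-x_3)-(\alpha-\beta)+\epsilon(\alpha-\beta)\{\mathcal{X}_{n,m}x_2x_3+\mathcal{Y}_{n,m}x_1x_4\}$, $\ f(u,x;\alpha)=1-\epsilon(\mathcal{Y}_{n,m}u^2+\mathcal{X}_{n,m}x^2)$; - ${\rm H2}^\sigma_\epsilon$: $\mathcal{E}=(x_1-x_4)(x_2-x_3)+(\beta-\alpha)(x_1+x_2+x_3+x_4)-\alpha^2+\beta^2-\epsilon(\beta-\alpha)^3-\epsilon(\beta-\alpha)\{2\mathcal{Y}_{n,m}x_1+2\mathcal{X}_{n,m}x_2+\alpha+\beta\}\{2\mathcal{Y}_{n,m}x_4+2\mathcal{X}_{n,m}x_3+\alpha+\beta\}$, $\ f(u,x;\alpha)=2\{u+x+\alpha-2\epsilon[\mathcal{Y}_{n,m}(u+\alpha)^2+\mathcal{X}_{n,m}(x+\alpha)^2]\}$; - ${\rm H3}^\sigma_\epsilon$: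 $\mathcal{E}=\alpha(x_1x_2+x_3x_4)-\beta(x_1x_3+x_2x_4)+(\alpha^2-\beta^2)\delta-\frac{\epsilon(\alpha^2-\beta^2)}{\alpha\beta}\{\mathcal{X}_{n,m}x_2x_3+\mathcal{Y}_{n,m}x_1x_4\}$, $\ f(u,x;\alpha)=ux+\delta\alpha-\frac{\epsilon}{\alpha}(\mathcal{Y}_{n,m}u^2+\mathcal{X}_{n,m}x^2)$ (lattice parameters nonzero). $f_{,u_{n+1,m}}$ and $f_{,u_{n,m+1}}$ denote the derivative of $f$ with respect to its second value argument. Symmetries. A vector field $R\,\partial_{u_{n,m}}+\xi\,\partial_\alpha+\zeta\,\partial_\beta$, where the characteristic $R$ is a (smooth) function of $n,m,\alpha,\beta$ and finitely many values of $u$, and $\xi,\zeta$ are functions of $n,m,\alpha,\beta$, generates a symmetry of $(\ast)$ if the infinitesimal criterion $$\sum_{i,j\in\{0,1\}}\big(\mathcal{S}_n^{(i)}\mathcal{S}_m^{(j)}R\big)\frac{\partial\mathcal{E}}{\partial u_{n+i,m+j}}+\xi\frac{\partial\mathcal{E}}{\partial\alpha}+\zeta\frac{\partial\mathcal{E}}{\partial\beta}=0$$ holds for every (generic) solution $u$ of $(\ast)$ and all $(n,m)\in\mathbb{Z}^2$; here $\mathcal{S}_n^{(i)}$, $\mathcal{S}_m^{(j)}$ shift $n\mapsto n+i$, $m\mapsto m+j$ everywhere, both in the indices of $u$ and in the explicit dependence on $n,m$. If $\xi=\zeta=0$ it is a (local) generalized symmetry; otherwise one speaks of an extended generalized symmetry.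 "Three-point" means that $R$ depends on $u$ only through $u_{n-1,m},u_{n,m},u_{n+1,m}$ (or through $u_{n,m-1},u_{n,m},u_{n,m+1}$); "five-point" means that $R$ depends on $u$ only through $u_{n,m},u_{n\pm1,m},u_{n,m\pm1}$. *)

theory Defs
  imports "HOL-Complex_Analysis.Complex_Analysis"
begin

section \<open>The deformed H equations\<close>

datatype family = H1 | H2 | H3

text \<open>The sites \<open>(n,m)\<close> form a black-white lattice: for \<open>\<sigma> = 1\<close> or \<open>\<sigma> = -1\<close>, one of the weights
  \<open>wX \<sigma> n m\<close>, \<open>wY \<sigma> n m\<close> is 1 and the other one is 0, depending on the parity of \<open>n + m\<close>.\<close>

definition wX :: "complex \<Rightarrow> int \<Rightarrow> int \<Rightarrow> complex" where
  "wX \<sigma> n m = (1 + \<sigma> * (-1) powi (n + m)) / 2"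

definition wY :: "complex \<Rightarrow> int \<Rightarrow> int \<Rightarrow> complex" where
  "wY \<sigma> n m = (1 - \<sigma> * (-1) powi (n + m)) / 2"

text \<open>\<open>\<E> fam \<sigma> \<epsilon> \<delta> n m \<alpha> \<beta> x1 x2 x3 x4\<close>; the constant \<open>\<delta>\<close> occurs in \<^const>\<open>H3\<close> only.\<close>

fun \<E> :: "family \<Rightarrow> complex \<Rightarrow> complex \<Rightarrow> complex \<Rightarrow> int \<Rightarrow> int \<Rightarrow> complex \<Rightarrow> complex
    \<Rightarrow> complex \<Rightarrow> complex \<Rightarrow> complex \<Rightarrow> complex \<Rightarrow> complex" where
  "\<E> H1 \<sigma> \<epsilon> \<delta> n m \<alpha> \<beta> x1 x2 x3 x4 =
     (x1 - x4) * (x2 - x3) - (\<alpha> - \<beta>)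
       + \<epsilon> * (\<alpha> - \<beta>) * (wX \<sigma> n m * x2 * x3 + wY \<sigma> n m * x1 * x4)"
| "\<E> H2 \<sigma> \<epsilon> \<delta> n m \<alpha> \<beta> x1 x2 x3 x4 =
     (x1 - x4) * (x2 - x3) + (\<beta> - \<alpha>) * (x1 + x2 + x3 + x4) - \<alpha>\<^sup>2 + \<beta>\<^sup>2
       - \<epsilon> * (\<beta> - \<alpha>) ^ 3
       - \<epsilon> * (\<beta> - \<alpha>) * (2 * wY \<sigma> n m * x1 + 2 * wX \<sigma> n m * x2 + \<alpha> + \<beta>)
           * (2 * wY \<sigma> n m * x4 + 2 * wX \<sigma> n m * x3 + \<alpha> + \<beta>)"
| "\<E> H3 \<sigma> \<epsilon> \<delta> n m \<alpha> \<beta> x1 x2 x3 x4 =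
     \<alpha> * (x1 * x2 + x3 * x4) - \<beta> * (x1 * x3 + x2 * x4) + (\<alpha>\<^sup>2 - \<beta>\<^sup>2) * \<delta>
       - \<epsilon> * (\<alpha>\<^sup>2 - \<beta>\<^sup>2) / (\<alpha> * \<beta>) * (wX \<sigma> n m * x2 * x3 + wY \<sigma> n m * x1 * x4)"

text \<open>\<open>ff fam \<sigma> \<epsilon> \<delta> n m u x \<alpha>\<close> is the polynomial \<open>f(u,x;\<alpha>)\<close> at the site \<open>(n,m)\<close>.\<close>

fun ff :: "family \<Rightarrow> complex \<Rightarrow> complex \<Rightarrow> complex \<Rightarrow> int \<Rightarrow> int
    \<Rightarrow> complex \<Rightarrow> complex \<Rightarrow> complex \<Rightarrow> complex" where
  "ff H1 \<sigma> \<epsilon> \<delta> n m u x \<alpha> = 1 - \<epsilon> * (wY \<sigma> n m * u\<^sup>2 + wX \<sigma> n m * x\<^sup>2)"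
| "ff H2 \<sigma> \<epsilon> \<delta> n m u x \<alpha> =
     2 * (u + x + \<alpha> - 2 * \<epsilon> * (wY \<sigma> n m * (u + \<alpha>)\<^sup>2 + wX \<sigma> n m * (x + \<alpha>)\<^sup>2))"
| "ff H3 \<sigma> \<epsilon> \<delta> n m u x \<alpha> =
     u * x + \<delta> * \<alpha> - \<epsilon> / \<alpha> * (wY \<sigma> n m * u\<^sup>2 + wX \<sigma> n m * x\<^sup>2)"

text \<open>Generic lattice parameters: those for which the equation is well defined and does not
  factorize. For instance, \<^const>\<open>H1\<close> becomes \<open>(x1 - x4) * (x2 - x3) = 0\<close> when \<open>\<alpha> = \<beta>\<close>.\<close>

fun generic_params :: "family \<Rightarrow> (complex \<times> complex) set" where
  "generic_params H1 = {(\<alpha>, \<beta>). \<alpha> \<noteq> \<beta>}"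
| "generic_params H2 = {(\<alpha>, \<beta>). \<alpha> \<noteq> \<beta>}"
| "generic_params H3 = {(\<alpha>, \<beta>). \<alpha> \<noteq> 0 \<and> \<beta> \<noteq> 0 \<and> \<alpha>\<^sup>2 \<noteq> \<beta>\<^sup>2}"


section \<open>Solutions and five-point stencils\<close>

text \<open>The remaining definitions make sense for any quadrilateral equation
  \<open>Q n m \<alpha> \<beta> u(n,m) u(n+1,m) u(n,m+1) u(n+1,m+1) = 0\<close>.\<close>

type_synonym quad = "int \<Rightarrow> int \<Rightarrow> complex \<Rightarrow> complex
    \<Rightarrow> complex \<Rightarrow> complex \<Rightarrow> complex \<Rightarrow> complex \<Rightarrow> complex"

definition D1 :: "quad \<Rightarrow> quad" where
  "D1 Q n m \<alpha> \<beta> x1 x2 x3 x4 = deriv (\<lambda>t. Q n m \<alpha> \<beta> t x2 x3 x4) x1"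

definition D2 :: "quad \<Rightarrow> quad" where
  "D2 Q n m \<alpha> \<beta> x1 x2 x3 x4 = deriv (\<lambda>t. Q n m \<alpha> \<beta> x1 t x3 x4) x2"

definition D3 :: "quad \<Rightarrow> quad" where
  "D3 Q n m \<alpha> \<beta> x1 x2 x3 x4 = deriv (\<lambda>t. Q n m \<alpha> \<beta> x1 x2 t x4) x3"

definition D4 :: "quad \<Rightarrow> quad" where
  "D4 Q n m \<alpha> \<beta> x1 x2 x3 x4 = deriv (\<lambda>t. Q n m \<alpha> \<beta> x1 x2 x3 t) x4"

definition D\<alpha> :: "quad \<Rightarrow> quad" where
  "D\<alpha> Q n m \<alpha> \<beta> x1 x2 x3 x4 = deriv (\<lambda>t. Q n m t \<beta> x1 x2 x3 x4) \<alpha>"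

definition D\<beta> :: "quad \<Rightarrow> quad" where
  "D\<beta> Q n m \<alpha> \<beta> x1 x2 x3 x4 = deriv (\<lambda>t. Q n m \<alpha> t x1 x2 x3 x4) \<beta>"

definition on_quad :: "quad \<Rightarrow> complex \<Rightarrow> complex \<Rightarrow> (int \<Rightarrow> int \<Rightarrow> complex) \<Rightarrow> int \<Rightarrow> int \<Rightarrow> complex"
  where "on_quad F \<alpha> \<beta> u n m = F n m \<alpha> \<beta> (u n m) (u (n+1) m) (u n (m+1)) (u (n+1) (m+1))"

text \<open>A generic solution is a solution on the whole lattice along which the (multi-affine) equation
  determines, on each quadrilateral, the value at any vertex from the other three.\<close>

definition generic_solution :: "quad \<Rightarrow> complex \<Rightarrow> complex \<Rightarrow> (int \<Rightarrow> int \<Rightarrow> complex) \<Rightarrow> bool" where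
  "generic_solution Q \<alpha> \<beta> u \<longleftrightarrow>
     (\<forall>n m. on_quad Q \<alpha> \<beta> u n m = 0 \<and>
        on_quad (D1 Q) \<alpha> \<beta> u n m \<noteq> 0 \<and> on_quad (D2 Q) \<alpha> \<beta> u n m \<noteq> 0 \<and>
        on_quad (D3 Q) \<alpha> \<beta> u n m \<noteq> 0 \<and> on_quad (D4 Q) \<alpha> \<beta> u n m \<noteq> 0)"

datatype site = Centre | East | West | North | South

instance site :: finite
proof
  have "x \<in> {Centre, East, West, North, South}" for x :: site
    by (cases x) auto
  then show "finite (UNIV :: site set)"
    by (metis finite.emptyI finite.insertI finite_subset subsetI)
qed

definition stencil :: "(int \<Rightarrow> int \<Rightarrow> complex) \<Rightarrow> int \<Rightarrow> int \<Rightarrow> complex ^ site" where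
  "stencil u n m = (\<chi> s. case s of Centre \<Rightarrow> u n m | East \<Rightarrow> u (n+1) m | West \<Rightarrow> u (n-1) m
     | North \<Rightarrow> u n (m+1) | South \<Rightarrow> u n (m-1))"


section \<open>Five-point symmetries\<close>

text \<open>A five-point characteristic \<open>R n m \<alpha> \<beta>\<close> is a function of the stencil of \<open>u\<close> at \<open>(n,m)\<close>, with
  \<open>R n m \<alpha> \<beta> (stencil u n m)\<close> its value along \<open>u\<close>. It need not be defined everywhere, so it comes
  with a domain of definition \<open>D n m \<alpha> \<beta>\<close>.\<close>

type_synonym characteristic = "int \<Rightarrow> int \<Rightarrow> complex \<Rightarrow> complex \<Rightarrow> complex ^ site \<Rightarrow> complex"

type_synonym domain_family = "int \<Rightarrow> int \<Rightarrow> complex \<Rightarrow> complex \<Rightarrow> (complex ^ site) set"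

type_synonym param_coeff = "int \<Rightarrow> int \<Rightarrow> complex \<Rightarrow> complex \<Rightarrow> complex"

text \<open>Smoothness in complex variables: existence of a complex-linear total derivative.\<close>

definition holo_on :: "(complex ^ site \<Rightarrow> complex) \<Rightarrow> (complex ^ site) set \<Rightarrow> bool" where
  "holo_on F A \<longleftrightarrow>
     (\<forall>v\<in>A. \<exists>c :: complex ^ site. (F has_derivative (\<lambda>h. \<Sum>s\<in>UNIV. c $ s * h $ s)) (at v))"

text \<open>Some generic solution has to stay in the domains, as otherwise the symmetry criterion could
  be vacuous. Connectedness of the slices with fixed central value ensures that a holomorphic
  function on the domain which locally depends only on the central value is a (single-valued)
  function of it.\<close>

definition admissible_domain ::
    "quad \<Rightarrow> complex \<Rightarrow> complex \<Rightarrow> (int \<Rightarrow> int \<Rightarrow> (complex ^ site) set) \<Rightarrow> bool" where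
  "admissible_domain Q \<alpha> \<beta> A \<longleftrightarrow>
     (\<forall>n m. open (A n m) \<and> connected (A n m) \<and> (\<forall>c. connected {v \<in> A n m. v $ Centre = c})) \<and>
     (\<exists>u. generic_solution Q \<alpha> \<beta> u \<and> (\<forall>n m. stencil u n m \<in> A n m))"

text \<open>The infinitesimal criterion for \<open>R \<partial>\<^sub>u + \<xi> \<partial>\<^sub>\<alpha> + \<zeta> \<partial>\<^sub>\<beta>\<close> at fixed parameters.\<close>

definition infinitesimal_criterion ::
    "quad \<Rightarrow> domain_family \<Rightarrow> characteristic \<Rightarrow> param_coeff \<Rightarrow> param_coeff
      \<Rightarrow> complex \<Rightarrow> complex \<Rightarrow> bool" where
  "infinitesimal_criterion Q D R \<xi> \<zeta> \<alpha> \<beta> \<longleftrightarrow>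
     (\<forall>u n m. generic_solution Q \<alpha> \<beta> u \<longrightarrow>
        (\<forall>i\<in>{0,1}. \<forall>j\<in>{0,1}. stencil u (n+i) (m+j) \<in> D (n+i) (m+j) \<alpha> \<beta>) \<longrightarrow>
          R n m \<alpha> \<beta> (stencil u n m) * on_quad (D1 Q) \<alpha> \<beta> u n m
        + R (n+1) m \<alpha> \<beta> (stencil u (n+1) m) * on_quad (D2 Q) \<alpha> \<beta> u n m
        + R n (m+1) \<alpha> \<beta> (stencil u n (m+1)) * on_quad (D3 Q) \<alpha> \<beta> u n m
        + R (n+1) (m+1) \<alpha> \<beta> (stencil u (n+1) (m+1)) * on_quad (D4 Q) \<alpha> \<beta> u n m
        + \<xi> n m \<alpha> \<beta> * on_quad (D\<alpha> Q) \<alpha> \<beta> u n m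
        + \<zeta> n m \<alpha> \<beta> * on_quad (D\<beta> Q) \<alpha> \<beta> u n m = 0)"

text \<open>Here \<open>P\<close> is the set of lattice parameters for which the vector field is given.
  Local symmetries, \<open>\<xi> = \<zeta> = 0\<close>, are included.\<close>

definition five_point_symmetry ::
    "quad \<Rightarrow> (complex \<times> complex) set \<Rightarrow> domain_family \<Rightarrow> characteristic
      \<Rightarrow> param_coeff \<Rightarrow> param_coeff \<Rightarrow> bool" where
  "five_point_symmetry Q P D R \<xi> \<zeta> \<longleftrightarrow>
     (\<forall>(\<alpha>, \<beta>) \<in> P. admissible_domain Q \<alpha> \<beta> (\<lambda>n m. D n m \<alpha> \<beta>) \<and>
        (\<forall>n m. holo_on (R n m \<alpha> \<beta>) (D n m \<alpha> \<beta>)) \<and>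
        infinitesimal_criterion Q D R \<xi> \<zeta> \<alpha> \<beta>)"

definition depends_only_on :: "site set \<Rightarrow> characteristic \<Rightarrow> bool" where
  "depends_only_on S R \<longleftrightarrow>
     (\<forall>n m \<alpha> \<beta> v w. (\<forall>s\<in>S. v $ s = w $ s) \<longrightarrow> R n m \<alpha> \<beta> v = R n m \<alpha> \<beta> w)"

definition local_three_point_symmetry ::
    "quad \<Rightarrow> (complex \<times> complex) set \<Rightarrow> domain_family \<Rightarrow> characteristic \<Rightarrow> bool" where
  "local_three_point_symmetry Q P D R \<longleftrightarrow>
     five_point_symmetry Q P D R (\<lambda>_ _ _ _. 0) (\<lambda>_ _ _ _. 0) \<and>
     (depends_only_on {West, Centre, East} R \<or> depends_only_on {South, Centre, North} R)"


section \<open>The characteristics \<open>R\<^sub>n\<close> and \<open>R\<^sub>m\<close>\<close>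

definition Rn :: "family \<Rightarrow> complex \<Rightarrow> complex \<Rightarrow> complex \<Rightarrow> characteristic" where
  "Rn fam \<sigma> \<epsilon> \<delta> n m \<alpha> \<beta> v =
     ff fam \<sigma> \<epsilon> \<delta> n m (v $ Centre) (v $ East) \<alpha> / (v $ East - v $ West)
       - 1/2 * deriv (\<lambda>x. ff fam \<sigma> \<epsilon> \<delta> n m (v $ Centre) x \<alpha>) (v $ East)"

definition Rm :: "family \<Rightarrow> complex \<Rightarrow> complex \<Rightarrow> complex \<Rightarrow> characteristic" where
  "Rm fam \<sigma> \<epsilon> \<delta> n m \<alpha> \<beta> v =
     ff fam \<sigma> \<epsilon> \<delta> n m (v $ Centre) (v $ North) \<beta> / (v $ North - v $ South)
       - 1/2 * deriv (\<lambda>x. ff fam \<sigma> \<epsilon> \<delta> n m (v $ Centre) x \<beta>) (v $ North)"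

definition dom_n :: domain_family where
  "dom_n n m \<alpha> \<beta> = {v. v $ East \<noteq> v $ West}"

definition dom_m :: domain_family where
  "dom_m n m \<alpha> \<beta> = {v. v $ North \<noteq> v $ South}"

definition five_point_form :: "family \<Rightarrow> complex \<Rightarrow> complex \<Rightarrow> complex
    \<Rightarrow> (int \<Rightarrow> complex \<Rightarrow> complex \<Rightarrow> complex) \<Rightarrow> (int \<Rightarrow> complex \<Rightarrow> complex \<Rightarrow> complex)
    \<Rightarrow> (int \<Rightarrow> int \<Rightarrow> complex \<Rightarrow> complex \<Rightarrow> complex \<Rightarrow> complex) \<Rightarrow> characteristic" where
  "five_point_form fam \<sigma> \<epsilon> \<delta> a b \<psi> n m \<alpha> \<beta> v =
     a n \<alpha> \<beta> * Rn fam \<sigma> \<epsilon> \<delta> n m \<alpha> \<beta> v + b m \<alpha> \<beta> * Rm fam \<sigma> \<epsilon> \<delta> n m \<alpha> \<beta> v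
       + 1/2 * \<psi> n m (v $ Centre) \<alpha> \<beta>"

end

theory Submission
  imports Defs
begin

text \<open>All three families have the form \<open>a (x1 x2 + x3 x4) + b (x1 x3 + x2 x4)\<close> plus diagonal, linear and
  constant terms whose coefficients depend only on the colour (the parity of \<open>n + m\<close>) of the vertices
  involved, and this class is invariant under reflections and transposition of the lattice.

  Generic solutions are flexible: a row on which the discriminant \<open>f\<close> does not vanish extends row by
  row, because each new row is determined by one of its values through injective Moebius maps and only
  countably many choices of that value are bad. Hence, near a given solution, the symmetry criterion
  holds for all values of the seven independent variables around a quadrilateral. Differentiating it
  with respect to the westernmost value shows that \<open>\<partial>R/\<partial>u\<^sub>W\<close> does not depend on the northern and
  southern values and that \<open>\<lambda> = (u\<^sub>E - u\<^sub>W)\<^sup>2 / f \<cdot> \<partial>R/\<partial>u\<^sub>W\<close> takes the same value at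
  \<open>(n,m)\<close> and \<open>(n,m+1)\<close>. As \<open>u(n,m+1)\<close> is a free variable in this equality, the gradient of \<open>\<lambda>\<close>
  satisfies a linear system whose determinant is a nonzero polynomial, so \<open>\<lambda>\<close> is a constant that
  depends on \<open>n\<close> only. Reflections and transposition give the other three derivatives of \<open>R\<close>, and the
  identity theorem on the slices with fixed central value yields the function \<open>\<psi>\<close>.\<close>

text \<open>The criterion is known only along solutions on all of Z^2 without a degenerate cell, so
  the values near a cell cannot simply be varied: each variation must extend to the whole lattice.
  One row can be prescribed exactly and one column up to small errors; continuity of the
  characteristic and of the parameter terms removes the errors. The discriminant enters because, on
  solutions, the product of the derivatives of the equation at the two ends of an edge is the
  discriminant of the opposite edge. For the known symmetry the western derivative is
  \<open>f\<close> divided by the square of the difference, so the quotient \<lambda> turns the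
  claim into a constancy statement. The terms with \<xi> and \<zeta> do not contain the westernmost
  value and vanish at the first differentiation. The linear system is tractable because the diagonal
  coefficients of neighbouring colours have product zero; its determinant could vanish identically
  only if the vertical discriminant did, which genericity excludes. Smoothness means one complex
  derivative at each point, so second derivatives must first be obtained from Cauchy's
  formula.\<close>

unbundle no fps_syntax

subsection \<open>Holomorphic functions of the stencil\<close>

definition pd :: "site \<Rightarrow> (complex ^ site \<Rightarrow> complex) \<Rightarrow> complex ^ site \<Rightarrow> complex" where
  "pd s F v = deriv (\<lambda>t. F (v + axis s t)) 0"

lemma axis_component: "axis s t $ r = (if r = s then t else 0)"
  by (simp add: axis_def)

lemma axis_0 [simp]: "axis s (0::complex) = (0 :: complex ^ site)"
  by (simp add: vec_eq_iff axis_component)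

lemma bounded_linear_axis: "bounded_linear (\<lambda>t::complex. axis s t :: complex ^ site)"
proof -
  have "(\<lambda>t::complex. axis s t) = (\<lambda>t. \<chi> r. if r = s then t else 0)"
    by (auto simp: axis_def vec_eq_iff)
  moreover have "linear (\<lambda>t::complex. axis s t :: complex ^ site)"
    by (intro linearI) (auto simp: vec_eq_iff axis_component)
  ultimately show ?thesis
    by (simp add: linear_conv_bounded_linear)
qed

lemma vec_eq_sum_axis: "v = (\<Sum>s\<in>UNIV. axis s (v $ s))" for v :: "complex ^ site"
  by (simp add: vec_eq_iff axis_component sum.delta)

text \<open>Restriction to coordinate lines identifies the unnamed coefficient vector in
  \<open>holo_on\<close> with the partial derivatives \<open>pd\<close>.\<close>

lemma holo_onE:
  assumes "holo_on F A" "v \<in> A"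
  shows "(F has_derivative (\<lambda>h. \<Sum>s\<in>UNIV. pd s F v * h $ s)) (at v)"
proof -
  obtain c :: "complex ^ site" where c: "(F has_derivative (\<lambda>h. \<Sum>s\<in>UNIV. c $ s * h $ s)) (at v)"
    using assms unfolding holo_on_def by blast
  have "pd s F v = c $ s" for s
  proof -
    have "((\<lambda>t. v + axis s t) has_derivative (\<lambda>t. axis s t)) (at 0)"
      by (auto intro!: derivative_eq_intros bounded_linear.has_derivative[OF bounded_linear_axis])
    moreover have "(F has_derivative (\<lambda>h. \<Sum>s\<in>UNIV. c $ s * h $ s)) (at (v + axis s 0))"
      using c by (simp add: axis_0)
    ultimately have "((\<lambda>t. F (v + axis s t)) has_derivative (\<lambda>t. \<Sum>r\<in>UNIV. c $ r * axis s t $ r)) (at 0)"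
      by (rule has_derivative_compose)
    moreover have "(\<Sum>r\<in>UNIV. c $ r * axis s t $ r) = c $ s * t" for t
      by (simp add: axis_component if_distrib sum.delta cong: if_cong)
    ultimately have "((\<lambda>t. F (v + axis s t)) has_field_derivative c $ s) (at 0)"
      by (simp add: has_field_derivative_def)
    then show ?thesis
      unfolding pd_def by (rule DERIV_imp_deriv)
  qed
  then show ?thesis
    using c by simp
qed

lemma holo_onI:
  assumes "\<And>v. v \<in> A \<Longrightarrow> (F has_derivative (\<lambda>h. \<Sum>s\<in>UNIV. c v s * h $ s)) (at v)"
  shows "holo_on F A"
  unfolding holo_on_def
proof
  fix v assume "v \<in> A"
  from assms[OF this] show "\<exists>c::complex ^ site. (F has_derivative (\<lambda>h. \<Sum>s\<in>UNIV. c $ s * h $ s)) (at v)"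
    by (intro exI[of _ "\<chi> s. c v s"]) simp
qed

lemma holo_on_subset: "holo_on F A \<Longrightarrow> B \<subseteq> A \<Longrightarrow> holo_on F B"
  unfolding holo_on_def by blast

lemma holo_on_isCont: "holo_on F A \<Longrightarrow> v \<in> A \<Longrightarrow> isCont F v"
  using holo_onE has_derivative_continuous by blast

lemma holo_on_chain:
  fixes \<gamma> :: "complex \<Rightarrow> complex ^ site"
  assumes F: "holo_on F A" "\<gamma> t \<in> A"
    and \<gamma>: "\<And>s. ((\<lambda>t. \<gamma> t $ s) has_field_derivative \<gamma>' s) (at t)"
  shows "((\<lambda>t. F (\<gamma> t)) has_field_derivative (\<Sum>s\<in>UNIV. pd s F (\<gamma> t) * \<gamma>' s)) (at t)"
proof -
  have "((\<lambda>t. \<Sum>s\<in>UNIV. axis s (\<gamma> t $ s)) has_derivative (\<lambda>h. \<Sum>s\<in>UNIV. axis s (\<gamma>' s * h))) (at t)"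
    using \<gamma> unfolding has_field_derivative_def
    by (intro has_derivative_sum bounded_linear.has_derivative[OF bounded_linear_axis]) auto
  then have "(\<gamma> has_derivative (\<lambda>h. \<Sum>s\<in>UNIV. axis s (\<gamma>' s * h))) (at t)"
    by (simp flip: vec_eq_sum_axis)
  from has_derivative_compose[OF this holo_onE[OF F]]
  have "((\<lambda>t. F (\<gamma> t)) has_derivative (\<lambda>h. \<Sum>s\<in>UNIV. pd s F (\<gamma> t) * (\<Sum>r\<in>UNIV. axis r (\<gamma>' r * h)) $ s)) (at t)" .
  moreover have "(\<Sum>s\<in>UNIV. pd s F (\<gamma> t) * (\<Sum>r\<in>UNIV. axis r (\<gamma>' r * h)) $ s)
      = (\<Sum>s\<in>UNIV. pd s F (\<gamma> t) * \<gamma>' s) * h" for h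
    by (simp add: axis_component sum.delta sum_distrib_right mult.assoc)
  ultimately show ?thesis
    by (simp add: has_field_derivative_def)
qed

lemma has_field_derivative_pd:
  assumes F: "holo_on F A" "v \<in> A"
  shows "((\<lambda>t. F (v + axis s t)) has_field_derivative pd s F v) (at 0)"
proof -
  have "((\<lambda>t. (v + axis s t) $ r) has_field_derivative (if r = s then 1 else 0)) (at 0)" for r
    by (auto simp: axis_component intro!: derivative_eq_intros)
  from holo_on_chain[where \<gamma>="\<lambda>t. v + axis s t" and t=0, OF F(1) _ this]
  show ?thesis
    using F(2) by (simp add: axis_0 if_distrib sum.delta cong: if_cong)
qed

lemma pd_line:
  assumes F: "holo_on F A" "v + axis s t \<in> A"
  shows "((\<lambda>t. F (v + axis s t)) has_field_derivative pd s F (v + axis s t)) (at t)"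
proof -
  have "((\<lambda>t. (v + axis s t) $ r) has_field_derivative (if r = s then 1 else 0)) (at t)" for r
    by (auto simp: axis_component intro!: derivative_eq_intros)
  from holo_on_chain[where \<gamma>="\<lambda>t. v + axis s t" and t=t, OF F(1) _ this]
  show ?thesis
    using F(2) by (simp add: if_distrib sum.delta cong: if_cong)
qed

lemma norm_axis_complex [simp]: "norm (axis s t :: complex ^ site) = norm t"
  by (simp add: norm_vec_def L2_set_def axis_component if_distrib[of norm] if_distrib[of "\<lambda>x. x\<^sup>2"] sum.delta cong: if_cong)

section \<open>Cauchy's integral formula and holomorphy of the partial derivatives\<close>

definition circ :: "real \<Rightarrow> real \<Rightarrow> complex" where
  "circ r x = r * exp (2 * of_real pi * \<i> * x)"

lemma circ_nonzero: "r > 0 \<Longrightarrow> circ r x \<noteq> 0"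
  by (simp add: circ_def)

lemma continuous_on_circ: "continuous_on S (circ r)"
  unfolding circ_def by (intro continuous_intros)

text \<open>Cauchy's formula for the first derivative along a coordinate line; the velocity of the
  circle cancels one of the two powers in the denominator. The right-hand side contains no
  derivative of \<open>F\<close>, so it can be differentiated in \<open>v\<close> under the
  integral.\<close>

lemma pd_integral:
  assumes F: "holo_on F A" and r: "r > 0" and sub: "cball v r \<subseteq> A"
  shows "pd s F v = integral (cbox 0 1) (\<lambda>x. F (v + axis s (circ r x)) * inverse (circ r x))"
proof -
  define f where "f = (\<lambda>u. F (v + axis s u))"
  have z: "circ r = circlepath 0 r"
    by (simp add: circ_def circlepath fun_eq_iff)
  note z0 = circ_nonzero[OF r]
  have inA: "v + axis s u \<in> A" if "u \<in> cball 0 r" for u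
    using that sub by (auto simp: dist_norm subset_iff)
  have der: "(f has_field_derivative pd s F (v + axis s u)) (at u)" if "u \<in> cball 0 r" for u
    using pd_line[OF F inA[OF that]] unfolding f_def .
  then have "continuous_on (cball 0 r) f"
    by (intro continuous_at_imp_continuous_on ballI DERIV_isCont) blast
  moreover have "f holomorphic_on ball 0 r"
    unfolding holomorphic_on_open[OF open_ball] using der by (meson ball_subset_cball subsetD)
  ultimately have "contour_integral (circlepath 0 r) (\<lambda>u. f u / (u - 0)^2) = (2 * pi * \<i>) * deriv f 0"
    using r by (intro Cauchy_contour_integral_circlepath_2) auto
  then have "(2 * pi * \<i>) * pd s F v
     = integral {0..1} (\<lambda>x. f (circlepath 0 r x) / (circlepath 0 r x)^2 * vector_derivative (circlepath 0 r) (at x))"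
    unfolding contour_integral_integral pd_def f_def by simp
  also have "\<dots> = integral {0..1} (\<lambda>x. (2 * pi * \<i>) * (f (circ r x) * inverse (circ r x)))"
  proof (rule integral_cong)
    fix x :: real
    have "vector_derivative (circlepath 0 r) (at x) = 2 * pi * \<i> * circ r x"
      by (simp add: vector_derivative_circlepath circ_def mult_ac)
    then show "f (circlepath 0 r x) / (circlepath 0 r x)^2 * vector_derivative (circlepath 0 r) (at x)
        = (2 * pi * \<i>) * (f (circ r x) * inverse (circ r x))"
      unfolding z[symmetric] using z0[of x] by (simp add: power2_eq_square field_simps)
  qed
  also have "\<dots> = (2 * pi * \<i>) * integral {0..1} (\<lambda>x. f (circ r x) * inverse (circ r x))"
    by simp
  finally show ?thesis
    by (simp add: f_def)
qed

text \<open>One radius must serve all centres near \<open>v0\<close>, because the integral formula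
  will be differentiated in its centre. Half the radius of a closed ball inside \<open>A\<close>
  suffices.\<close>

lemma polydisc_nbhd:
  fixes A :: "(complex ^ site) set"
  assumes "open A" "v0 \<in> A"
  obtains r where "r > 0" "\<And>v. v \<in> ball v0 r \<Longrightarrow> cball v r \<subseteq> A"
    "\<And>v x s. v \<in> ball v0 r \<Longrightarrow> v + axis s (circ r x) \<in> A"
proof -
  obtain d where d: "d > 0" "cball v0 d \<subseteq> A"
    using assms open_contains_cball by blast
  have sub: "cball v (d/2) \<subseteq> A" if "v \<in> ball v0 (d/2)" for v
  proof
    fix w assume "w \<in> cball v (d/2)"
    then have "w \<in> cball v0 d" using that dist_triangle[of v0 w v] by simp
    then show "w \<in> A" using d(2) by blast
  qed
  have in_cball: "v + axis s (circ (d/2) x) \<in> cball v (d/2)" for v :: "complex ^ site" and s x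
    using d(1) by (simp add: dist_norm circ_def norm_mult)
  show thesis
  proof (rule that[OF _ sub])
    show "v + axis s (circ (d/2) x) \<in> A" if "v \<in> ball v0 (d/2)" for v x s
      using sub[OF that] in_cball by blast
  qed (use d(1) in auto)
qed

lemma continuous_on_axis: "continuous_on S f \<Longrightarrow> continuous_on S (\<lambda>x. axis s (f x :: complex) :: complex ^ site)"
  by (rule continuous_on_compose2[OF linear_continuous_on[OF bounded_linear_axis]]) auto

text \<open>Prepares \<open>holo_on_pd\<close>: the Leibniz rule asks for a jointly continuous
  derivative of the integrand, while \<open>holo_on\<close> supplies only differentiability at each
  point.\<close>

lemma continuous_on_pd:
  assumes F: "holo_on F A" and A: "open A"
  shows "continuous_on A (pd s F)"
proof -
  have "isCont (pd s F) v0" if v0: "v0 \<in> A" for v0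
  proof -
    obtain r where r: "r > 0" "\<And>v. v \<in> ball v0 r \<Longrightarrow> cball v r \<subseteq> A"
      "\<And>v x s. v \<in> ball v0 r \<Longrightarrow> v + axis s (circ r x) \<in> A"
      using polydisc_nbhd[OF A v0] by metis
    have Fc: "continuous_on A F"
      using F holo_on_isCont continuous_at_imp_continuous_on by blast
    have "continuous_on (ball v0 r \<times> cbox 0 1) (\<lambda>(v,x::real). F (v + axis s (circ r x)) * inverse (circ r x))"
      unfolding split_def
      by (intro continuous_intros continuous_on_compose2[OF Fc] continuous_on_compose2[OF continuous_on_circ]
        continuous_on_axis) (use circ_nonzero r in auto)
    then have "continuous_on (ball v0 r) (\<lambda>v. integral (cbox 0 1) (\<lambda>x. F (v + axis s (circ r x)) * inverse (circ r x)))"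
      by (rule integral_continuous_on_param)
    then have "continuous_on (ball v0 r) (pd s F)"
      using r(2) by (subst continuous_on_cong[OF refl pd_integral[OF F r(1)]]) auto
    then show ?thesis
      using r(1) by (simp add: continuous_on_eq_continuous_at)
  qed
  then show ?thesis
    by (simp add: continuous_at_imp_continuous_on)
qed

text \<open>The Leibniz rule takes derivatives as elements of the space of bounded linear maps; this
  is the complex-linear functional with coefficients \<open>c\<close> in that form.\<close>

lemma blinfun_complex_linear:
  fixes c :: "site \<Rightarrow> complex"
  shows "blinfun_apply (\<Sum>s\<in>UNIV. blinfun_mult_right (c s) o\<^sub>L Blinfun (\<lambda>h. h $ s)) h = (\<Sum>s\<in>UNIV. c s * h $ s)"
proof -
  have "bounded_linear (\<lambda>h::complex ^ site. h $ s)" for s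
    by (rule bounded_linear_vec_nth)
  then show ?thesis
    by (simp add: blinfun.sum_left bounded_linear_Blinfun_apply)
qed

text \<open>The Cauchy integral is differentiated in its centre under the integral sign. The result
  is again complex linear, its coefficients being the integrals of those of the integrand.\<close>

lemma holo_on_pd:
  assumes F: "holo_on F A" and A: "open A"
  shows "holo_on (pd s F) A"
proof -
  let ?B = "\<lambda>c::site \<Rightarrow> complex. \<Sum>s\<in>UNIV. blinfun_mult_right (c s) o\<^sub>L Blinfun (\<lambda>h::complex ^ site. h $ s)"
  have "\<exists>c::complex ^ site. (pd s F has_derivative (\<lambda>h. \<Sum>r\<in>UNIV. c $ r * h $ r)) (at v0)" if v0: "v0 \<in> A" for v0
  proof -
    obtain r where r: "r > 0" "\<And>v. v \<in> ball v0 r \<Longrightarrow> cball v r \<subseteq> A"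
      and inA: "\<And>v x s. v \<in> ball v0 r \<Longrightarrow> v + axis s (circ r x) \<in> A"
      using polydisc_nbhd[OF A v0] by metis
    note z0 = circ_nonzero[OF r(1)]
    have Fc: "continuous_on A F"
      using F holo_on_isCont continuous_at_imp_continuous_on by blast
    define c where "c = (\<lambda>v x q. inverse (circ r x) * pd q F (v + axis s (circ r x)))"
    have cc: "continuous_on (ball v0 r \<times> cbox 0 1) (\<lambda>p. c (fst p) (snd p) q)" for q
      unfolding c_def
      by (intro continuous_intros continuous_on_compose2[OF continuous_on_pd[OF F A]] continuous_on_compose2[OF continuous_on_circ]
        continuous_on_axis)
        (use z0 inA in auto)
    have cB: "continuous_on (ball v0 r \<times> cbox 0 1) (\<lambda>(v,x::real). ?B (c v x))"
      unfolding split_def by (intro continuous_intros cc)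
    have "((\<lambda>v. integral (cbox 0 1) (\<lambda>x. F (v + axis s (circ r x)) * inverse (circ r x))) has_derivative
        blinfun_apply (integral (cbox 0 1) (\<lambda>x. ?B (c v0 x)))) (at v0 within ball v0 r)"
    proof (rule leibniz_rule)
      fix v and x :: real assume v: "v \<in> ball v0 r"
      have "((\<lambda>v. v + axis s (circ r x)) has_derivative (\<lambda>h. h)) (at v)"
        by (auto intro!: derivative_eq_intros)
      from has_derivative_compose[OF this holo_onE[OF F inA[OF v]]]
      have "((\<lambda>v. F (v + axis s (circ r x)) * inverse (circ r x)) has_derivative
          (\<lambda>h. (\<Sum>q\<in>UNIV. pd q F (v + axis s (circ r x)) * h $ q) * inverse (circ r x))) (at v)"
        by (rule has_derivative_mult_left)
      moreover have "(\<lambda>h. (\<Sum>q\<in>UNIV. pd q F (v + axis s (circ r x)) * h $ q) * inverse (circ r x)) = blinfun_apply (?B (c v x))"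
        by (simp add: fun_eq_iff blinfun_complex_linear c_def sum_distrib_left sum_distrib_right mult_ac)
      ultimately show "((\<lambda>v. F (v + axis s (circ r x)) * inverse (circ r x)) has_derivative blinfun_apply (?B (c v x))) (at v within ball v0 r)"
        by (simp add: has_derivative_at_withinI)
    next
      fix v assume v: "v \<in> ball v0 r"
      show "(\<lambda>x. F (v + axis s (circ r x)) * inverse (circ r x)) integrable_on cbox 0 1"
        by (intro integrable_continuous continuous_intros continuous_on_compose2[OF Fc] continuous_on_compose2[OF continuous_on_circ]
          continuous_on_axis)
          (use z0 inA[OF v] in auto)
    qed (use cB r in auto)
    then have "((\<lambda>v. integral (cbox 0 1) (\<lambda>x. F (v + axis s (circ r x)) * inverse (circ r x))) has_derivative
        blinfun_apply (integral (cbox 0 1) (\<lambda>x. ?B (c v0 x)))) (at v0)"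
      using r by (simp add: at_within_open[OF _ open_ball])
    then have "(pd s F has_derivative blinfun_apply (integral (cbox 0 1) (\<lambda>x. ?B (c v0 x)))) (at v0)"
    proof (rule has_derivative_transform_within_open[OF _ open_ball])
      fix v assume "v \<in> ball v0 r"
      then show "integral (cbox 0 1) (\<lambda>x. F (v + axis s (circ r x)) * inverse (circ r x)) = pd s F v"
        using pd_integral[OF F r(1) r(2), of v s] by simp
    qed (use r in auto)
    moreover have "blinfun_apply (integral (cbox 0 1) (\<lambda>x. ?B (c v0 x)))
        = (\<lambda>h. \<Sum>q\<in>UNIV. integral (cbox 0 1) (\<lambda>x. c v0 x q) * h $ q)"
    proof
      fix h
      have cont: "continuous_on (cbox 0 1) (\<lambda>x::real. c v0 x q)" for q
        using continuous_on_compose2[OF cc[of q], of "cbox 0 1" "\<lambda>x. (v0, x)"] r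
        by (simp add: continuous_on_Pair image_subset_iff)
      have "(\<lambda>x::real. ?B (c v0 x)) integrable_on cbox 0 1"
        by (intro integrable_continuous continuous_intros cont)
      then have "blinfun_apply (integral (cbox 0 1) (\<lambda>x. ?B (c v0 x))) h = integral (cbox 0 1) (\<lambda>x. blinfun_apply (?B (c v0 x)) h)"
        by (rule blinfun_apply_integral)
      also have "\<dots> = integral (cbox 0 1) (\<lambda>x. \<Sum>q\<in>UNIV. c v0 x q * h $ q)"
        by (simp only: blinfun_complex_linear)
      also have "\<dots> = (\<Sum>q\<in>UNIV. integral (cbox 0 1) (\<lambda>x. c v0 x q * h $ q))"
        by (intro integral_sum integrable_continuous continuous_intros cont) auto
      finally show "blinfun_apply (integral (cbox 0 1) (\<lambda>x. ?B (c v0 x))) h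
        = (\<Sum>q\<in>UNIV. integral (cbox 0 1) (\<lambda>x. c v0 x q) * h $ q)" by simp
    qed
    ultimately have "(pd s F has_derivative (\<lambda>h. \<Sum>q\<in>UNIV. integral (cbox 0 1) (\<lambda>x. c v0 x q) * h $ q)) (at v0)"
      by simp
    then show ?thesis
      by (intro exI[of _ "\<chi> q. integral (cbox 0 1) (\<lambda>x. c v0 x q)"]) simp
  qed
  then show ?thesis
    unfolding holo_on_def by blast
qed

section \<open>The identity theorem, by restriction to complex lines\<close>

lemma convex_line_ball: "convex ((\<lambda>t::complex. p + t *s (q - p)) -` ball c r)" for p q c :: "complex ^ site"
proof -
  define \<gamma> where "\<gamma> = (\<lambda>t::complex. p + t *s (q - p))"
  have "\<gamma> ((1 - x) *\<^sub>R s + x *\<^sub>R t) = (1 - x) *\<^sub>R \<gamma> s + x *\<^sub>R \<gamma> t" for x s t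
    by (simp add: \<gamma>_def vec_eq_iff scaleR_conv_of_real[where 'a=complex] algebra_simps)
  then have "convex (\<gamma> -` ball c r)"
    unfolding convex_alt using convex_ball[of c r] by (auto simp: convex_alt simp del: mem_ball)
  then show ?thesis by (simp add: \<gamma>_def)
qed

text \<open>The constraint \<open>v $ i = c i\<close> for \<open>i \<in> I\<close> covers both open subsets of the whole space
  (\<open>I = {}\<close>) and slices.\<close>

lemma holo_identity:
  fixes S :: "(complex ^ site) set"
  assumes F: "holo_on F A"
    and S: "connected S" "S \<subseteq> A" "\<And>v. v \<in> S \<Longrightarrow> \<exists>r>0. ball v r \<inter> {w. \<forall>i\<in>I. w $ i = c i} \<subseteq> S"
    and I: "\<And>v i. v \<in> S \<Longrightarrow> i \<in> I \<Longrightarrow> v $ i = c i"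
    and p: "p \<in> S" "r > 0" "\<And>v. v \<in> S \<Longrightarrow> dist p v < r \<Longrightarrow> F v = 0"
    and q: "q \<in> S"
  shows "F q = 0"
proof -
  let ?L = "{w. \<forall>i\<in>I. w $ i = c i}"
  \<comment> \<open>The points near which \<open>F\<close> vanishes on \<open>S\<close>; this set
    will be open and closed in \<open>S\<close>.\<close>
  define Z where "Z = {v \<in> S. \<exists>r>0. \<forall>w\<in>S. dist v w < r \<longrightarrow> F w = 0}"
  \<comment> \<open>A complex line joins \<open>w\<close> to a point \<open>u\<close> of
    \<open>Z\<close> in the same ball. It stays in the slice and meets the ball in a convex
    parameter set, so the one-variable identity theorem carries the zero from \<open>u\<close> to
    \<open>w\<close>.\<close>
  have key: "F w = 0"
    if v: "v \<in> S" and d: "ball v d \<inter> ?L \<subseteq> S" and u: "u \<in> Z" "dist v u < d" and w: "w \<in> S" "dist v w < d" for v d u w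
  proof -
    obtain e where e: "e > 0" "\<And>x. x \<in> S \<Longrightarrow> dist u x < e \<Longrightarrow> F x = 0" and uS: "u \<in> S"
      using u unfolding Z_def by blast
    define \<gamma> where "\<gamma> = (\<lambda>t::complex. u + t *s (w - u))"
    have \<gamma>c: "continuous_on UNIV \<gamma>"
      unfolding \<gamma>_def vector_scalar_mult_def plus_vec_def by (intro continuous_intros)
    define T where "T = \<gamma> -` ball v d"
    have T: "open T" unfolding T_def by (rule open_vimage[OF open_ball \<gamma>c])
    have "convex T" unfolding T_def \<gamma>_def by (rule convex_line_ball)
    then have Tc: "connected T" by (rule convex_connected)
    have \<gamma>S: "\<gamma> t \<in> S" if "t \<in> T" for t
    proof -
      have "\<gamma> t \<in> ?L" using I[OF uS] I[OF w(1)] by (simp add: \<gamma>_def)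
      then show ?thesis using that d unfolding T_def by blast
    qed
    have hol: "(F \<circ> \<gamma>) holomorphic_on T"
      unfolding holomorphic_on_open[OF T]
    proof
      fix t assume t: "t \<in> T"
      have "((\<lambda>t. \<gamma> t $ s) has_field_derivative (w - u) $ s) (at t)" for s
        unfolding \<gamma>_def by (auto intro!: derivative_eq_intros)
      from holo_on_chain[OF F _ this] \<gamma>S[OF t] S(2)
      show "\<exists>D. (F \<circ> \<gamma> has_field_derivative D) (at t)"
        unfolding o_def by blast
    qed
    have g01: "\<gamma> 0 = u" "\<gamma> 1 = w" by (simp_all add: \<gamma>_def)
    then have T01: "0 \<in> T" "1 \<in> T" using u w by (auto simp: T_def)
    have "open (T \<inter> \<gamma> -` ball u e)"
      by (intro open_Int T open_vimage[OF open_ball \<gamma>c])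
    moreover have "0 \<in> T \<inter> \<gamma> -` ball u e" using T01 g01 e by simp
    moreover have "(F \<circ> \<gamma>) t = 0" if "t \<in> T \<inter> \<gamma> -` ball u e" for t
      using that e(2) \<gamma>S by simp
    ultimately have "(F \<circ> \<gamma>) 1 = (\<lambda>_. 0) (1::complex)"
      using T Tc hol T01 by (intro analytic_continuation_open[of "T \<inter> \<gamma> -` ball u e" T "F \<circ> \<gamma>" "\<lambda>_. 0" 1]) auto
    then show ?thesis using g01 by simp
  qed
  have "Z = {} \<or> Z = S"
  proof (rule connected_clopen[THEN iffD1, rule_format, OF S(1)], intro conjI)
    show "openin (top_of_set S) Z"
      unfolding openin_euclidean_subtopology_iff
    proof (intro conjI ballI)
      fix x assume "x \<in> Z"
      then obtain r where r: "r > 0" "\<forall>w\<in>S. dist x w < r \<longrightarrow> F w = 0" unfolding Z_def by blast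
      have "y \<in> Z" if "y \<in> S" "dist y x < r / 2" for y
      proof -
        have "F w = 0" if "w \<in> S" "dist y w < r / 2" for w
          using r(2) that \<open>dist y x < r / 2\<close> by (metis dist_commute dist_triangle_half_l)
        then show ?thesis using r \<open>y \<in> S\<close> unfolding Z_def by (auto intro!: exI[of _ "r / 2"])
      qed
      then show "\<exists>e>0. \<forall>x'\<in>S. dist x' x < e \<longrightarrow> x' \<in> Z"
        using r(1) by (intro exI[of _ "r / 2"]) auto
    qed (auto simp: Z_def)
    show "closedin (top_of_set S) Z"
      unfolding closedin_limpt
    proof (intro conjI allI impI)
      fix x assume x: "x islimpt Z \<and> x \<in> S"
      then obtain d where d: "d > 0" "ball x d \<inter> ?L \<subseteq> S" using S(3) by blast
      then obtain u where "u \<in> Z" "dist u x < d" using x islimpt_approachable by blast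
      then show "x \<in> Z" using key[OF _ d(2), of u] x d(1) unfolding Z_def by (auto simp: dist_commute)
    qed (auto simp: Z_def)
  qed
  moreover have "p \<in> Z" using p unfolding Z_def by blast
  ultimately have "q \<in> Z" using q by blast
  then show ?thesis unfolding Z_def using q by auto
qed

lemma holo_identity_open:
  assumes "holo_on F A" "open A" "connected A" "p \<in> A" "r > 0" "\<And>v. dist p v < r \<Longrightarrow> F v = 0" "q \<in> A"
  shows "F q = 0"
  using holo_identity[of F A A "{}" undefined p r q] assms
  by (simp add: open_contains_ball)

subsection \<open>Two-coloured quadrilateral equations\<close>

text \<open>The vertices \<open>x1\<close>, \<open>x4\<close> have colour \<open>j\<close>, the
  vertices \<open>x2\<close>, \<open>x3\<close> colour \<open>j+1\<close>; diagonal and linear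
  coefficients are indexed by the colour of the vertices they multiply.\<close>

definition quad :: "complex \<Rightarrow> complex \<Rightarrow> complex \<Rightarrow> (int \<Rightarrow> complex) \<Rightarrow> (int \<Rightarrow> complex) \<Rightarrow> int
    \<Rightarrow> complex \<Rightarrow> complex \<Rightarrow> complex \<Rightarrow> complex \<Rightarrow> complex" where
  "quad a b k e l j x1 x2 x3 x4 = a * (x1 * x2 + x3 * x4) + b * (x1 * x3 + x2 * x4)
     + e j * x1 * x4 + e (j+1) * x2 * x3 + l j * (x1 + x4) + l (j+1) * (x2 + x3) + k"

text \<open>The derivative of \<^const>\<open>quad\<close> with respect to a vertex of colour \<open>j\<close> whose horizontal,
  vertical and diagonal neighbours carry the values \<open>h\<close>, \<open>v\<close>, \<open>d\<close>.\<close>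

definition dq :: "complex \<Rightarrow> complex \<Rightarrow> (int \<Rightarrow> complex) \<Rightarrow> (int \<Rightarrow> complex) \<Rightarrow> int
    \<Rightarrow> complex \<Rightarrow> complex \<Rightarrow> complex \<Rightarrow> complex" where
  "dq a b e l j h v d = a * h + b * v + e j * d + l j"

definition dquad :: "complex \<Rightarrow> complex \<Rightarrow> (int \<Rightarrow> complex) \<Rightarrow> (int \<Rightarrow> complex) \<Rightarrow> int
    \<Rightarrow> complex \<Rightarrow> complex \<Rightarrow> complex \<Rightarrow> complex \<Rightarrow> complex \<Rightarrow> complex \<Rightarrow> complex \<Rightarrow> complex \<Rightarrow> complex" where
  "dquad a b e l j x1 x2 x3 x4 r1 r2 r3 r4 = r1 * dq a b e l j x2 x3 x4 + r2 * dq a b e l (j+1) x1 x4 x3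
     + r3 * dq a b e l (j+1) x4 x1 x2 + r4 * dq a b e l j x3 x2 x1"

text \<open>The discriminant \<open>Q\<^sub>3 Q\<^sub>4 - Q Q\<^sub>3\<^sub>4\<close> of the equation, attached to a horizontal edge; vertical
  edges carry \<open>edge b a\<close>. For the deformed H equations it is a multiple of the polynomial \<open>f\<close>.\<close>

definition edge :: "complex \<Rightarrow> complex \<Rightarrow> complex \<Rightarrow> (int \<Rightarrow> complex) \<Rightarrow> (int \<Rightarrow> complex) \<Rightarrow> int
    \<Rightarrow> complex \<Rightarrow> complex \<Rightarrow> complex" where
  "edge a b k e l j x y = (b * x + e (j+1) * y + l (j+1)) * (b * y + e j * x + l j)
     - a * (a * x * y + l j * x + l (j+1) * y + k)"

definition good :: "complex \<Rightarrow> complex \<Rightarrow> complex \<Rightarrow> (int \<Rightarrow> complex) \<Rightarrow> (int \<Rightarrow> complex) \<Rightarrow> int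
    \<Rightarrow> complex \<Rightarrow> complex \<Rightarrow> complex \<Rightarrow> complex \<Rightarrow> bool" where
  "good a b k e l j x1 x2 x3 x4 \<longleftrightarrow> quad a b k e l j x1 x2 x3 x4 = 0 \<and>
     dq a b e l j x2 x3 x4 \<noteq> 0 \<and> dq a b e l (j+1) x1 x4 x3 \<noteq> 0 \<and>
     dq a b e l (j+1) x4 x1 x2 \<noteq> 0 \<and> dq a b e l j x3 x2 x1 \<noteq> 0"

definition gensol :: "complex \<Rightarrow> complex \<Rightarrow> complex \<Rightarrow> (int \<Rightarrow> complex) \<Rightarrow> (int \<Rightarrow> complex)
    \<Rightarrow> (int \<Rightarrow> int \<Rightarrow> complex) \<Rightarrow> bool" where
  "gensol a b k e l u \<longleftrightarrow>
     (\<forall>n m. good a b k e l (n+m) (u n m) (u (n+1) m) (u n (m+1)) (u (n+1) (m+1)))"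

text \<open>The solution \<open>x4\<close> of the equation, which is affine in \<open>x4\<close>;
  meaningful only where the denominator, the derivative with respect to \<open>x4\<close>, is
  nonzero.\<close>

definition nxt :: "complex \<Rightarrow> complex \<Rightarrow> complex \<Rightarrow> (int \<Rightarrow> complex) \<Rightarrow> (int \<Rightarrow> complex) \<Rightarrow> int
    \<Rightarrow> complex \<Rightarrow> complex \<Rightarrow> complex \<Rightarrow> complex" where
  "nxt a b k e l j x1 x2 x3 = - (a * x1 * x2 + b * x1 * x3 + e (j+1) * x2 * x3 + l j * x1
     + l (j+1) * (x2 + x3) + k) / dq a b e l j x3 x2 x1"

lemma finite_quadratic_roots:
  fixes p q r :: complex
  assumes "p \<noteq> 0 \<or> q \<noteq> 0 \<or> r \<noteq> 0"
  shows "finite {y. p + q * y + r * y\<^sup>2 = 0}"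
proof -
  have "[:p, q, r:] \<noteq> 0" using assms by auto
  from poly_roots_finite[OF this] show ?thesis
    by (simp add: power2_eq_square algebra_simps)
qed

text \<open>A nonzero polynomial has finitely many roots, but a ball is infinite. This is the
  comparison of coefficients used below, also for affine functions written with a zero quadratic
  term.\<close>

lemma quadratic_zero:
  fixes p q r :: complex
  assumes "r0 > 0" "\<And>y. dist y y0 < r0 \<Longrightarrow> p + q * y + r * y\<^sup>2 = 0"
  shows "p = 0" "q = 0" "r = 0"
proof -
  have "ball y0 r0 \<subseteq> {y. p + q * y + r * y\<^sup>2 = 0}"
    using assms(2) by (auto simp: dist_commute)
  moreover have "infinite (ball y0 r0)"
    using assms(1) uncountable_ball countable_finite by blast
  ultimately have "infinite {y. p + q * y + r * y\<^sup>2 = 0}"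
    using finite_subset by blast
  then show "p = 0" "q = 0" "r = 0" using finite_quadratic_roots by blast+
qed

text \<open>\<open>e_mult\<close> expresses that the diagonal deformation terms live on one colour
  only. \<open>edge_nz\<close> demands that no discriminant vanishes identically; it feeds both the
  construction of solutions and the final determinant argument.\<close>

locale bw_quad =
  fixes a b k :: complex and e l :: "int \<Rightarrow> complex"
  assumes a_nz: "a \<noteq> 0" and b_nz: "b \<noteq> 0"
    and e_per: "\<And>j. e (j + 2) = e j" and l_per: "\<And>j. l (j + 2) = l j"
    and e_mult: "\<And>j. e j * e (j + 1) = 0"
    and edge_nz: "\<And>j. \<exists>x y. edge a b k e l j x y \<noteq> 0" "\<And>j. \<exists>x y. edge b a k e l j x y \<noteq> 0"
begin

abbreviation "Q \<equiv> quad a b k e l"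
abbreviation "E \<equiv> dq a b e l"
abbreviation "dQ \<equiv> dquad a b e l"
abbreviation "gA \<equiv> edge a b k e l"
abbreviation "gB \<equiv> edge b a k e l"
abbreviation "gd \<equiv> good a b k e l"
abbreviation "nx \<equiv> nxt a b k e l"

lemma periodic [simp]: "e (j + 1 + 1) = e j" "l (j + 1 + 1) = l j"
    "e (j + 2) = e j" "l (j + 2) = l j" "e (2 + j) = e j" "l (2 + j) = l j"
  using e_per[of j] l_per[of j] by (simp_all add: add.assoc add.commute[of 2])

lemma even_shift:
  assumes "even (i - j)"
  shows "e i = e j" "l i = l j" "e (i + 1) = e (j + 1)" "l (i + 1) = l (j + 1)"
proof -
  have *: "e (j + 2 * int n) = e j \<and> l (j + 2 * int n) = l j" for j n
  proof (induction n)
    case (Suc n)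
    then show ?case using e_per[of "j + 2 * int n"] l_per[of "j + 2 * int n"] by (simp add: algebra_simps)
  qed simp
  have **: "e i = e j \<and> l i = l j" if "even (i - j)" for i j
  proof -
    from that obtain c where "i - j = 2 * c" by (rule evenE)
    then have c: "i = j + 2 * c" by simp
    show ?thesis
    proof (cases "c \<ge> 0")
      case True then show ?thesis using *[of j "nat c"] c by simp
    next
      case False then show ?thesis using *[of i "nat (-c)"] c by simp
    qed
  qed
  show "e i = e j" "l i = l j" "e (i + 1) = e (j + 1)" "l (i + 1) = l (j + 1)"
    using **[OF assms] **[of "i + 1" "j + 1"] assms by simp_all
qed

lemma even_shift_all:
  assumes "even (i - j)"
  shows "Q i = Q j" "E i = E j" "E (i + 1) = E (j + 1)" "gA i = gA j" "gB i = gB j" "gd i = gd j"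
  using even_shift[OF assms]
  by (simp_all add: fun_eq_iff quad_def dq_def edge_def good_def)

lemma E_per [simp]: "E (j + 1 + 1) = E j" "E (j + 2) = E j" "E (2 + j) = E j"
  by (simp_all add: dq_def fun_eq_iff)

lemma edge_flip: "gA (j + 1) y x = gA j x y"
  by (simp add: edge_def algebra_simps)

lemma Q_hflip: "Q (j + 1) x2 x1 x4 x3 = Q j x1 x2 x3 x4"
  and Q_vflip: "Q (j + 1) x3 x4 x1 x2 = Q j x1 x2 x3 x4"
  by (simp_all add: quad_def algebra_simps)

lemma good_hflip: "gd (j + 1) x2 x1 x4 x3 \<longleftrightarrow> gd j x1 x2 x3 x4"
  unfolding good_def Q_hflip by auto

lemma good_vflip: "gd (j + 1) x3 x4 x1 x2 \<longleftrightarrow> gd j x1 x2 x3 x4"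
  unfolding good_def Q_vflip by auto

text \<open>For a multi-affine \<open>Q\<close> the expression \<open>Q3 * Q4 - Q * Q34\<close> is
  free of \<open>x3\<close> and \<open>x4\<close>. Here \<open>Q34 = a\<close>, which explains the
  multiple of \<open>Q\<close> that is subtracted; \<open>E24\<close> is the same with
  \<open>Q24 = b\<close>.\<close>

lemma E34: "Q j x1 x2 x3 x4 = 0 \<Longrightarrow> E (j+1) x4 x1 x2 * E j x3 x2 x1 = gA j x1 x2"
proof -
  have "E (j+1) x4 x1 x2 * E j x3 x2 x1 - a * Q j x1 x2 x3 x4 = gA j x1 x2"
    by (simp add: quad_def dq_def edge_def algebra_simps)
  then show "Q j x1 x2 x3 x4 = 0 \<Longrightarrow> ?thesis" by simp
qed

lemma E12: "Q j x1 x2 x3 x4 = 0 \<Longrightarrow> E j x2 x3 x4 * E (j+1) x1 x4 x3 = gA (j+1) x3 x4"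
  using E34[of "j+1" x3 x4 x1 x2] by (simp add: Q_vflip)

lemma E24: "Q j x1 x2 x3 x4 = 0 \<Longrightarrow> E (j+1) x1 x4 x3 * E j x3 x2 x1 = gB j x1 x3"
proof -
  have "E (j+1) x1 x4 x3 * E j x3 x2 x1 - b * Q j x1 x2 x3 x4 = gB j x1 x3"
    by (simp add: quad_def dq_def edge_def algebra_simps)
  then show "Q j x1 x2 x3 x4 = 0 \<Longrightarrow> ?thesis" by simp
qed

lemma Q_split4: "Q j x1 x2 x3 x4 = E j x3 x2 x1 * x4 + (a * x1 * x2 + b * x1 * x3 + e (j+1) * x2 * x3 + l j * x1
     + l (j+1) * (x2 + x3) + k)"
  by (simp add: quad_def dq_def algebra_simps)

lemma Q_nx_iff: "E j x3 x2 x1 \<noteq> 0 \<Longrightarrow> Q j x1 x2 x3 x4 = 0 \<longleftrightarrow> x4 = nx j x1 x2 x3"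
  unfolding Q_split4 nxt_def nonzero_eq_divide_eq eq_neg_iff_add_eq_0 by (simp add: mult.commute)

lemma Q_nx: "E j x3 x2 x1 \<noteq> 0 \<Longrightarrow> Q j x1 x2 x3 (nx j x1 x2 x3) = 0"
  using Q_nx_iff by blast

lemma Q_diff3: "Q j x1 x2 x3 x4 - Q j x1 x2 y x4 = E (j+1) x4 x1 x2 * (x3 - y)"
  by (simp add: quad_def dq_def algebra_simps)

lemma good_nx:
  assumes "gd j x1 x2 x3 x4" shows "x4 = nx j x1 x2 x3"
  using assms Q_nx_iff unfolding good_def by blast

subsection \<open>Extension of solutions\<close>

text \<open>Two cells that share \<open>x1\<close>, \<open>x2\<close>, \<open>x4\<close> give
  \<open>Q3 * (y - y') = 0\<close>, and \<open>Q3\<close> is nonzero because \<open>Q3 * Q4\<close>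
  is the nonvanishing discriminant of the lower edge.\<close>

lemma nx_inj:
  assumes g: "gA j x1 x2 \<noteq> 0" and E: "E j y x2 x1 \<noteq> 0" "E j y' x2 x1 \<noteq> 0" and eq: "nx j x1 x2 y = nx j x1 x2 y'"
  shows "y = y'"
proof -
  let ?z = "nx j x1 x2 y"
  have Q: "Q j x1 x2 y ?z = 0" "Q j x1 x2 y' ?z = 0"
    using Q_nx[OF E(1)] Q_nx[OF E(2)] eq by simp_all
  then have "E (j+1) ?z x1 x2 * (y - y') = 0"
    using Q_diff3[of j x1 x2 y ?z y'] by simp
  moreover have "E (j+1) ?z x1 x2 \<noteq> 0" using E34[OF Q(1)] g by auto
  ultimately show ?thesis by simp
qed

text \<open>The derivatives at \<open>x3\<close> and \<open>x4\<close> are nonzero together by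
  \<open>E34\<close>. The derivative at \<open>x1\<close>, multiplied by the one at
  \<open>x4\<close>, is a quadratic in \<open>y\<close> with leading coefficient
  \<open>a * b\<close>; the derivative at \<open>x2\<close>, treated likewise, gives the vertical
  discriminant \<open>gB j x1 y\<close>.\<close>

lemma finite_bad_values:
  assumes g: "gA j x1 x2 \<noteq> 0"
  shows "finite {y. E j y x2 x1 = 0 \<or> \<not> gd j x1 x2 y (nx j x1 x2 y)}" (is "finite ?B")
proof -
  have l1: "finite {y. E j y x2 x1 = 0}"
  proof -
    have "{y. E j y x2 x1 = 0} = {y. (b * x2 + e j * x1 + l j) + a * y + 0 * y\<^sup>2 = 0}"
      by (simp add: dq_def algebra_simps)
    moreover have "finite {y. (b * x2 + e j * x1 + l j) + a * y + 0 * y\<^sup>2 = 0}"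
      by (rule finite_quadratic_roots) (simp add: a_nz)
    ultimately show ?thesis by simp
  qed
  define N where "N = (\<lambda>y. a * x1 * x2 + b * x1 * y + e (j+1) * x2 * y + l j * x1 + l (j+1) * (x2 + y) + k)"
  have nxE: "E j y x2 x1 * nx j x1 x2 y = - N y" if "E j y x2 x1 \<noteq> 0" for y
    using that by (simp add: nxt_def N_def)
  have l2: "finite {y. E j y x2 x1 \<noteq> 0 \<and> E j x2 y (nx j x1 x2 y) = 0}"
  proof -
    define p where "p = (a * x2 + l j) * (b * x2 + e j * x1 + l j) - e j * (a * x1 * x2 + l j * x1 + l (j+1) * x2 + k)"
    define q where "q = a * (a * x2 + l j) + b * (b * x2 + e j * x1 + l j) - e j * (b * x1 + e (j+1) * x2 + l (j+1))"
    have "p + q * y + a * b * y\<^sup>2 = 0" if "E j y x2 x1 \<noteq> 0" "E j x2 y (nx j x1 x2 y) = 0" for y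
    proof -
      have "0 = E j y x2 x1 * E j x2 y (nx j x1 x2 y)" using that by simp
      also have "\<dots> = E j y x2 x1 * (a * x2 + b * y + l j) + e j * (E j y x2 x1 * nx j x1 x2 y)"
        by (simp add: dq_def algebra_simps)
      also have "\<dots> = p + q * y + a * b * y\<^sup>2"
        unfolding nxE[OF that(1)] by (simp add: dq_def N_def p_def q_def algebra_simps power2_eq_square)
      finally show ?thesis by simp
    qed
    then have "{y. E j y x2 x1 \<noteq> 0 \<and> E j x2 y (nx j x1 x2 y) = 0} \<subseteq> {y. p + q * y + a * b * y\<^sup>2 = 0}" by blast
    then show ?thesis using finite_quadratic_roots[of p q "a * b"] a_nz b_nz finite_subset by auto
  qed
  have l3: "finite {y. E j y x2 x1 \<noteq> 0 \<and> E (j+1) x1 (nx j x1 x2 y) y = 0}"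
  proof -
    define p where "p = (a * x1 + l (j+1)) * (e j * x1 + l j) - b * (l j * x1 + k)"
    define q where "q = a * (a * x1 + l (j+1)) + e (j+1) * (e j * x1 + l j) - b * (b * x1 + l (j+1))"
    have gB: "gB j x1 y = p + q * y + a * e (j+1) * y\<^sup>2" for y
      by (simp add: edge_def p_def q_def algebra_simps power2_eq_square)
    have "p \<noteq> 0 \<or> q \<noteq> 0 \<or> a * e (j+1) \<noteq> 0"
    proof (rule ccontr)
      assume "\<not> (p \<noteq> 0 \<or> q \<noteq> 0 \<or> a * e (j+1) \<noteq> 0)"
      then have z: "e (j+1) = 0" "p = 0" "q = 0" using a_nz by auto
      \<comment> \<open>If \<open>gB j x1\<close> vanished identically, then \<open>e (j+1)\<close>,
        \<open>p\<close> and \<open>q\<close> would be zero, and this identity would annihilate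
        \<open>gA j x1 x2\<close>.\<close>
      have "b * gA j x1 x2 = a * p - (b * x2 + e j * x1 + l j) * q + e (j+1) * (b * x2 * (b * x2 + e j * x1 + l j) + (e j * x1 + l j) * (b * x2 + e j * x1 + l j))"
        using z(1) by (simp add: edge_def p_def q_def algebra_simps)
      then show False using z g b_nz by simp
    qed
    moreover have "{y. E j y x2 x1 \<noteq> 0 \<and> E (j+1) x1 (nx j x1 x2 y) y = 0} \<subseteq> {y. p + q * y + a * e (j+1) * y\<^sup>2 = 0}"
      using E24[OF Q_nx] gB by force
    ultimately show ?thesis using finite_quadratic_roots finite_subset by blast
  qed
  have "?B \<subseteq> {y. E j y x2 x1 = 0} \<union> {y. E j y x2 x1 \<noteq> 0 \<and> E j x2 y (nx j x1 x2 y) = 0}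
      \<union> {y. E j y x2 x1 \<noteq> 0 \<and> E (j+1) x1 (nx j x1 x2 y) y = 0}"
    using E34[OF Q_nx] g Q_nx unfolding good_def by fastforce
  then show ?thesis using l1 l2 l3 finite_subset by blast
qed

text \<open>\<open>Y y0\<close> iterates the Moebius maps from the seed \<open>y0\<close>, and
  \<open>S i\<close> holds the seeds whose first \<open>i\<close> iterates avoid the finite bad sets
  \<open>F\<close>. On \<open>S i\<close> the \<open>i\<close>-th iterate is injective in the seed,
  so each step loses finitely many seeds, hence countably many in all.\<close>

lemma half_row_extension:
  fixes x :: "nat \<Rightarrow> complex"
  assumes g: "\<And>i. gA (j + int i) (x i) (x (Suc i)) \<noteq> 0"
  shows "\<exists>B. countable B \<and> (\<forall>y0. y0 \<notin> B \<longrightarrow> (\<exists>y. y 0 = y0 \<and>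
    (\<forall>i. gd (j + int i) (x i) (x (Suc i)) (y i) (y (Suc i)))))"
proof -
  define Y where "Y = (\<lambda>y0. rec_nat y0 (\<lambda>i y. nx (j + int i) (x i) (x (Suc i)) y))"
  have Y: "Y y0 0 = y0" "Y y0 (Suc i) = nx (j + int i) (x i) (x (Suc i)) (Y y0 i)" for y0 i
    by (simp_all add: Y_def)
  define F where "F = (\<lambda>i. {y. E (j + int i) y (x (Suc i)) (x i) = 0 \<or>
      \<not> gd (j + int i) (x i) (x (Suc i)) y (nx (j + int i) (x i) (x (Suc i)) y)})"
  define S where "S = (\<lambda>i. {y0. \<forall>i'<i. Y y0 i' \<notin> F i'})"
  have inj: "inj_on (\<lambda>y0. Y y0 i) (S i)" for i
  proof (induction i)
    case 0 show ?case by (simp add: Y inj_on_def)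
  next
    case (Suc i)
    show ?case
    proof (rule inj_onI)
      fix y y' assume yy: "y \<in> S (Suc i)" "y' \<in> S (Suc i)" "Y y (Suc i) = Y y' (Suc i)"
      then have "Y y i \<notin> F i" "Y y' i \<notin> F i" by (auto simp: S_def)
      then have "Y y i = Y y' i"
        using nx_inj[OF g[of i], of "Y y i" "Y y' i"] yy(3) by (simp add: Y F_def)
      moreover have "y \<in> S i" "y' \<in> S i" using yy by (auto simp: S_def)
      ultimately show "y = y'" using Suc.IH by (auto dest: inj_onD)
    qed
  qed
  define B where "B = (\<Union>i. {y0 \<in> S i. Y y0 i \<in> F i})"
  have "finite {y0 \<in> S i. Y y0 i \<in> F i}" for i
  proof (rule finite_imageD)
    show "finite ((\<lambda>y0. Y y0 i) ` {y0 \<in> S i. Y y0 i \<in> F i})"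
      by (rule finite_subset[of _ "F i"]) (use finite_bad_values[OF g[of i]] in \<open>auto simp: F_def\<close>)
    show "inj_on (\<lambda>y0. Y y0 i) {y0 \<in> S i. Y y0 i \<in> F i}"
      using inj[of i] by (rule inj_on_subset) auto
  qed
  then have "countable B" unfolding B_def by (intro countable_UN) (simp_all add: countable_finite)
  moreover have "\<exists>y. y 0 = y0 \<and> (\<forall>i. gd (j + int i) (x i) (x (Suc i)) (y i) (y (Suc i)))" if "y0 \<notin> B" for y0
  proof -
    have "Y y0 i \<notin> F i" for i
    proof (induction i rule: less_induct)
      case (less i)
      then have "y0 \<in> S i" by (auto simp: S_def)
      then show ?case using that unfolding B_def by blast
    qed
    then show ?thesis by (intro exI[of _ "Y y0"]) (auto simp: Y F_def)
  qed
  ultimately show ?thesis by blast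
qed

text \<open>The half row to the left is a half row to the right of the reflected lattice; both start
  from the same seed, so the two countable exceptional sets are united.\<close>

lemma row_extension:
  fixes x :: "int \<Rightarrow> complex"
  assumes g: "\<And>n. gA (j + n) (x n) (x (n+1)) \<noteq> 0"
  shows "\<exists>B. countable B \<and> (\<forall>y0. y0 \<notin> B \<longrightarrow> (\<exists>y. y n0 = y0 \<and>
    (\<forall>n. gd (j + n) (x n) (x (n+1)) (y n) (y (n+1)))))"
proof -
  have 1: "gA (j + n0 + int i) (x (n0 + int i)) (x (n0 + int (Suc i))) \<noteq> 0" for i
    using g[of "n0 + int i"] by (simp add: algebra_simps)
  have 2: "gA (j + n0 + int i) (x (n0 - int i)) (x (n0 - int (Suc i))) \<noteq> 0" for i
  proof -
    have "gA (j + n0 + int i) (x (n0 - int i)) (x (n0 - int (Suc i)))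
        = gA (j + (n0 - int (Suc i)) + 1) (x (n0 - int i)) (x (n0 - int (Suc i)))"
      by (subst even_shift_all(4)[of "j + n0 + int i" "j + (n0 - int (Suc i)) + 1"]) auto
    also have "\<dots> = gA (j + (n0 - int (Suc i))) (x (n0 - int (Suc i))) (x (n0 - int i))"
      by (rule edge_flip)
    finally show ?thesis using g[of "n0 - int (Suc i)"] by simp
  qed
  obtain B1 where B1: "countable B1" "\<And>y0. y0 \<notin> B1 \<Longrightarrow> \<exists>y. y 0 = y0 \<and>
    (\<forall>i. gd (j + n0 + int i) (x (n0 + int i)) (x (n0 + int (Suc i))) (y i) (y (Suc i)))"
    using half_row_extension[of "j + n0" "\<lambda>i. x (n0 + int i)", OF 1] by blast
  obtain B2 where B2: "countable B2" "\<And>y0. y0 \<notin> B2 \<Longrightarrow> \<exists>y. y 0 = y0 \<and>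
    (\<forall>i. gd (j + n0 + int i) (x (n0 - int i)) (x (n0 - int (Suc i))) (y i) (y (Suc i)))"
    using half_row_extension[of "j + n0" "\<lambda>i. x (n0 - int i)", OF 2] by blast
  have "\<exists>y. y n0 = y0 \<and> (\<forall>n. gd (j + n) (x n) (x (n+1)) (y n) (y (n+1)))" if y0: "y0 \<notin> B1 \<union> B2" for y0
  proof -
    obtain p where p: "p 0 = y0" "\<And>i. gd (j + n0 + int i) (x (n0 + int i)) (x (n0 + int (Suc i))) (p i) (p (Suc i))"
      using B1(2) y0 by blast
    obtain q where q: "q 0 = y0" "\<And>i. gd (j + n0 + int i) (x (n0 - int i)) (x (n0 - int (Suc i))) (q i) (q (Suc i))"
      using B2(2) y0 by blast
    define y where "y = (\<lambda>n. if n \<ge> n0 then p (nat (n - n0)) else q (nat (n0 - n)))"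
    have "gd (j + n) (x n) (x (n+1)) (y n) (y (n+1))" for n
    proof (cases "n \<ge> n0")
      case True
      then have "y n = p (nat (n - n0))" "y (n+1) = p (Suc (nat (n - n0)))"
        by (auto simp: y_def nat_add_distrib intro!: arg_cong[of _ _ p])
      then show ?thesis using p(2)[of "nat (n - n0)"] True by (simp add: algebra_simps)
    next
      case False
      define i where "i = nat (n0 - n - 1)"
      have i: "n = n0 - int (Suc i)" "n + 1 = n0 - int i" using False by (auto simp: i_def)
      have "nat (n0 - n) = Suc i" "n + 1 \<ge> n0 \<Longrightarrow> i = 0 \<and> n + 1 - n0 = 0" "n + 1 < n0 \<Longrightarrow> nat (n0 - (n + 1)) = i"
        using i by auto
      then have y: "y n = q (Suc i)" "y (n+1) = q i"
        using False p(1) q(1) by (auto simp: y_def)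
      have "gd (j + n + 1) (x (n+1)) (x n) (y (n+1)) (y n)"
        using q(2)[of i] unfolding y i[symmetric]
        by (subst even_shift_all(6)[of "j + n + 1" "j + n0 + int i"]) (auto simp: i(1))
      then show ?thesis by (simp only: good_hflip)
    qed
    moreover have "y n0 = y0" by (simp add: y_def p)
    ultimately show ?thesis by blast
  qed
  then show ?thesis using B1(1) B2(1) by (intro exI[of _ "B1 \<union> B2"]) blast
qed

text \<open>The invariant is that \<open>gA\<close> does not vanish on the current row. A good cell
  passes it on, since by \<open>E12\<close> the discriminant of its upper edge is a product of two
  nonzero derivatives. A nonempty open set is uncountable, so \<open>T i\<close> contains an
  admissible seed.\<close>

lemma half_plane_extension:
  fixes x :: "int \<Rightarrow> complex" and T :: "nat \<Rightarrow> complex set"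
  assumes g: "\<And>n. gA (j + n) (x n) (x (n+1)) \<noteq> 0"
    and T: "\<And>i. open (T i)" "\<And>i. T i \<noteq> {}"
  shows "\<exists>r. r 0 = x \<and> (\<forall>i. r (Suc i) n0 \<in> T i \<and>
    (\<forall>n. gd (j + int i + n) (r i n) (r i (n+1)) (r (Suc i) n) (r (Suc i) (n+1))))"
proof -
  have "\<exists>r. \<forall>i. ((i = 0 \<longrightarrow> r i = x) \<and> (\<forall>n. gA (j + int i + n) (r i n) (r i (n+1)) \<noteq> 0)) \<and>
    (r (Suc i) n0 \<in> T i \<and> (\<forall>n. gd (j + int i + n) (r i n) (r i (n+1)) (r (Suc i) n) (r (Suc i) (n+1))))"
  proof (rule dependent_nat_choice)
    show "\<exists>y. (0 = (0::nat) \<longrightarrow> y = x) \<and> (\<forall>n. gA (j + int 0 + n) (y n) (y (n + 1)) \<noteq> 0)"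
      using g by auto
  next
    fix y i assume y: "(i = 0 \<longrightarrow> y = x) \<and> (\<forall>n. gA (j + int i + n) (y n) (y (n + 1)) \<noteq> 0)"
    then obtain B where B: "countable B" "\<And>y0. y0 \<notin> B \<Longrightarrow> \<exists>z. z n0 = y0 \<and>
        (\<forall>n. gd (j + int i + n) (y n) (y (n+1)) (z n) (z (n+1)))"
      using row_extension[of "j + int i" y n0] by blast
    have "\<not> T i \<subseteq> B"
    proof
      assume "T i \<subseteq> B"
      obtain c where "c \<in> T i" using T(2) by blast
      then obtain r where "r > 0" "ball c r \<subseteq> T i" using T(1) open_contains_ball by blast
      then show False using uncountable_ball[of r c] countable_subset[OF _ B(1), of "ball c r"] \<open>T i \<subseteq> B\<close> by simp
    qed
    then obtain y0 where "y0 \<in> T i" "y0 \<notin> B" by blast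
    then obtain z where z: "z n0 \<in> T i" "\<And>n. gd (j + int i + n) (y n) (y (n+1)) (z n) (z (n+1))"
      using B(2) by blast
    have "gA (j + int (Suc i) + n) (z n) (z (n+1)) \<noteq> 0" for n
    proof -
      have "E (j + int i + n) (y (n+1)) (z n) (z (n+1)) * E (j + int i + n + 1) (y n) (z (n+1)) (z n)
          = gA (j + int i + n + 1) (z n) (z (n+1))"
        using z(2)[of n] by (intro E12) (simp add: good_def)
      then have "gA (j + int i + n + 1) (z n) (z (n+1)) \<noteq> 0"
        using z(2)[of n] unfolding good_def by (metis mult_eq_0_iff)
      then show ?thesis by (simp add: algebra_simps)
    qed
    then show "\<exists>z. ((Suc i = 0 \<longrightarrow> z = x) \<and> (\<forall>n. gA (j + int (Suc i) + n) (z n) (z (n + 1)) \<noteq> 0)) \<and>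
        z n0 \<in> T i \<and> (\<forall>n. gd (j + int i + n) (y n) (y (n + 1)) (z n) (z (n + 1)))"
      using z by blast
  qed
  then show ?thesis by blast
qed

text \<open>The lower half plane is built as an upper one and turned over by
  \<open>good_vflip\<close>. The column can only be steered into open sets because every new row has
  to avoid countably many values.\<close>

theorem gensol_extension:
  fixes x :: "int \<Rightarrow> complex" and T :: "int \<Rightarrow> complex set"
  assumes g: "\<And>n. gA (n + m0) (x n) (x (n+1)) \<noteq> 0"
    and T: "\<And>m. open (T m)" "\<And>m. T m \<noteq> {}"
  shows "\<exists>u. gensol a b k e l u \<and> (\<forall>n. u n m0 = x n) \<and> (\<forall>m. m \<noteq> m0 \<longrightarrow> u n0 m \<in> T m)"
proof -
  have g': "gA (m0 + n) (x n) (x (n+1)) \<noteq> 0" for n using g[of n] by (simp add: add.commute)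
  obtain p where p: "p 0 = x" "\<And>i. p (Suc i) n0 \<in> T (m0 + int (Suc i))"
    "\<And>i n. gd (m0 + int i + n) (p i n) (p i (n+1)) (p (Suc i) n) (p (Suc i) (n+1))"
    using half_plane_extension[OF g', of "\<lambda>i. T (m0 + int (Suc i))" n0] T by auto
  obtain q where q: "q 0 = x" "\<And>i. q (Suc i) n0 \<in> T (m0 - int (Suc i))"
    "\<And>i n. gd (m0 + int i + n) (q i n) (q i (n+1)) (q (Suc i) n) (q (Suc i) (n+1))"
    using half_plane_extension[OF g', of "\<lambda>i. T (m0 - int (Suc i))" n0] T by auto
  define u where "u = (\<lambda>n m. if m \<ge> m0 then p (nat (m - m0)) n else q (nat (m0 - m)) n)"
  have "gd (n + m) (u n m) (u (n+1) m) (u n (m+1)) (u (n+1) (m+1))" for n m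
  proof (cases "m \<ge> m0")
    case True
    then have "u n m = p (nat (m - m0)) n" "u n (m+1) = p (Suc (nat (m - m0))) n" for n
      by (auto simp: u_def nat_add_distrib intro!: arg_cong[of _ _ "\<lambda>i. p i n"])
    then show ?thesis using p(3)[of "nat (m - m0)" n] True by (simp add: algebra_simps)
  next
    case False
    define i where "i = nat (m0 - m - 1)"
    have i: "m = m0 - int (Suc i)" "m + 1 = m0 - int i" using False by (auto simp: i_def)
    have "nat (m0 - m) = Suc i" "m + 1 \<ge> m0 \<Longrightarrow> i = 0 \<and> m + 1 - m0 = 0" "m + 1 < m0 \<Longrightarrow> nat (m0 - (m + 1)) = i"
      using i by auto
    then have y: "u n m = q (Suc i) n" "u n (m+1) = q i n" for n
      using False p(1) q(1) by (auto simp: u_def)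
    have "gd (n + m + 1) (u n (m+1)) (u (n+1) (m+1)) (u n m) (u (n+1) m)"
      using q(3)[of i n] unfolding y
      by (subst even_shift_all(6)[of "n + m + 1" "m0 + int i + n"]) (auto simp: i(1))
    then show ?thesis by (simp only: good_vflip)
  qed
  moreover have "u n m0 = x n" for n by (simp add: u_def p)
  moreover have "u n0 m \<in> T m" if "m \<noteq> m0" for m
    using that p(2)[of "nat (m - m0 - 1)"] q(2)[of "nat (m0 - m - 1)"]
    by (auto simp: u_def Suc_nat_eq_nat_zadd1 algebra_simps)
  ultimately show ?thesis unfolding gensol_def by blast
qed

end

subsection \<open>The symmetry criterion on a patch\<close>

definition st :: "complex \<Rightarrow> complex \<Rightarrow> complex \<Rightarrow> complex \<Rightarrow> complex \<Rightarrow> complex ^ site" where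
  "st c e w n s = (\<chi> i. case i of Centre \<Rightarrow> c | East \<Rightarrow> e | West \<Rightarrow> w | North \<Rightarrow> n | South \<Rightarrow> s)"

lemma st_component [simp]: "st c e w n s $ Centre = c" "st c e w n s $ East = e"
  "st c e w n s $ West = w" "st c e w n s $ North = n" "st c e w n s $ South = s"
  by (simp_all add: st_def)

lemma stencil_eq_st: "stencil u n m = st (u n m) (u (n+1) m) (u (n-1) m) (u n (m+1)) (u n (m-1))"
  by (simp add: stencil_def st_def)

lemma all_site: "(\<forall>s. P s) \<longleftrightarrow> P Centre \<and> P East \<and> P West \<and> P North \<and> P South"
  by (metis site.exhaust)

lemma st_surj: "v = st (v $ Centre) (v $ East) (v $ West) (v $ North) (v $ South)"
  by (simp add: vec_eq_iff all_site)

lemma UNIV_site: "UNIV = {Centre, East, West, North, South}"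
  using site.exhaust by auto

lemma sum_site: "sum f UNIV = f Centre + f East + f West + f North + f South"
  by (simp add: UNIV_site add.assoc)

lemma st_plus_axis:
  "st c e w n s + axis Centre t = st (c + t) e w n s"
  "st c e w n s + axis East t = st c (e + t) w n s"
  "st c e w n s + axis West t = st c e (w + t) n s"
  "st c e w n s + axis North t = st c e w (n + t) s"
  "st c e w n s + axis South t = st c e w n (s + t)"
  by (simp_all add: vec_eq_iff all_site axis_component)

lemma tendsto_st [tendsto_intros]:
  assumes "(c \<longlongrightarrow> c') F" "(e \<longlongrightarrow> e') F" "(w \<longlongrightarrow> w') F" "(n \<longlongrightarrow> n') F" "(s \<longlongrightarrow> s') F"
  shows "((\<lambda>x. st (c x) (e x) (w x) (n x) (s x)) \<longlongrightarrow> st c' e' w' n' s') F"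
proof (rule vec_tendstoI)
  fix i show "((\<lambda>x. st (c x) (e x) (w x) (n x) (s x) $ i) \<longlongrightarrow> st c' e' w' n' s' $ i) F"
    using assms by (cases i) simp_all
qed

lemma dist_Pair_le: "dist (a, b) (c, d) \<le> dist a c + dist b d"
  unfolding dist_Pair_Pair by (rule sqrt_sum_squares_le_sum) auto

lemma eventually_nhds_5:
  assumes "eventually P (nhds (x1, x2, x3, x4, x5))"
  shows "\<exists>d>0. \<forall>y1 y2 y3 y4 y5. dist y1 x1 < d \<and> dist y2 x2 < d \<and> dist y3 x3 < d \<and>
    dist y4 x4 < d \<and> dist y5 x5 < d \<longrightarrow> P (y1, y2, y3, y4, y5)"
proof -
  obtain d where d: "d > 0" "\<And>y. dist y (x1, x2, x3, x4, x5) < d \<Longrightarrow> P y"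
    using assms unfolding eventually_nhds_metric by blast
  have "P (y1, y2, y3, y4, y5)"
    if "dist y1 x1 < d/5" "dist y2 x2 < d/5" "dist y3 x3 < d/5" "dist y4 x4 < d/5" "dist y5 x5 < d/5" for y1 y2 y3 y4 y5
  proof (rule d(2))
    show "dist (y1, y2, y3, y4, y5) (x1, x2, x3, x4, x5) < d"
      using that dist_Pair_le[of y1 "(y2, y3, y4, y5)" x1 "(x2, x3, x4, x5)"]
        dist_Pair_le[of y2 "(y3, y4, y5)" x2 "(x3, x4, x5)"]
        dist_Pair_le[of y3 "(y4, y5)" x3 "(x4, x5)"] dist_Pair_le[of y4 y5 x4 x5]
      by linarith
  qed
  then show ?thesis using d(1) by (intro exI[of _ "d/5"]) simp
qed

lemma tendsto_dq [tendsto_intros]: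
  assumes "(h \<longlongrightarrow> h') F" "(v \<longlongrightarrow> v') F" "(d \<longlongrightarrow> d') F"
  shows "((\<lambda>x. dq a b e l j (h x) (v x) (d x)) \<longlongrightarrow> dq a b e l j h' v' d') F"
  unfolding dq_def using assms by (intro tendsto_intros)

lemma tendsto_edge [tendsto_intros]:
  assumes "(f \<longlongrightarrow> x) F" "(g \<longlongrightarrow> y) F"
  shows "((\<lambda>t. edge a b k e l j (f t) (g t)) \<longlongrightarrow> edge a b k e l j x y) F"
  unfolding edge_def using assms by (intro tendsto_intros)

lemma tendsto_nxt [tendsto_intros]:
  assumes "(f1 \<longlongrightarrow> x1) F" "(f2 \<longlongrightarrow> x2) F" "(f3 \<longlongrightarrow> x3) F" "dq a b e l j x3 x2 x1 \<noteq> 0"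
  shows "((\<lambda>t. nxt a b k e l j (f1 t) (f2 t) (f3 t)) \<longlongrightarrow> nxt a b k e l j x1 x2 x3) F"
  unfolding nxt_def using assms by (intro tendsto_intros)

context bw_quad
begin

lemma eventually_good:
  assumes "(f1 \<longlongrightarrow> x1) F" "(f2 \<longlongrightarrow> x2) F" "(f3 \<longlongrightarrow> x3) F" "gd j x1 x2 x3 x4"
  shows "\<forall>\<^sub>F t in F. gd j (f1 t) (f2 t) (f3 t) (nx j (f1 t) (f2 t) (f3 t))"
proof -
  have x4: "x4 = nx j x1 x2 x3" using good_nx[OF assms(4)] .
  have E: "E j x3 x2 x1 \<noteq> 0" "E j x2 x3 x4 \<noteq> 0" "E (j+1) x1 x4 x3 \<noteq> 0" "E (j+1) x4 x1 x2 \<noteq> 0"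
    using assms(4) by (auto simp: good_def)
  have t: "((\<lambda>t. nx j (f1 t) (f2 t) (f3 t)) \<longlongrightarrow> x4) F"
    unfolding x4 using assms E by (intro tendsto_intros)
  have "\<forall>\<^sub>F t in F. E j (f3 t) (f2 t) (f1 t) \<noteq> 0"
    by (rule tendsto_imp_eventually_ne[OF tendsto_dq E(1)]) (use assms t in auto)
  moreover have "\<forall>\<^sub>F t in F. E j (f2 t) (f3 t) (nx j (f1 t) (f2 t) (f3 t)) \<noteq> 0"
    by (rule tendsto_imp_eventually_ne[OF tendsto_dq E(2)]) (use assms t in auto)
  moreover have "\<forall>\<^sub>F t in F. E (j+1) (f1 t) (nx j (f1 t) (f2 t) (f3 t)) (f3 t) \<noteq> 0"
    by (rule tendsto_imp_eventually_ne[OF tendsto_dq E(3)]) (use assms t in auto)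
  moreover have "\<forall>\<^sub>F t in F. E (j+1) (nx j (f1 t) (f2 t) (f3 t)) (f1 t) (f2 t) \<noteq> 0"
    by (rule tendsto_imp_eventually_ne[OF tendsto_dq E(4)]) (use assms t in auto)
  ultimately show ?thesis
    by eventually_elim (auto simp: good_def Q_nx)
qed

lemma good_edges:
  assumes "gd j x1 x2 x3 x4"
  shows "gA j x1 x2 \<noteq> 0" "gA (j+1) x3 x4 \<noteq> 0" "gB j x1 x3 \<noteq> 0"
  using assms E34[of j x1 x2 x3 x4] E12[of j x1 x2 x3 x4] E24[of j x1 x2 x3 x4]
  unfolding good_def by auto

text \<open>The cell and four of its neighbours, reflected where necessary so that the value to be
  computed by \<open>nx\<close> stands in the last slot.\<close>

lemma gensol_good:
  assumes "gensol a b k e l u" "j = n + m"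
  shows "gd j (u n m) (u (n+1) m) (u n (m+1)) (u (n+1) (m+1))"
    and "gd j (u n m) (u (n-1) m) (u n (m+1)) (u (n-1) (m+1))"
    and "gd j (u n m) (u (n+1) m) (u n (m-1)) (u (n+1) (m-1))"
    and "gd (j+1) (u (n+1) m) (u (n+2) m) (u (n+1) (m+1)) (u (n+2) (m+1))"
    and "gd (j+1) (u n (m+1)) (u (n+1) (m+1)) (u n (m+2)) (u (n+1) (m+2))"
proof -
  have g: "gd (n + m) (u n m) (u (n+1) m) (u n (m+1)) (u (n+1) (m+1))" for n m
    using assms(1) unfolding gensol_def by blast
  show "gd j (u n m) (u (n+1) m) (u n (m+1)) (u (n+1) (m+1))" using g assms(2) by simp
  show "gd j (u n m) (u (n-1) m) (u n (m+1)) (u (n-1) (m+1))"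
    using g[of "n-1" m] good_hflip[of "j-1"] assms(2) by (simp add: algebra_simps)
  show "gd j (u n m) (u (n+1) m) (u n (m-1)) (u (n+1) (m-1))"
    using g[of n "m-1"] good_vflip[of "j-1"] assms(2) by (simp add: algebra_simps)
  show "gd (j+1) (u (n+1) m) (u (n+2) m) (u (n+1) (m+1)) (u (n+2) (m+1))"
    using g[of "n+1" m] assms(2) by (simp add: algebra_simps)
  show "gd (j+1) (u n (m+1)) (u (n+1) (m+1)) (u n (m+2)) (u (n+1) (m+2))"
    using g[of n "m+1"] assms(2) by (simp add: algebra_simps)
qed

end

text \<open>\<open>K\<close> stands for the terms with \<xi> and \<zeta>; it involves only the four
  values of the cell, and continuity is all that is recorded about it. \<open>u0\<close> is the
  solution inside the domains around which the argument is localised.\<close>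

locale bw_symmetry = bw_quad +
  fixes A :: "int \<Rightarrow> int \<Rightarrow> (complex ^ site) set"
    and R :: "int \<Rightarrow> int \<Rightarrow> complex ^ site \<Rightarrow> complex"
    and K :: "int \<Rightarrow> int \<Rightarrow> complex \<Rightarrow> complex \<Rightarrow> complex \<Rightarrow> complex \<Rightarrow> complex"
    and u0 :: "int \<Rightarrow> int \<Rightarrow> complex"
  assumes A_open: "\<And>n m. open (A n m)"
    and A_conn: "\<And>n m. connected (A n m)"
    and R_holo: "\<And>n m. holo_on (R n m) (A n m)"
    and K_tendsto: "\<And>n m f1 f2 f3 f4 x1 x2 x3 x4. f1 \<longlonglongrightarrow> x1 \<Longrightarrow> f2 \<longlonglongrightarrow> x2 \<Longrightarrow> f3 \<longlonglongrightarrow> x3 \<Longrightarrow> f4 \<longlonglongrightarrow> x4 \<Longrightarrow>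
      (\<lambda>i. K n m (f1 i) (f2 i) (f3 i) (f4 i)) \<longlonglongrightarrow> K n m x1 x2 x3 x4"
    and crit: "\<And>u n m. gensol a b k e l u \<Longrightarrow> stencil u n m \<in> A n m \<Longrightarrow> stencil u (n+1) m \<in> A (n+1) m \<Longrightarrow>
      stencil u n (m+1) \<in> A n (m+1) \<Longrightarrow> stencil u (n+1) (m+1) \<in> A (n+1) (m+1) \<Longrightarrow>
        dquad a b e l (n+m) (u n m) (u (n+1) m) (u n (m+1)) (u (n+1) (m+1)) (R n m (stencil u n m)) (R (n+1) m (stencil u (n+1) m))
          (R n (m+1) (stencil u n (m+1))) (R (n+1) (m+1) (stencil u (n+1) (m+1)))
        + K n m (u n m) (u (n+1) m) (u n (m+1)) (u (n+1) (m+1)) = 0"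
    and u0_sol: "gensol a b k e l u0"
    and u0_in: "\<And>n m. stencil u0 n m \<in> A n m"
begin

text \<open>Around the quadrilateral at \<open>(n,m)\<close> the values \<open>x1, x2, x3\<close> on the quadrilateral and
  \<open>w, y, s, t\<close> at \<open>(n-1,m)\<close>, \<open>(n+2,m)\<close>, \<open>(n,m-1)\<close>, \<open>(n,m+2)\<close> are free and determine all
  values that enter the symmetry criterion.\<close>

definition patch :: "int \<Rightarrow> int \<Rightarrow> complex \<Rightarrow> complex \<Rightarrow> complex \<Rightarrow> complex \<Rightarrow> complex \<Rightarrow> complex \<Rightarrow> complex \<Rightarrow> bool" where
  "patch n m x1 x2 x3 w y s t \<longleftrightarrow> (let j = n + m; x4 = nx j x1 x2 x3; w' = nx j x1 w x3; y' = nx (j+1) x2 y x4;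
      s' = nx j x1 x2 s; t' = nx (j+1) x3 x4 t in
    gd j x1 x2 x3 x4 \<and> gd j x1 w x3 w' \<and> gd (j+1) x2 y x4 y' \<and> gd j x1 x2 s s' \<and> gd (j+1) x3 x4 t t' \<and>
    gA (j-2) (u0 (n-2) m) w \<noteq> 0 \<and> gA (j+2) y (u0 (n+3) m) \<noteq> 0 \<and>
    st x1 x2 w x3 s \<in> A n m \<and> st x2 y x1 x4 s' \<in> A (n+1) m \<and>
    st x3 x4 w' t x1 \<in> A n (m+1) \<and> st x4 y' x3 t' x2 \<in> A (n+1) (m+1))"

text \<open>All conditions in \<open>patch\<close> are open, and they hold at \<open>u0\<close>
  because \<open>nx\<close> reproduces the values of a generic solution.\<close>

lemma patch_eventually:
  assumes "(f1 \<longlongrightarrow> u0 n m) F" "(f2 \<longlongrightarrow> u0 (n+1) m) F" "(f3 \<longlongrightarrow> u0 n (m+1)) F" "(fw \<longlongrightarrow> u0 (n-1) m) F"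
    "(fy \<longlongrightarrow> u0 (n+2) m) F" "(fs \<longlongrightarrow> u0 n (m-1)) F" "(ft \<longlongrightarrow> u0 n (m+2)) F"
  shows "\<forall>\<^sub>F p in F. patch n m (f1 p) (f2 p) (f3 p) (fw p) (fy p) (fs p) (ft p)"
proof -
  define j where "j = n + m"
  note g = gensol_good[OF u0_sol j_def]
  note x4 = good_nx[OF g(1)] and w' = good_nx[OF g(2)] and s' = good_nx[OF g(3)]
    and y' = good_nx[OF g(4)] and t' = good_nx[OF g(5)]
  have E: "E j (u0 n (m+1)) (u0 (n+1) m) (u0 n m) \<noteq> 0" "E j (u0 n (m+1)) (u0 (n-1) m) (u0 n m) \<noteq> 0"
    "E j (u0 n (m-1)) (u0 (n+1) m) (u0 n m) \<noteq> 0" "E (j+1) (u0 (n+1) (m+1)) (u0 (n+2) m) (u0 (n+1) m) \<noteq> 0"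
    "E (j+1) (u0 n (m+2)) (u0 (n+1) (m+1)) (u0 n (m+1)) \<noteq> 0"
    using g unfolding good_def by blast+
  let ?x4 = "\<lambda>p. nx j (f1 p) (f2 p) (f3 p)" and ?w' = "\<lambda>p. nx j (f1 p) (fw p) (f3 p)"
    and ?s' = "\<lambda>p. nx j (f1 p) (f2 p) (fs p)"
  let ?y' = "\<lambda>p. nx (j+1) (f2 p) (fy p) (?x4 p)" and ?t' = "\<lambda>p. nx (j+1) (f3 p) (?x4 p) (ft p)"
  have t: "(?x4 \<longlongrightarrow> u0 (n+1) (m+1)) F" "(?w' \<longlongrightarrow> u0 (n-1) (m+1)) F" "(?s' \<longlongrightarrow> u0 (n+1) (m-1)) F"
    unfolding x4 w' s' by (intro tendsto_nxt assms E)+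
  have t2: "(?y' \<longlongrightarrow> u0 (n+2) (m+1)) F" "(?t' \<longlongrightarrow> u0 (n+1) (m+2)) F"
    unfolding y' t' by (intro tendsto_nxt assms E t)+
  have gsol: "gA (n+m) (u0 n m) (u0 (n+1) m) \<noteq> 0" for n m
    using good_edges(1)[OF gensol_good(1)[OF u0_sol refl]] .
  have A: "st (u0 n m) (u0 (n+1) m) (u0 (n-1) m) (u0 n (m+1)) (u0 n (m-1)) \<in> A n m" for n m
    using u0_in[of n m] unfolding stencil_eq_st .
  note tA = topological_tendstoD[OF tendsto_st A_open]
  have "\<forall>\<^sub>F p in F. gd j (f1 p) (f2 p) (f3 p) (?x4 p)" by (rule eventually_good[OF assms(1-3) g(1)])
  moreover have "\<forall>\<^sub>F p in F. gd j (f1 p) (fw p) (f3 p) (?w' p)" by (rule eventually_good[OF assms(1,4,3) g(2)])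
  moreover have "\<forall>\<^sub>F p in F. gd j (f1 p) (f2 p) (fs p) (?s' p)" by (rule eventually_good[OF assms(1,2,6) g(3)])
  moreover have "\<forall>\<^sub>F p in F. gd (j+1) (f2 p) (fy p) (?x4 p) (?y' p)" by (rule eventually_good[OF assms(2,5) t(1) g(4)])
  moreover have "\<forall>\<^sub>F p in F. gd (j+1) (f3 p) (?x4 p) (ft p) (?t' p)" by (rule eventually_good[OF assms(3) t(1) assms(7) g(5)])
  moreover have "\<forall>\<^sub>F p in F. gA (j-2) (u0 (n-2) m) (fw p) \<noteq> 0"
    by (rule tendsto_imp_eventually_ne[OF tendsto_edge[OF tendsto_const assms(4)]])
      (use gsol[of "n-2" m] in \<open>simp add: j_def algebra_simps\<close>)
  moreover have "\<forall>\<^sub>F p in F. gA (j+2) (fy p) (u0 (n+3) m) \<noteq> 0"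
    by (rule tendsto_imp_eventually_ne[OF tendsto_edge[OF assms(5) tendsto_const]])
      (use gsol[of "n+2" m] in \<open>simp add: j_def algebra_simps\<close>)
  moreover have "\<forall>\<^sub>F p in F. st (f1 p) (f2 p) (fw p) (f3 p) (fs p) \<in> A n m"
    by (rule tA[OF assms(1,2,4,3,6) A])
  moreover have "\<forall>\<^sub>F p in F. st (f2 p) (fy p) (f1 p) (?x4 p) (?s' p) \<in> A (n+1) m"
    by (rule tA[OF assms(2,5,1) t(1,3)]) (use A[of "n+1" m] in \<open>simp add: add.commute\<close>)
  moreover have "\<forall>\<^sub>F p in F. st (f3 p) (?x4 p) (?w' p) (ft p) (f1 p) \<in> A n (m+1)"
    by (rule tA[OF assms(3) t(1,2) assms(7,1)]) (use A[of n "m+1"] in \<open>simp add: add.commute\<close>)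
  moreover have "\<forall>\<^sub>F p in F. st (?x4 p) (?y' p) (f3 p) (?t' p) (f2 p) \<in> A (n+1) (m+1)"
    by (rule tA[OF t(1) t2(1) assms(3) t2(2) assms(2)]) (use A[of "n+1" "m+1"] in \<open>simp add: add.commute\<close>)
  ultimately show ?thesis
    unfolding patch_def Let_def j_def[symmetric] by eventually_elim blast
qed

text \<open>The patch data are approximated by generic solutions, because \<open>gensol_extension\<close>
  prescribes the row through \<open>(n,m)\<close> exactly and the column up to arbitrarily small errors.\<close>

lemma patch_criterion:
  assumes p: "patch n m x1 x2 x3 w y s t"
  defines "j \<equiv> n + m"
  defines "x4 \<equiv> nx j x1 x2 x3"
  shows "dQ j x1 x2 x3 x4 (R n m (st x1 x2 w x3 s)) (R (n+1) m (st x2 y x1 x4 (nx j x1 x2 s)))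
      (R n (m+1) (st x3 x4 (nx j x1 w x3) t x1)) (R (n+1) (m+1) (st x4 (nx (j+1) x2 y x4) x3 (nx (j+1) x3 x4 t) x2))
    + K n m x1 x2 x3 x4 = 0"
proof -
  define w' y' s' t' where "w' = nx j x1 w x3" "y' = nx (j+1) x2 y x4" "s' = nx j x1 x2 s" "t' = nx (j+1) x3 x4 t"
  note defs = w'_y'_s'_t'_def
  have g: "gd j x1 x2 x3 x4" "gd j x1 w x3 w'" "gd (j+1) x2 y x4 y'" "gd j x1 x2 s s'" "gd (j+1) x3 x4 t t'"
    and ge: "gA (j-2) (u0 (n-2) m) w \<noteq> 0" "gA (j+2) y (u0 (n+3) m) \<noteq> 0"
    and inA: "st x1 x2 w x3 s \<in> A n m" "st x2 y x1 x4 s' \<in> A (n+1) m"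
      "st x3 x4 w' t x1 \<in> A n (m+1)" "st x4 y' x3 t' x2 \<in> A (n+1) (m+1)"
    using p unfolding patch_def Let_def j_def x4_def defs by blast+
  \<comment> \<open>The four prescribed values are spliced into the row of \<open>u0\<close>. The
    two conditions on \<open>gA\<close> at the end of \<open>patch\<close> concern exactly the
    junctions at \<open>n-2\<close> and \<open>n+2\<close>.\<close>
  define x where "x = (\<lambda>i. if i = n-1 then w else if i = n then x1 else if i = n+1 then x2 else if i = n+2 then y else u0 i m)"
  have row: "gA (i + m) (x i) (x (i+1)) \<noteq> 0" for i
  proof -
    consider "i = n-2" | "i = n-1" | "i = n" | "i = n+1" | "i = n+2" | "i \<notin> {n-2, n-1, n, n+1, n+2}" by blast
    then show ?thesis
    proof cases
      case 1 show ?thesis unfolding 1 using ge(1) by (simp add: x_def j_def algebra_simps)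
    next
      case 2 show ?thesis unfolding 2 using good_edges(1)[OF g(2)] edge_flip[of "j-1" x1 w] by (simp add: x_def j_def algebra_simps)
    next
      case 3 show ?thesis unfolding 3 using good_edges(1)[OF g(1)] by (simp add: x_def j_def)
    next
      case 4 show ?thesis unfolding 4 using good_edges(1)[OF g(3)] by (simp add: x_def j_def algebra_simps)
    next
      case 5 show ?thesis unfolding 5 using ge by (simp add: x_def j_def algebra_simps)
    next
      case 6
      then have "x i = u0 i m" "x (i+1) = u0 (i+1) m" by (auto simp: x_def)
      then show ?thesis using good_edges(1)[OF gensol_good(1)[OF u0_sol refl]] by simp
    qed
  qed
  \<comment> \<open>The \<open>q\<close>-th solution meets \<open>s\<close>, \<open>x3\<close> and
    \<open>t\<close> up to the error \<open>1/(q+1)\<close>; elsewhere in the column the centre 0 is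
    arbitrary.\<close>
  define T where "T = (\<lambda>(q::nat) i. ball (if i = m+1 then x3 else if i = m-1 then s else if i = m+2 then t else 0) (inverse (Suc q)))"
  have "\<exists>u. gensol a b k e l u \<and> (\<forall>i. u i m = x i) \<and> (\<forall>i. i \<noteq> m \<longrightarrow> u n i \<in> T q i)" for q
    by (rule gensol_extension[OF row]) (auto simp: T_def)
  then obtain u where u: "\<And>q. gensol a b k e l (u q)" "\<And>q i. u q i m = x i" "\<And>q i. i \<noteq> m \<Longrightarrow> u q n i \<in> T q i"
    by metis
  have col: "(\<lambda>q. u q n i) \<longlonglongrightarrow> (if i = m+1 then x3 else if i = m-1 then s else if i = m+2 then t else 0)"
    (is "_ \<longlonglongrightarrow> ?c") if "i \<noteq> m" for i
  proof (rule metric_LIMSEQ_I)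
    fix r :: real assume "r > 0"
    then obtain N where N: "inverse (Suc N) < r" using reals_Archimedean by blast
    have "dist (u q n i) ?c < r" if "q \<ge> N" for q
    proof -
      have "dist (u q n i) ?c < inverse (Suc q)" using u(3)[OF \<open>i \<noteq> m\<close>, of q] unfolding T_def by (simp add: dist_commute)
      also have "\<dots> \<le> inverse (Suc N)" using that by (simp add: field_simps)
      finally show ?thesis using N by simp
    qed
    then show "\<exists>N. \<forall>q\<ge>N. dist (u q n i) ?c < r" by blast
  qed
  have row_vals: "u q n m = x1" "u q (n+1) m = x2" "u q (n-1) m = w" "u q (n+2) m = y" for q
    by (simp_all add: u(2) x_def)
  have t3: "(\<lambda>q. u q n (m+1)) \<longlonglongrightarrow> x3" "(\<lambda>q. u q n (m-1)) \<longlonglongrightarrow> s" "(\<lambda>q. u q n (m+2)) \<longlonglongrightarrow> t"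
    using col[of "m+1"] col[of "m-1"] col[of "m+2"] by simp_all
  note gu = gensol_good[OF u(1) j_def[THEN meta_eq_to_obj_eq]]
  have E: "E j x3 x2 x1 \<noteq> 0" "E j x3 w x1 \<noteq> 0" "E j s x2 x1 \<noteq> 0" "E (j+1) x4 y x2 \<noteq> 0" "E (j+1) t x4 x3 \<noteq> 0"
    using g unfolding good_def by blast+
  have u4: "(\<lambda>q. u q (n+1) (m+1)) \<longlonglongrightarrow> x4"
    unfolding good_nx[OF gu(1)] row_vals x4_def by (intro tendsto_nxt tendsto_const t3 E)
  have uw: "(\<lambda>q. u q (n-1) (m+1)) \<longlonglongrightarrow> w'"
    unfolding good_nx[OF gu(2)] row_vals defs by (intro tendsto_nxt tendsto_const t3 E)
  have us: "(\<lambda>q. u q (n+1) (m-1)) \<longlonglongrightarrow> s'"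
    unfolding good_nx[OF gu(3)] row_vals defs by (intro tendsto_nxt tendsto_const t3 E)
  have uy: "(\<lambda>q. u q (n+2) (m+1)) \<longlonglongrightarrow> y'"
    unfolding good_nx[OF gu(4)] row_vals defs by (intro tendsto_nxt tendsto_const t3 u4 E)
  have ut: "(\<lambda>q. u q (n+1) (m+2)) \<longlonglongrightarrow> t'"
    unfolding good_nx[OF gu(5)] defs by (intro tendsto_nxt tendsto_const t3 u4 E)
  have s1: "(\<lambda>q. stencil (u q) n m) \<longlonglongrightarrow> st x1 x2 w x3 s"
    unfolding stencil_eq_st row_vals by (intro tendsto_st tendsto_const t3)
  have s2: "(\<lambda>q. stencil (u q) (n+1) m) \<longlonglongrightarrow> st x2 y x1 x4 s'"
    using tendsto_st[OF tendsto_const tendsto_const tendsto_const u4 us, of x2 y x1]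
    unfolding stencil_eq_st by (simp add: row_vals add.commute[of 2])
  have s3: "(\<lambda>q. stencil (u q) n (m+1)) \<longlonglongrightarrow> st x3 x4 w' t x1"
    using tendsto_st[OF t3(1) u4 uw t3(3) tendsto_const, of x1]
    unfolding stencil_eq_st by (simp add: row_vals add.commute[of 2])
  have s4: "(\<lambda>q. stencil (u q) (n+1) (m+1)) \<longlonglongrightarrow> st x4 y' x3 t' x2"
    using tendsto_st[OF u4 uy t3(1) ut tendsto_const, of x2]
    unfolding stencil_eq_st by (simp add: row_vals add.commute[of 2])
  have Rt: "(\<lambda>q. R i i' (f q)) \<longlonglongrightarrow> R i i' v" if "f \<longlonglongrightarrow> v" "v \<in> A i i'" for f v i i'
    using isCont_tendsto_compose[OF holo_on_isCont[OF R_holo that(2)] that(1)] .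
  let ?S = "\<lambda>q. dQ j (u q n m) (u q (n+1) m) (u q n (m+1)) (u q (n+1) (m+1)) (R n m (stencil (u q) n m))
      (R (n+1) m (stencil (u q) (n+1) m)) (R n (m+1) (stencil (u q) n (m+1))) (R (n+1) (m+1) (stencil (u q) (n+1) (m+1)))
      + K n m (u q n m) (u q (n+1) m) (u q n (m+1)) (u q (n+1) (m+1))"
  have "?S \<longlonglongrightarrow> dQ j x1 x2 x3 x4 (R n m (st x1 x2 w x3 s)) (R (n+1) m (st x2 y x1 x4 s'))
      (R n (m+1) (st x3 x4 w' t x1)) (R (n+1) (m+1) (st x4 y' x3 t' x2)) + K n m x1 x2 x3 x4"
    unfolding row_vals dquad_def
    by (intro tendsto_add tendsto_mult tendsto_dq Rt K_tendsto inA s1 s2 s3 s4 t3 u4 tendsto_const)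
  \<comment> \<open>The domains are open, so the stencils of the approximating solutions eventually
    lie in them and the criterion applies.\<close>
  moreover have "\<forall>\<^sub>F q in sequentially. ?S q = 0"
    using topological_tendstoD[OF s1 A_open inA(1)] topological_tendstoD[OF s2 A_open inA(2)]
      topological_tendstoD[OF s3 A_open inA(3)] topological_tendstoD[OF s4 A_open inA(4)]
    by eventually_elim (use crit[OF u(1)] in \<open>simp only: j_def\<close>)
  then have "?S \<longlonglongrightarrow> 0" by (rule tendsto_eventually)
  ultimately show ?thesis unfolding defs by (rule LIMSEQ_unique)
qed

definition near :: "real \<Rightarrow> int \<Rightarrow> int \<Rightarrow> complex \<Rightarrow> complex \<Rightarrow> complex \<Rightarrow> complex \<Rightarrow> complex \<Rightarrow> bool" where
  "near d n m c f w nn s \<longleftrightarrow> dist c (u0 n m) < d \<and> dist f (u0 (n+1) m) < d \<and> dist w (u0 (n-1) m) < d \<and>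
    dist nn (u0 n (m+1)) < d \<and> dist s (u0 n (m-1)) < d"

lemma near_openE:
  assumes "near d n m c f w nn s"
  obtains r where "r > 0" "\<And>c' f' w' nn' s'. dist c' c < r \<Longrightarrow> dist f' f < r \<Longrightarrow> dist w' w < r \<Longrightarrow>
    dist nn' nn < r \<Longrightarrow> dist s' s < r \<Longrightarrow> near d n m c' f' w' nn' s'"
proof -
  have "\<exists>r>0. \<forall>c' f' w' nn' s'. dist c' c < r \<and> dist f' f < r \<and> dist w' w < r \<and> dist nn' nn < r \<and> dist s' s < r
    \<longrightarrow> near d n m c' f' w' nn' s'"
  proof -
    define \<rho> where "\<rho> = (\<lambda>x y :: complex. d - dist y x)"
    have \<rho>: "dist y x < d \<Longrightarrow> \<rho> x y > 0 \<and> (dist z y < \<rho> x y \<longrightarrow> dist z x < d)" for x y z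
      using dist_triangle[of z x y] by (simp add: \<rho>_def)
    let ?R = "{\<rho> (u0 n m) c, \<rho> (u0 (n+1) m) f, \<rho> (u0 (n-1) m) w, \<rho> (u0 n (m+1)) nn, \<rho> (u0 n (m-1)) s}"
    show ?thesis
      using assms \<rho> unfolding near_def by (intro exI[of _ "Min ?R"]) (simp, blast)
  qed
  then show thesis using that by blast
qed

text \<open>The values at \<open>(n+2,m)\<close> and \<open>(n,m+2)\<close> are frozen at those of
  \<open>u0\<close>; the five values of the stencil at \<open>(n,m)\<close> stay free.\<close>

lemma patch_nbhd:
  "\<exists>d>0. \<forall>c e w nn s. near d n m c e w nn s \<longrightarrow> patch n m c e nn w (u0 (n+2) m) s (u0 n (m+2))"
proof -
  let ?p = "(u0 n m, u0 (n+1) m, u0 (n-1) m, u0 n (m+1), u0 n (m-1))"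
  have id: "((\<lambda>p. p) \<longlongrightarrow> ?p) (nhds ?p)" by (simp add: filterlim_def)
  note s1 = tendsto_snd[OF id] note s2 = tendsto_snd[OF s1] note s3 = tendsto_snd[OF s2]
  have "\<forall>\<^sub>F p in nhds ?p. patch n m (fst p) (fst (snd p)) (fst (snd (snd (snd p)))) (fst (snd (snd p)))
    (u0 (n+2) m) (snd (snd (snd (snd p)))) (u0 n (m+2))"
    using tendsto_fst[OF id] tendsto_fst[OF s1] tendsto_fst[OF s2] tendsto_fst[OF s3] tendsto_snd[OF s3]
    by (intro patch_eventually tendsto_const) simp_all
  from eventually_nhds_5[OF this] show ?thesis by (simp add: near_def)
qed

end

subsection \<open>Reflections and transposition\<close>

fun hfl :: "site \<Rightarrow> site" where
  "hfl Centre = Centre" | "hfl East = West" | "hfl West = East" | "hfl North = North" | "hfl South = South"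

fun tps :: "site \<Rightarrow> site" where
  "tps Centre = Centre" | "tps East = North" | "tps West = South" | "tps North = East" | "tps South = West"

lemma hfl_invol: "hfl (hfl s) = s" and tps_invol: "tps (tps s) = s"
  by (cases s; simp)+

definition perm :: "(site \<Rightarrow> site) \<Rightarrow> complex ^ site \<Rightarrow> complex ^ site" where
  "perm p v = (\<chi> s. v $ p s)"

lemma perm_component [simp]: "perm p v $ s = v $ p s"
  by (simp add: perm_def)

lemma perm_st [simp]: "perm hfl (st c e w n s) = st c w e n s" "perm tps (st c e w n s) = st c n s e w"
  by (simp_all add: vec_eq_iff all_site)

lemma bounded_linear_perm: "bounded_linear (perm p)"
proof -
  have "linear (perm p)" by (intro linearI) (auto simp: vec_eq_iff)
  then show ?thesis by (simp add: linear_conv_bounded_linear)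
qed

lemma holo_on_perm:
  assumes F: "holo_on F B" and p: "\<And>s. p (p s) = s"
  shows "holo_on (\<lambda>v. F (perm p v)) {v. perm p v \<in> B}"
proof (rule holo_onI)
  fix v assume "v \<in> {v. perm p v \<in> B}"
  then have "((\<lambda>v. F (perm p v)) has_derivative (\<lambda>h. \<Sum>s\<in>UNIV. pd s F (perm p v) * perm p h $ s)) (at v)"
    using has_derivative_compose[OF bounded_linear_imp_has_derivative[OF bounded_linear_perm] holo_onE[OF F]] by blast
  moreover have "(\<Sum>s\<in>UNIV. pd s F (perm p v) * perm p h $ s) = (\<Sum>s\<in>UNIV. pd (p s) F (perm p v) * h $ s)" for h
    by (rule sum.reindex_bij_witness[of _ p p]) (auto simp: p)
  ultimately show "((\<lambda>v. F (perm p v)) has_derivative (\<lambda>h. \<Sum>s\<in>UNIV. pd (p s) F (perm p v) * h $ s)) (at v)"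
    by simp
qed

lemma pd_perm:
  assumes p: "\<And>s. p (p s) = s"
  shows "pd s (\<lambda>v. F (perm p v)) v = pd (p s) F (perm p v)"
proof -
  have "perm p (v + axis s t) = perm p v + axis (p s) t" for t
    by (auto simp: vec_eq_iff axis_component p)
  then show ?thesis by (simp add: pd_def)
qed

lemma open_perm: "open B \<Longrightarrow> open {v. perm p v \<in> B}"
  using open_vimage[of B "perm p"] linear_continuous_on[OF bounded_linear_perm] by (simp add: vimage_def)

lemma connected_perm:
  assumes B: "connected B" and p: "\<And>s. p (p s) = s"
  shows "connected {v. perm p v \<in> B}"
proof -
  have "perm p (perm p v) = v" for v by (simp add: vec_eq_iff p)
  then have "{v. perm p v \<in> B} = perm p ` B" by (auto simp: image_iff) metis
  then show ?thesis
    using connected_continuous_image[OF linear_continuous_on[OF bounded_linear_perm] B] by simp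
qed

definition hA :: "(int \<Rightarrow> int \<Rightarrow> (complex ^ site) set) \<Rightarrow> int \<Rightarrow> int \<Rightarrow> (complex ^ site) set" where
  "hA A n m = {v. perm hfl v \<in> A (- n) m}"

definition hR :: "(int \<Rightarrow> int \<Rightarrow> complex ^ site \<Rightarrow> complex) \<Rightarrow> int \<Rightarrow> int \<Rightarrow> complex ^ site \<Rightarrow> complex" where
  "hR R n m v = R (- n) m (perm hfl v)"

text \<open>Reflection sends a cell with lower left corner \<open>n\<close> to one with lower left
  corner \<open>-n-1\<close> and exchanges its left and right vertices.\<close>

definition hK :: "(int \<Rightarrow> int \<Rightarrow> complex \<Rightarrow> complex \<Rightarrow> complex \<Rightarrow> complex \<Rightarrow> complex)
    \<Rightarrow> int \<Rightarrow> int \<Rightarrow> complex \<Rightarrow> complex \<Rightarrow> complex \<Rightarrow> complex \<Rightarrow> complex" where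
  "hK K n m x1 x2 x3 x4 = K (- n - 1) m x2 x1 x4 x3"

definition hu :: "(int \<Rightarrow> int \<Rightarrow> complex) \<Rightarrow> int \<Rightarrow> int \<Rightarrow> complex" where
  "hu u n m = u (- n) m"

definition tA :: "(int \<Rightarrow> int \<Rightarrow> (complex ^ site) set) \<Rightarrow> int \<Rightarrow> int \<Rightarrow> (complex ^ site) set" where
  "tA A n m = {v. perm tps v \<in> A m n}"

definition tR :: "(int \<Rightarrow> int \<Rightarrow> complex ^ site \<Rightarrow> complex) \<Rightarrow> int \<Rightarrow> int \<Rightarrow> complex ^ site \<Rightarrow> complex" where
  "tR R n m v = R m n (perm tps v)"

definition tK :: "(int \<Rightarrow> int \<Rightarrow> complex \<Rightarrow> complex \<Rightarrow> complex \<Rightarrow> complex \<Rightarrow> complex)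
    \<Rightarrow> int \<Rightarrow> int \<Rightarrow> complex \<Rightarrow> complex \<Rightarrow> complex \<Rightarrow> complex \<Rightarrow> complex" where
  "tK K n m x1 x2 x3 x4 = K m n x1 x3 x2 x4"

definition tu :: "(int \<Rightarrow> int \<Rightarrow> complex) \<Rightarrow> int \<Rightarrow> int \<Rightarrow> complex" where
  "tu u n m = u m n"

lemma hu_hu [simp]: "hu (hu u) = u" and tu_tu [simp]: "tu (tu u) = u"
  by (simp_all add: fun_eq_iff hu_def tu_def)

lemma perm_stencil_hu: "perm hfl (stencil u n m) = stencil (hu u) (- n) m"
  by (simp add: stencil_eq_st hu_def add.commute)

lemma perm_stencil_tu: "perm tps (stencil u n m) = stencil (tu u) m n"
  by (simp add: stencil_eq_st tu_def)

lemma dq_transpose: "dq b a e l j v h d = dq a b e l j h v d"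
  by (simp add: dq_def)

lemma dquad_transpose: "dquad b a e l j x1 x3 x2 x4 r1 r3 r2 r4 = dquad a b e l j x1 x2 x3 x4 r1 r2 r3 r4"
  by (simp add: dquad_def dq_transpose[of b a])

lemma good_transpose: "good b a k e l j x1 x3 x2 x4 \<longleftrightarrow> good a b k e l j x1 x2 x3 x4"
proof -
  have "quad b a k e l j x1 x3 x2 x4 = quad a b k e l j x1 x2 x3 x4"
    by (simp add: quad_def algebra_simps)
  then show ?thesis unfolding good_def dq_transpose[of b a] by auto
qed

lemma gensol_transpose: "gensol b a k e l (tu u) \<longleftrightarrow> gensol a b k e l u"
  unfolding gensol_def tu_def good_transpose[of b a] by (metis add.commute)

lemma (in bw_quad) bw_quad_transpose: "bw_quad b a k e l"
  by unfold_locales (use a_nz b_nz e_per l_per e_mult edge_nz in auto)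

lemma (in bw_quad) gensol_hflip:
  assumes "gensol a b k e l u" shows "gensol a b k e l (hu u)"
  unfolding gensol_def
proof (intro allI)
  fix n m
  have "gd (- n - 1 + m) (u (- n - 1) m) (u (- n) m) (u (- n - 1) (m+1)) (u (- n) (m+1))"
    using gensol_good(1)[OF assms refl, of "- n - 1" m] by simp
  then have "gd (- n - 1 + m + 1) (u (- n) m) (u (- n - 1) m) (u (- n) (m+1)) (u (- n - 1) (m+1))"
    by (simp only: good_hflip)
  moreover have "gd (- n - 1 + m + 1) = gd (n + m)" by (rule even_shift_all) simp
  ultimately show "gd (n + m) (hu u n m) (hu u (n+1) m) (hu u n (m+1)) (hu u (n+1) (m+1))"
    by (simp add: hu_def)
qed

context bw_symmetry
begin

text \<open>The reflected criterion at \<open>(n,m)\<close> is the original one at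
  \<open>(-n-1,m)\<close>. The colours agree because \<open>n + m\<close> and \<open>-n + m\<close>
  have the same parity.\<close>

lemma symmetry_hflip: "bw_symmetry a b k e l (hA A) (hR R) (hK K) (hu u0)"
proof unfold_locales
  fix n m
  show "open (hA A n m)" "connected (hA A n m)"
    unfolding hA_def using open_perm A_open connected_perm[OF A_conn hfl_invol] by blast+
  show "holo_on (hR R n m) (hA A n m)"
    unfolding hA_def hR_def[abs_def] using R_holo hfl_invol by (rule holo_on_perm)
  show "gensol a b k e l (hu u0)" using u0_sol by (rule gensol_hflip)
  show "stencil (hu u0) n m \<in> hA A n m"
    using u0_in[of "-n" m] by (simp add: hA_def perm_stencil_hu)
  fix f1 f2 f3 f4 :: "nat \<Rightarrow> complex" and x1 x2 x3 x4
  assume "f1 \<longlonglongrightarrow> x1" "f2 \<longlonglongrightarrow> x2" "f3 \<longlonglongrightarrow> x3" "f4 \<longlonglongrightarrow> x4"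
  then show "(\<lambda>i. hK K n m (f1 i) (f2 i) (f3 i) (f4 i)) \<longlonglongrightarrow> hK K n m x1 x2 x3 x4"
    unfolding hK_def by (intro K_tendsto)
next
  fix u n m
  assume u: "gensol a b k e l u" and s: "stencil u n m \<in> hA A n m" "stencil u (n+1) m \<in> hA A (n+1) m"
    "stencil u n (m+1) \<in> hA A n (m+1)" "stencil u (n+1) (m+1) \<in> hA A (n+1) (m+1)"
  define n' where "n' = - n - 1"
  have n': "- n = n' + 1" "- (n + 1) = n'" by (simp_all add: n'_def)
  have E: "E (n' + m) = E (n + m + 1)" "E (n' + m + 1) = E (n + m)"
    by (rule even_shift_all, simp add: n'_def)+
  have uu: "hu u n' i = u (n+1) i" "hu u (n'+1) i = u n i" for i by (simp_all add: hu_def n'_def add.commute)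
  have "dQ (n'+m) (hu u n' m) (hu u (n'+1) m) (hu u n' (m+1)) (hu u (n'+1) (m+1)) (R n' m (stencil (hu u) n' m))
        (R (n'+1) m (stencil (hu u) (n'+1) m)) (R n' (m+1) (stencil (hu u) n' (m+1))) (R (n'+1) (m+1) (stencil (hu u) (n'+1) (m+1)))
      + K n' m (hu u n' m) (hu u (n'+1) m) (hu u n' (m+1)) (hu u (n'+1) (m+1)) = 0"
    using s unfolding hA_def mem_Collect_eq perm_stencil_hu n' by (intro crit gensol_hflip u)
  then show "dQ (n+m) (u n m) (u (n+1) m) (u n (m+1)) (u (n+1) (m+1)) (hR R n m (stencil u n m)) (hR R (n+1) m (stencil u (n+1) m))
        (hR R n (m+1) (stencil u n (m+1))) (hR R (n+1) (m+1) (stencil u (n+1) (m+1)))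
      + hK K n m (u n m) (u (n+1) m) (u n (m+1)) (u (n+1) (m+1)) = 0"
    unfolding hR_def hK_def perm_stencil_hu n' dquad_def E uu n'_def[symmetric] by (simp add: algebra_simps)
qed

lemma symmetry_transpose: "bw_symmetry b a k e l (tA A) (tR R) (tK K) (tu u0)"
proof (intro bw_symmetry.intro bw_quad_transpose bw_symmetry_axioms.intro)
  fix n m
  show "open (tA A n m)" "connected (tA A n m)"
    unfolding tA_def using open_perm A_open connected_perm[OF A_conn tps_invol] by blast+
  show "holo_on (tR R n m) (tA A n m)"
    unfolding tA_def tR_def[abs_def] using R_holo tps_invol by (rule holo_on_perm)
  show "gensol b a k e l (tu u0)" using u0_sol by (simp add: gensol_transpose)
  show "stencil (tu u0) n m \<in> tA A n m"
    using u0_in[of m n] by (simp add: tA_def perm_stencil_tu)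
  fix f1 f2 f3 f4 :: "nat \<Rightarrow> complex" and x1 x2 x3 x4
  assume "f1 \<longlonglongrightarrow> x1" "f2 \<longlonglongrightarrow> x2" "f3 \<longlonglongrightarrow> x3" "f4 \<longlonglongrightarrow> x4"
  then show "(\<lambda>i. tK K n m (f1 i) (f2 i) (f3 i) (f4 i)) \<longlonglongrightarrow> tK K n m x1 x2 x3 x4"
    unfolding tK_def by (intro K_tendsto)
next
  fix u n m
  assume u: "gensol b a k e l u" and s: "stencil u n m \<in> tA A n m" "stencil u (n+1) m \<in> tA A (n+1) m"
    "stencil u n (m+1) \<in> tA A n (m+1)" "stencil u (n+1) (m+1) \<in> tA A (n+1) (m+1)"
  have u': "gensol a b k e l (tu u)"
    using u gensol_transpose[of a b k e l u] by simp
  have "dQ (m+n) (tu u m n) (tu u (m+1) n) (tu u m (n+1)) (tu u (m+1) (n+1)) (R m n (stencil (tu u) m n))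
        (R (m+1) n (stencil (tu u) (m+1) n)) (R m (n+1) (stencil (tu u) m (n+1))) (R (m+1) (n+1) (stencil (tu u) (m+1) (n+1)))
      + K m n (tu u m n) (tu u (m+1) n) (tu u m (n+1)) (tu u (m+1) (n+1)) = 0"
    using s unfolding tA_def mem_Collect_eq perm_stencil_tu by (intro crit u')
  then show "dquad b a e l (n+m) (u n m) (u (n+1) m) (u n (m+1)) (u (n+1) (m+1)) (tR R n m (stencil u n m))
        (tR R (n+1) m (stencil u (n+1) m)) (tR R n (m+1) (stencil u n (m+1))) (tR R (n+1) (m+1) (stencil u (n+1) (m+1)))
      + tK K n m (u n m) (u (n+1) m) (u n (m+1)) (u (n+1) (m+1)) = 0"
    unfolding dquad_transpose[of b a] tR_def tK_def perm_stencil_tu by (simp only: tu_def add.commute)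
qed

end

subsection \<open>The western derivative of the characteristic\<close>

lemma has_field_derivative_st:
  assumes F: "holo_on F A" "st c e w n s \<in> A"
  shows "((\<lambda>x. F (st x e w n s)) has_field_derivative pd Centre F (st c e w n s)) (at c)"
    and "((\<lambda>x. F (st c x w n s)) has_field_derivative pd East F (st c e w n s)) (at e)"
    and "((\<lambda>x. F (st c e x n s)) has_field_derivative pd West F (st c e w n s)) (at w)"
  using pd_line[OF F(1), of "st 0 e w n s" Centre c] pd_line[OF F(1), of "st c 0 w n s" East e]
    pd_line[OF F(1), of "st c e 0 n s" West w] F(2)
  by (simp_all add: st_plus_axis)

context bw_quad
begin

text \<open>Implicit differentiation: the derivative of \<open>x4\<close> is minus the quotient of
  the derivatives of the equation with respect to \<open>x2\<close> and \<open>x4\<close>.\<close>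

lemma nx_deriv2:
  assumes D: "E j x3 x2 x1 \<noteq> 0"
  shows "((\<lambda>x2. nx j x1 x2 x3) has_field_derivative - E (j+1) x1 (nx j x1 x2 x3) x3 / E j x3 x2 x1) (at x2)"
proof -
  define N where "N = (\<lambda>x2. a * x1 * x2 + b * x1 * x3 + e (j+1) * x2 * x3 + l j * x1 + l (j+1) * (x2 + x3) + k)"
  have N: "N x2 = - (nx j x1 x2 x3 * E j x3 x2 x1)" using D by (simp add: nxt_def N_def)
  have "(N has_field_derivative a * x1 + e (j+1) * x3 + l (j+1)) (at x2)"
    unfolding N_def by (auto intro!: derivative_eq_intros simp: algebra_simps)
  moreover have "((\<lambda>x2. E j x3 x2 x1) has_field_derivative b) (at x2)"
    unfolding dq_def by (auto intro!: derivative_eq_intros)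
  ultimately have h1: "((\<lambda>x2. - N x2 / E j x3 x2 x1) has_field_derivative
      (- (a * x1 + e (j+1) * x3 + l (j+1)) * E j x3 x2 x1 - (- N x2) * b) / (E j x3 x2 x1 * E j x3 x2 x1)) (at x2)"
    using D by (intro DERIV_divide DERIV_minus)
  have h2: "(- (a * x1 + e (j+1) * x3 + l (j+1)) * E j x3 x2 x1 - (- N x2) * b) / (E j x3 x2 x1 * E j x3 x2 x1)
      = - (a * x1 + e (j+1) * x3 + l (j+1) + b * nx j x1 x2 x3) / E j x3 x2 x1"
    using D by (simp add: N field_simps)
  have h3: "a * x1 + e (j+1) * x3 + l (j+1) + b * nx j x1 x2 x3 = E (j+1) x1 (nx j x1 x2 x3) x3"
    by (simp add: dq_def)
  have h4: "(\<lambda>x2. - N x2 / E j x3 x2 x1) = (\<lambda>x2. nx j x1 x2 x3)"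
    by (simp add: fun_eq_iff nxt_def N_def)
  show ?thesis using h1 unfolding h4 h2 h3 .
qed

lemma nx_deriv1:
  assumes D: "E j x3 x2 x1 \<noteq> 0"
  shows "((\<lambda>x1. nx j x1 x2 x3) has_field_derivative - E j x2 x3 (nx j x1 x2 x3) / E j x3 x2 x1) (at x1)"
proof -
  define N where "N = (\<lambda>x1. a * x1 * x2 + b * x1 * x3 + e (j+1) * x2 * x3 + l j * x1 + l (j+1) * (x2 + x3) + k)"
  have N: "N x1 = - (nx j x1 x2 x3 * E j x3 x2 x1)" using D by (simp add: nxt_def N_def)
  have "(N has_field_derivative a * x2 + b * x3 + l j) (at x1)"
    unfolding N_def by (auto intro!: derivative_eq_intros simp: algebra_simps)
  moreover have "((\<lambda>x1. E j x3 x2 x1) has_field_derivative e j) (at x1)"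
    unfolding dq_def by (auto intro!: derivative_eq_intros)
  ultimately have h1: "((\<lambda>x1. - N x1 / E j x3 x2 x1) has_field_derivative
      (- (a * x2 + b * x3 + l j) * E j x3 x2 x1 - (- N x1) * e j) / (E j x3 x2 x1 * E j x3 x2 x1)) (at x1)"
    using D by (intro DERIV_divide DERIV_minus)
  have h2: "(- (a * x2 + b * x3 + l j) * E j x3 x2 x1 - (- N x1) * e j) / (E j x3 x2 x1 * E j x3 x2 x1)
      = - (a * x2 + b * x3 + l j + e j * nx j x1 x2 x3) / E j x3 x2 x1"
    using D by (simp add: N field_simps)
  have h3: "a * x2 + b * x3 + l j + e j * nx j x1 x2 x3 = E j x2 x3 (nx j x1 x2 x3)"
    by (simp add: dq_def)
  have h4: "(\<lambda>x1. - N x1 / E j x3 x2 x1) = (\<lambda>x1. nx j x1 x2 x3)"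
    by (simp add: fun_eq_iff nxt_def N_def)
  show ?thesis using h1 unfolding h4 h2 h3 .
qed

text \<open>The difference formula of the Moebius map \<open>x2 \<mapsto> x4\<close>, whose
  determinant is, up to sign, the vertical discriminant.\<close>

lemma nx_diff:
  assumes "E j x3 x2 x1 \<noteq> 0" "E j x3 w x1 \<noteq> 0"
  shows "(nx j x1 x2 x3 - nx j x1 w x3) * (E j x3 x2 x1 * E j x3 w x1) = - gB j x1 x3 * (x2 - w)"
proof -
  define N where "N = (\<lambda>y. a * x1 * y + b * x1 * x3 + e (j+1) * y * x3 + l j * x1 + l (j+1) * (y + x3) + k)"
  have N: "E j x3 y x1 * nx j x1 y x3 = - N y" if "E j x3 y x1 \<noteq> 0" for y
    using that by (simp add: nxt_def N_def)
  have "(nx j x1 x2 x3 - nx j x1 w x3) * (E j x3 x2 x1 * E j x3 w x1)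
      = (E j x3 x2 x1 * nx j x1 x2 x3) * E j x3 w x1 - (E j x3 w x1 * nx j x1 w x3) * E j x3 x2 x1"
    by (simp add: algebra_simps)
  also have "\<dots> = - N x2 * E j x3 w x1 + N w * E j x3 x2 x1"
    unfolding N[OF assms(1)] N[OF assms(2)] by simp
  also have "\<dots> = - gB j x1 x3 * (x2 - w)"
    by (simp add: N_def dq_def edge_def algebra_simps)
  finally show ?thesis .
qed

end

context bw_symmetry
begin

text \<open>Only the characteristics at \<open>(n,m)\<close> and \<open>(n,m+1)\<close> contain
  \<open>w\<close>, the second one through \<open>w'\<close>. Differentiating the criterion in
  \<open>w\<close> removes all other terms, including \<open>K\<close>, and the chain rule
  contributes the derivative of \<open>w'\<close>.\<close>

lemma west_relation:
  assumes r: "r > 0" and p: "\<And>w'. dist w' w < r \<Longrightarrow> patch n m x1 x2 x3 w' y s t"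
  defines "j \<equiv> n + m"
  defines "x4 \<equiv> nx j x1 x2 x3" and "w' \<equiv> nx j x1 w x3"
  shows "pd West (R n m) (st x1 x2 w x3 s) * (E j x2 x3 x4 * E j x3 w x1)
    = pd West (R n (m+1)) (st x3 x4 w' t x1) * (E (j+1) x1 w' x3 * E (j+1) x4 x1 x2)"
proof -
  have pw: "patch n m x1 x2 x3 w y s t" using p r by simp
  then have inA: "st x1 x2 w x3 s \<in> A n m" "st x3 x4 w' t x1 \<in> A n (m+1)" and gw: "gd j x1 w x3 w'"
    unfolding patch_def Let_def x4_def w'_def j_def by auto
  have Ew: "E j x3 w x1 \<noteq> 0" using gw by (simp add: good_def)
  define c where "c = R (n+1) m (st x2 y x1 x4 (nx j x1 x2 s)) * E (j+1) x1 x4 x3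
    + R (n+1) (m+1) (st x4 (nx (j+1) x2 y x4) x3 (nx (j+1) x3 x4 t) x2) * E j x3 x2 x1 + K n m x1 x2 x3 x4"
  define f where "f = (\<lambda>w. R n m (st x1 x2 w x3 s) * E j x2 x3 x4
    + R n (m+1) (st x3 x4 (nx j x1 w x3) t x1) * E (j+1) x4 x1 x2 + c)"
  have f0: "f w1 = 0" if "dist w1 w < r" for w1
    using patch_criterion[OF p[OF that]] unfolding f_def c_def x4_def j_def dquad_def by (simp add: algebra_simps)
  have d1: "((\<lambda>w. R n m (st x1 x2 w x3 s)) has_field_derivative pd West (R n m) (st x1 x2 w x3 s)) (at w)"
    using has_field_derivative_st(3)[OF R_holo inA(1)] .
  have d2: "((\<lambda>w. R n (m+1) (st x3 x4 (nx j x1 w x3) t x1)) has_field_derivative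
      pd West (R n (m+1)) (st x3 x4 w' t x1) * (- E (j+1) x1 w' x3 / E j x3 w x1)) (at w)"
  proof -
    have "((\<lambda>w. st x3 x4 (nx j x1 w x3) t x1 $ i) has_field_derivative
        (if i = West then - E (j+1) x1 w' x3 / E j x3 w x1 else 0)) (at w)" for i
      using nx_deriv2[OF Ew] by (cases i) (auto simp: w'_def)
    from holo_on_chain[OF R_holo _ this, of n "m+1"] inA(2) show ?thesis by (simp add: sum_site w'_def)
  qed
  have "(f has_field_derivative pd West (R n m) (st x1 x2 w x3 s) * E j x2 x3 x4
      + pd West (R n (m+1)) (st x3 x4 w' t x1) * (- E (j+1) x1 w' x3 / E j x3 w x1) * E (j+1) x4 x1 x2 + 0) (at w)"
    unfolding f_def by (intro DERIV_add DERIV_const DERIV_cmult_right d1 d2)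
  moreover have "(f has_field_derivative 0) (at w)"
  proof (rule has_field_derivative_transform_within[OF DERIV_const[of 0] r])
    show "0 = f w1" if "dist w1 w < r" for w1 using f0[OF that] by simp
  qed simp
  ultimately have "pd West (R n m) (st x1 x2 w x3 s) * E j x2 x3 x4
      + pd West (R n (m+1)) (st x3 x4 w' t x1) * (- E (j+1) x1 w' x3 / E j x3 w x1) * E (j+1) x4 x1 x2 + 0 = 0"
    by (rule DERIV_unique)
  then show ?thesis using Ew by (simp add: field_simps)
qed

text \<open>In \<open>west_relation\<close> the value \<open>s\<close> occurs only inside the
  left-hand derivative, whose cofactor is nonzero.\<close>

lemma south_independent:
  "\<exists>d>0. \<forall>c e w nn s s'. near d n m c e w nn s \<longrightarrow> near d n m c e w nn s' \<longrightarrow>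
    pd West (R n m) (st c e w nn s) = pd West (R n m) (st c e w nn s')"
proof -
  obtain d where d: "d > 0" "\<And>c e w nn s. near d n m c e w nn s \<Longrightarrow> patch n m c e nn w (u0 (n+2) m) s (u0 n (m+2))"
    using patch_nbhd by metis
  have "pd West (R n m) (st c e w nn s) = pd West (R n m) (st c e w nn s')"
    if h: "near d n m c e w nn s" "near d n m c e w nn s'" for c e w nn s s'
  proof -
    from h(1) obtain r where r: "r > 0" "\<And>w'. dist w' w < r \<Longrightarrow> near d n m c e w' nn s"
      by (rule near_openE) auto
    have p: "patch n m c e nn w' (u0 (n+2) m) s (u0 n (m+2))" "patch n m c e nn w' (u0 (n+2) m) s' (u0 n (m+2))"
      if "dist w' w < r" for w' using d(2) r(2)[OF that] h(2) by (simp_all add: near_def)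
    have "gd (n+m) c e nn (nx (n+m) c e nn)" "gd (n+m) c w nn (nx (n+m) c w nn)"
      using p(1)[of w] r unfolding patch_def Let_def by auto
    then have "E (n+m) e nn (nx (n+m) c e nn) * E (n+m) nn w c \<noteq> 0" by (simp add: good_def)
    then show ?thesis
      using west_relation[of r w n m c e nn "u0 (n+2) m" s "u0 n (m+2)", OF r(1) p(1)]
        west_relation[of r w n m c e nn "u0 (n+2) m" s' "u0 n (m+2)", OF r(1) p(2)] by (metis mult_right_cancel)
  qed
  then show ?thesis using d(1) by blast
qed

text \<open>For the known symmetry \<open>v\<^sub>n\<close> the following function is constant.\<close>

definition lam :: "int \<Rightarrow> int \<Rightarrow> complex ^ site \<Rightarrow> complex" where
  "lam n m v = pd West (R n m) v * (v $ East - v $ West)\<^sup>2 / gA (n+m) (v $ Centre) (v $ East)"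

text \<open>On solutions the two discriminants are \<open>e3 * e4\<close> and
  \<open>e1 * e2\<close>, the Moebius map turns \<open>x2 - w\<close> into \<open>x4 - w'\<close>
  with factor \<open>- e2 / f4\<close>, and \<open>f2 * f4 = e2 * e4\<close>. These factors match
  those in \<open>west_relation\<close>.\<close>

lemma lam_relation:
  assumes r: "r > 0" and p: "\<And>w'. dist w' w < r \<Longrightarrow> patch n m x1 x2 x3 w' y s t"
  defines "j \<equiv> n + m"
  defines "x4 \<equiv> nx j x1 x2 x3" and "w' \<equiv> nx j x1 w x3"
  shows "lam n m (st x1 x2 w x3 s) = lam n (m+1) (st x3 x4 w' t x1)"
proof -
  have "patch n m x1 x2 x3 w y s t" using p r by simp
  then have g: "gd j x1 x2 x3 x4" "gd j x1 w x3 w'"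
    unfolding patch_def Let_def x4_def w'_def j_def by auto
  define P P' where "P = pd West (R n m) (st x1 x2 w x3 s)" "P' = pd West (R n (m+1)) (st x3 x4 w' t x1)"
  define e1 e2 e3 e4 f2 f4 where "e1 = E j x2 x3 x4" "e2 = E (j+1) x1 x4 x3" "e3 = E (j+1) x4 x1 x2" "e4 = E j x3 x2 x1"
    "f2 = E (j+1) x1 w' x3" "f4 = E j x3 w x1"
  note defs = e1_e2_e3_e4_f2_f4_def
  have nz: "e1 \<noteq> 0" "e2 \<noteq> 0" "e3 \<noteq> 0" "e4 \<noteq> 0" "f2 \<noteq> 0" "f4 \<noteq> 0"
    using g unfolding good_def defs by blast+
  have Q: "Q j x1 x2 x3 x4 = 0" "Q j x1 w x3 w' = 0" using g unfolding good_def by blast+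
  have gA: "gA j x1 x2 = e3 * e4" "gA (j+1) x3 x4 = e1 * e2"
    using E34[OF Q(1)] E12[OF Q(1)] by (simp_all add: defs)
  have gB: "gB j x1 x3 = e2 * e4" "gB j x1 x3 = f2 * f4"
    using E24[OF Q(1)] E24[OF Q(2)] by (simp_all add: defs)
  have rel: "P * (e1 * f4) = P' * (f2 * e3)"
    using west_relation[OF r p] unfolding P_P'_def defs x4_def w'_def j_def by blast
  have "(x4 - w') * (e4 * f4) = - (e2 * e4) * (x2 - w)"
    using nx_diff[of j x3 x2 x1 w] nz gB unfolding defs x4_def w'_def by simp
  then have "e4 * ((x4 - w') * f4) = e4 * (- e2 * (x2 - w))" by (simp add: algebra_simps)
  then have diff: "(x4 - w') * f4 = - e2 * (x2 - w)" by (rule mult_left_cancel[THEN iffD1, OF nz(4)])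
  have ef: "f2 * f4 = e2 * e4" using gB by simp
  have "(P' * (x4 - w')\<^sup>2 * (e3 * e4)) * f4\<^sup>2 = P' * e3 * e4 * ((x4 - w') * f4)\<^sup>2"
    by (simp add: power_mult_distrib mult_ac)
  also have "\<dots> = P' * e3 * (e2 * e4) * e2 * (x2 - w)\<^sup>2"
    unfolding diff by (simp add: power2_eq_square algebra_simps)
  also have "\<dots> = (P' * (f2 * e3)) * f4 * e2 * (x2 - w)\<^sup>2"
    unfolding ef[symmetric] by (simp add: algebra_simps)
  also have "\<dots> = (P * (x2 - w)\<^sup>2 * (e1 * e2)) * f4\<^sup>2"
    unfolding rel[symmetric] by (simp add: power2_eq_square algebra_simps)
  finally have "P' * (x4 - w')\<^sup>2 * (e3 * e4) = P * (x2 - w)\<^sup>2 * (e1 * e2)" using nz by simp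
  then have "P * (x2 - w)\<^sup>2 / (e3 * e4) = P' * (x4 - w')\<^sup>2 / (e1 * e2)"
    using nz by (simp add: field_simps)
  then show ?thesis
    using gA unfolding lam_def P_P'_def j_def by (simp add: add.assoc)
qed

end

text \<open>Transposition, horizontal reflection and transposition compose to the vertical
  reflection: it swaps \<open>North\<close> and \<open>South\<close>, keeps \<open>West\<close> and
  sends row \<open>m\<close> to row \<open>-m\<close>.\<close>

lemma (in bw_symmetry) north_independent:
  "\<exists>d>0. \<forall>c e w nn nn' s. near d n m c e w nn s \<longrightarrow> near d n m c e w nn' s \<longrightarrow>
    pd West (R n m) (st c e w nn s) = pd West (R n m) (st c e w nn' s)"
proof -
  interpret V: bw_symmetry a b k e l "tA (hA (tA A))" "tR (hR (tR R))" "tK (hK (tK K))" "tu (hu (tu u0))"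
    by (intro bw_symmetry.symmetry_transpose[where a=b] bw_symmetry.symmetry_hflip symmetry_transpose)
  have R: "tR (hR (tR R)) n (-m) = (\<lambda>v. R n m (perm tps (perm hfl (perm tps v))))"
    by (simp add: fun_eq_iff tR_def hR_def)
  have "pd West (tR (hR (tR R)) n (-m)) v = pd West (R n m) (perm tps (perm hfl (perm tps v)))" for v
    unfolding R using pd_perm[of tps West "\<lambda>v. R n m (perm tps (perm hfl v))" v]
      pd_perm[of hfl South "\<lambda>v. R n m (perm tps v)" "perm tps v"] pd_perm[of tps South "R n m" "perm hfl (perm tps v)"]
    by (simp add: hfl_invol tps_invol)
  then have pV: "pd West (tR (hR (tR R)) n (-m)) (st c e w s nn) = pd West (R n m) (st c e w nn s)" for c e w nn s
    by simp
  have near: "V.near d n (-m) c e w s nn \<longleftrightarrow> near d n m c e w nn s" for d c e w nn s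
    unfolding V.near_def near_def by (auto simp: tu_def hu_def add.commute)
  show ?thesis
    using V.south_independent[of n "-m"] unfolding pV near by blast
qed

section \<open>Closure properties of holomorphic functions of the stencil\<close>

lemma holo_on_const: "holo_on (\<lambda>_. c) A"
  by (rule holo_onI[where c="\<lambda>_ _. 0"]) simp

lemma holo_on_component: "holo_on (\<lambda>v. v $ s) A"
proof (rule holo_onI[where c="\<lambda>_ r. if r = s then 1 else 0"])
  fix v :: "complex ^ site"
  have "(\<Sum>r\<in>UNIV. (if r = s then 1 else 0) * h $ r) = h $ s" for h :: "complex ^ site"
    by (simp add: if_distrib[of "\<lambda>x. x * _"] sum.delta cong: if_cong)
  then show "((\<lambda>v. v $ s) has_derivative (\<lambda>h. \<Sum>r\<in>UNIV. (if r = s then 1 else 0) * h $ r)) (at v)"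
    using bounded_linear_imp_has_derivative[OF bounded_linear_vec_nth] by simp
qed

lemma holo_on_add:
  assumes "holo_on F A" "holo_on G A" shows "holo_on (\<lambda>v. F v + G v) A"
proof (rule holo_onI)
  fix v assume v: "v \<in> A"
  show "((\<lambda>v. F v + G v) has_derivative (\<lambda>h. \<Sum>s\<in>UNIV. (pd s F v + pd s G v) * h $ s)) (at v)"
    using has_derivative_add[OF holo_onE[OF assms(1) v] holo_onE[OF assms(2) v]]
    by (simp add: sum.distrib distrib_right)
qed

lemma holo_on_diff:
  assumes "holo_on F A" "holo_on G A" shows "holo_on (\<lambda>v. F v - G v) A"
proof (rule holo_onI)
  fix v assume v: "v \<in> A"
  show "((\<lambda>v. F v - G v) has_derivative (\<lambda>h. \<Sum>s\<in>UNIV. (pd s F v - pd s G v) * h $ s)) (at v)"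
    using has_derivative_diff[OF holo_onE[OF assms(1) v] holo_onE[OF assms(2) v]]
    by (simp add: sum_subtractf left_diff_distrib)
qed

lemma holo_on_mult:
  assumes "holo_on F A" "holo_on G A" shows "holo_on (\<lambda>v. F v * G v) A"
proof (rule holo_onI)
  fix v assume v: "v \<in> A"
  show "((\<lambda>v. F v * G v) has_derivative (\<lambda>h. \<Sum>s\<in>UNIV. (F v * pd s G v + pd s F v * G v) * h $ s)) (at v)"
    using has_derivative_mult[OF holo_onE[OF assms(1) v] holo_onE[OF assms(2) v]]
    by (simp add: sum.distrib distrib_left sum_distrib_left sum_distrib_right mult_ac)
qed

lemma holo_on_inverse:
  assumes "holo_on F A" "\<And>v. v \<in> A \<Longrightarrow> F v \<noteq> 0" shows "holo_on (\<lambda>v. inverse (F v)) A"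
proof (rule holo_onI)
  fix v assume v: "v \<in> A"
  show "((\<lambda>v. inverse (F v)) has_derivative (\<lambda>h. \<Sum>s\<in>UNIV. (- (inverse (F v) * pd s F v * inverse (F v))) * h $ s)) (at v)"
    using Deriv.has_derivative_inverse[OF assms(2)[OF v] holo_onE[OF assms(1) v]]
    by (simp add: sum_negf sum_distrib_left sum_distrib_right mult_ac)
qed

lemma holo_on_divide:
  assumes "holo_on F A" "holo_on G A" "\<And>v. v \<in> A \<Longrightarrow> G v \<noteq> 0" shows "holo_on (\<lambda>v. F v / G v) A"
  using holo_on_mult[OF assms(1) holo_on_inverse[OF assms(2,3)]] by (simp add: divide_inverse)

lemma holo_on_power2: "holo_on F A \<Longrightarrow> holo_on (\<lambda>v. (F v)\<^sup>2) A"
  unfolding power2_eq_square by (rule holo_on_mult)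

lemma holo_on_edge:
  "holo_on F A \<Longrightarrow> holo_on G A \<Longrightarrow> holo_on (\<lambda>v. edge a b k e l j (F v) (G v)) A"
  unfolding edge_def by (intro holo_on_add holo_on_diff holo_on_mult holo_on_const)

lemmas holo_on_intros = holo_on_add holo_on_diff holo_on_mult holo_on_divide holo_on_power2 holo_on_edge
  holo_on_const holo_on_component

lemma continuous_on_holo: "holo_on F A \<Longrightarrow> continuous_on A F"
  using holo_on_isCont continuous_at_imp_continuous_on by blast

lemma holo_on_constant:
  assumes F: "holo_on F A" "convex A" "\<And>v s. v \<in> A \<Longrightarrow> pd s F v = 0" and vw: "v \<in> A" "w \<in> A"
  shows "F v = F w"
proof -
  have "\<exists>c. \<forall>x\<in>A. F x = c"
  proof (rule has_derivative_zero_constant[OF F(2)])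
    fix x assume "x \<in> A"
    then show "(F has_derivative (\<lambda>h. 0)) (at x within A)"
      using holo_onE[OF F(1)] F(3) has_derivative_at_withinI by fastforce
  qed
  then show ?thesis using vw by auto
qed

lemma DERIV_eq_local:
  fixes f g :: "complex \<Rightarrow> complex"
  assumes "(f has_field_derivative D) (at x)" "(g has_field_derivative D') (at x)"
    and r: "r > 0" "\<And>y. dist y x < r \<Longrightarrow> f y = g y"
  shows "D = D'"
  using has_field_derivative_transform_within[OF assms(1) r(1), of g] r(2) assms(2)
  by (auto intro: DERIV_unique)

lemma pd_eq_local:
  assumes r: "r > 0" "\<And>t. norm t < r \<Longrightarrow> F (v + axis s t) = G (w + axis s t)"
  shows "pd s F v = pd s G w"
  unfolding pd_def
  by (rule deriv_cong_ev) (use r in \<open>auto simp: eventually_nhds_metric dist_norm intro!: exI[of _ r]\<close>)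

section \<open>The gradient of \<open>lam\<close> and its vanishing\<close>

context bw_symmetry
begin

lemma near_stencil:
  assumes "dist (stencil u0 n m) v < d"
  shows "near d n m (v $ Centre) (v $ East) (v $ West) (v $ North) (v $ South)"
proof -
  have "dist (v $ i) (stencil u0 n m $ i) < d" for i
    using dist_vec_nth_le[of v i "stencil u0 n m"] assms by (simp add: dist_commute)
  from this[of Centre] this[of East] this[of West] this[of North] this[of South]
  show ?thesis by (simp add: near_def stencil_eq_st)
qed

text \<open>\<open>south_independent\<close> is local around the stencil of \<open>u0\<close>;
  connectedness of the domain and the identity theorem make it global.\<close>

lemma south_zero:
  assumes "v \<in> A n m"
  shows "pd South (pd West (R n m)) v = 0"
proof -
  obtain d where d: "d > 0" "\<And>c e w nn s s'. near d n m c e w nn s \<Longrightarrow> near d n m c e w nn s' \<Longrightarrow>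
    pd West (R n m) (st c e w nn s) = pd West (R n m) (st c e w nn s')"
    using south_independent[of n m] by metis
  show ?thesis
  proof (rule holo_identity_open[OF holo_on_pd[OF holo_on_pd[OF R_holo A_open] A_open] A_open A_conn u0_in d(1) _ assms])
    fix v assume "dist (stencil u0 n m) v < d"
    note nv = near_stencil[OF this]
    from nv obtain r where r: "r > 0" "\<And>s'. dist s' (v $ South) < r \<Longrightarrow> near d n m (v $ Centre) (v $ East) (v $ West) (v $ North) s'"
      by (rule near_openE) auto
    have "pd South (pd West (R n m)) v = pd South (\<lambda>_. pd West (R n m) v) v"
    proof (rule pd_eq_local[OF r(1)])
      fix t :: complex assume "norm t < r"
      then show "pd West (R n m) (v + axis South t) = pd West (R n m) v"
        using d(2)[OF r(2)[of "v $ South + t"] nv] by (metis add_diff_cancel_left' dist_norm st_plus_axis(5) st_surj)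
    qed
    then show "pd South (pd West (R n m)) v = 0" by (simp add: pd_def)
  qed
qed

definition dom_lam :: "int \<Rightarrow> int \<Rightarrow> (complex ^ site) set" where
  "dom_lam n m = {v \<in> A n m. gA (n+m) (v $ Centre) (v $ East) \<noteq> 0}"

lemma open_dom_lam: "open (dom_lam n m)"
proof -
  have "open {v::complex ^ site. gA (n+m) (v $ Centre) (v $ East) \<noteq> 0}"
    by (intro open_Collect_neq continuous_on_holo[OF holo_on_edge] holo_on_component continuous_on_const)
  then show ?thesis using A_open open_Int by (auto simp: dom_lam_def Collect_conj_eq)
qed

lemma holo_on_lam: "holo_on (lam n m) (dom_lam n m)"
proof -
  have "holo_on (pd West (R n m)) (dom_lam n m)"
    using holo_on_pd[OF R_holo A_open] by (rule holo_on_subset) (auto simp: dom_lam_def)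
  then show ?thesis
    unfolding lam_def[abs_def] by (intro holo_on_intros) (auto simp: dom_lam_def)
qed

lemma lam_south_zero:
  assumes "v \<in> dom_lam n m" shows "pd South (lam n m) v = 0"
proof -
  have v: "v \<in> A n m" using assms by (simp add: dom_lam_def)
  have "((\<lambda>t. pd West (R n m) (v + axis South t)) has_field_derivative 0) (at 0)"
    using has_field_derivative_pd[OF holo_on_pd[OF R_holo A_open] v, of West South] south_zero[OF v] by simp
  then have "((\<lambda>t. pd West (R n m) (v + axis South t) * ((v $ East - v $ West)\<^sup>2 / gA (n+m) (v $ Centre) (v $ East))) has_field_derivative 0) (at 0)"
    by (metis DERIV_cmult_right mult_zero_left)
  moreover have "lam n m (v + axis South t) = pd West (R n m) (v + axis South t) * ((v $ East - v $ West)\<^sup>2 / gA (n+m) (v $ Centre) (v $ East))" for t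
    by (simp add: lam_def axis_component)
  ultimately show ?thesis unfolding pd_def by (simp add: DERIV_imp_deriv)
qed

text \<open>The counterpart of \<open>edge\<close> for the diagonal through \<open>x2\<close> and
  \<open>x3\<close>: it is \<open>Q1 * Q4 - Q * Q14\<close> with \<open>Q14 = e j\<close>.\<close>

definition diag :: "int \<Rightarrow> complex \<Rightarrow> complex \<Rightarrow> complex" where
  "diag j x2 x3 = (a * x2 + b * x3 + l j) * (a * x3 + b * x2 + l j) - e j * (e (j+1) * x2 * x3 + l (j+1) * (x2 + x3) + k)"

lemma E14: "Q j x1 x2 x3 x4 = 0 \<Longrightarrow> E j x2 x3 x4 * E j x3 x2 x1 = diag j x2 x3"
proof -
  have "E j x2 x3 x4 * E j x3 x2 x1 - e j * Q j x1 x2 x3 x4 = diag j x2 x3"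
    by (simp add: quad_def dq_def diag_def algebra_simps)
  then show "Q j x1 x2 x3 x4 = 0 \<Longrightarrow> ?thesis" by simp
qed

text \<open>Differentiating \<open>lam_relation\<close> along \<open>x1\<close>, \<open>x2\<close> and \<open>w\<close> and eliminating the derivatives of
  the right-hand side leaves a relation that is polynomial in the independent variable \<open>x3\<close>.\<close>

lemma lam_gradient_relation:
  "\<exists>d>0. \<forall>x1 x2 w x3 s. near d n m x1 x2 w x3 s \<longrightarrow> st x1 x2 w x3 s \<in> dom_lam n m \<and>
    pd Centre (lam n m) (st x1 x2 w x3 s) * gB (n+m) x1 x3
    = pd East (lam n m) (st x1 x2 w x3 s) * diag (n+m) x2 x3 + pd West (lam n m) (st x1 x2 w x3 s) * diag (n+m) w x3"
proof -
  define j where "j = n + m"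
  define T where "T = u0 n (m+2)"
  obtain d where d: "d > 0" "\<And>c e w nn s. near d n m c e w nn s \<Longrightarrow> patch n m c e nn w (u0 (n+2) m) s T"
    using patch_nbhd unfolding T_def by metis
  have *: "st x1 x2 w x3 S \<in> dom_lam n m \<and> pd Centre (lam n m) (st x1 x2 w x3 S) * gB j x1 x3
      = pd East (lam n m) (st x1 x2 w x3 S) * diag j x2 x3 + pd West (lam n m) (st x1 x2 w x3 S) * diag j w x3"
    if h: "near d n m x1 x2 w x3 S" for x1 x2 w x3 S
  proof -
    have rel: "lam n m (st y1 y2 yw x3 S) = lam n (m+1) (st x3 (nx j y1 y2 x3) (nx j y1 yw x3) T y1)"
      if y: "near d n m y1 y2 yw x3 S" for y1 y2 yw
    proof -
      from y obtain r where "r > 0" "\<And>w'. dist w' yw < r \<Longrightarrow> near d n m y1 y2 w' x3 S"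
        by (rule near_openE) auto
      then show ?thesis unfolding j_def using d(2) by (intro lam_relation[where y="u0 (n+2) m"]) auto
    qed
    from h obtain r where r: "r > 0" "\<And>x. dist x x1 < r \<Longrightarrow> near d n m x x2 w x3 S"
      "\<And>x. dist x x2 < r \<Longrightarrow> near d n m x1 x w x3 S" "\<And>x. dist x w < r \<Longrightarrow> near d n m x1 x2 x x3 S"
      by (rule near_openE) auto
    define x4 w' where "x4 = nx j x1 x2 x3" "w' = nx j x1 w x3"
    note defs = x4_w'_def
    have g: "gd j x1 x2 x3 x4" "gd j x1 w x3 w'" and inA: "st x1 x2 w x3 S \<in> A n m" "st x3 x4 w' T x1 \<in> A n (m+1)"
      using d(2)[OF h] unfolding patch_def Let_def defs j_def by auto
    have dl: "st x1 x2 w x3 S \<in> dom_lam n m" "st x3 x4 w' T x1 \<in> dom_lam n (m+1)"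
      using inA good_edges[OF g(1)] by (auto simp: dom_lam_def j_def add.assoc)
    define pE pW where "pE = pd East (lam n (m+1)) (st x3 x4 w' T x1)" "pW = pd West (lam n (m+1)) (st x3 x4 w' T x1)"
    \<comment> \<open>The value \<open>x1\<close> is also the southern neighbour of
      \<open>(n,m+1)\<close>; this contribution to the derivative in \<open>x1\<close> drops
      out.\<close>
    have pS: "pd South (lam n (m+1)) (st x3 x4 w' T x1) = 0" using lam_south_zero[OF dl(2)] .
    define e1 e2 e4 f1 f2 f4 where "e1 = E j x2 x3 x4" "e2 = E (j+1) x1 x4 x3" "e4 = E j x3 x2 x1"
      "f1 = E j w x3 w'" "f2 = E (j+1) x1 w' x3" "f4 = E j x3 w x1"
    note edefs = e1_e2_e4_f1_f2_f4_def
    have nz: "e4 \<noteq> 0" "f4 \<noteq> 0" using g unfolding good_def edefs by blast+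
    have Q: "Q j x1 x2 x3 x4 = 0" "Q j x1 w x3 w' = 0" using g unfolding good_def by blast+
    have gB: "gB j x1 x3 = e2 * e4" "gB j x1 x3 = f2 * f4" "diag j x2 x3 = e1 * e4" "diag j w x3 = f1 * f4"
      using E24[OF Q(1)] E24[OF Q(2)] E14[OF Q(1)] E14[OF Q(2)] by (simp_all add: edefs)
    note hl = has_field_derivative_st[OF holo_on_lam dl(1)]
    have e: "((\<lambda>x. lam n (m+1) (st x3 (nx j x1 x x3) w' T x1)) has_field_derivative pE * (- e2 / e4)) (at x2)"
    proof -
      have "((\<lambda>x. st x3 (nx j x1 x x3) w' T x1 $ i) has_field_derivative (if i = East then - e2 / e4 else 0)) (at x2)" for i
        using nx_deriv2[of j x3 x2 x1] nz by (cases i) (auto simp: edefs defs)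
      from holo_on_chain[OF holo_on_lam _ this, of n "m+1"] dl(2) show ?thesis by (simp add: sum_site defs pE_pW_def)
    qed
    have w: "((\<lambda>x. lam n (m+1) (st x3 x4 (nx j x1 x x3) T x1)) has_field_derivative pW * (- f2 / f4)) (at w)"
    proof -
      have "((\<lambda>x. st x3 x4 (nx j x1 x x3) T x1 $ i) has_field_derivative (if i = West then - f2 / f4 else 0)) (at w)" for i
        using nx_deriv2[of j x3 w x1] nz by (cases i) (auto simp: edefs defs)
      from holo_on_chain[OF holo_on_lam _ this, of n "m+1"] dl(2) show ?thesis by (simp add: sum_site defs pE_pW_def)
    qed
    have c: "((\<lambda>x. lam n (m+1) (st x3 (nx j x x2 x3) (nx j x w x3) T x)) has_field_derivative
        pE * (- e1 / e4) + pW * (- f1 / f4)) (at x1)"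
    proof -
      have "((\<lambda>x. st x3 (nx j x x2 x3) (nx j x w x3) T x $ i) has_field_derivative
        (if i = East then - e1 / e4 else if i = West then - f1 / f4 else if i = South then 1 else 0)) (at x1)" for i
        using nx_deriv1[of j x3 x2 x1] nx_deriv1[of j x3 w x1] nz by (cases i) (auto simp: edefs defs)
      from holo_on_chain[OF holo_on_lam _ this, of n "m+1"] dl(2) pS show ?thesis by (simp add: sum_site defs pE_pW_def)
    qed
    have qE: "pd East (lam n m) (st x1 x2 w x3 S) = pE * (- e2 / e4)"
      using rel[OF r(3)] by (intro DERIV_eq_local[OF hl(2) e r(1)]) (simp add: defs)
    have qW: "pd West (lam n m) (st x1 x2 w x3 S) = pW * (- f2 / f4)"
      using rel[OF r(4)] by (intro DERIV_eq_local[OF hl(3) w r(1)]) (simp add: defs)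
    have qC: "pd Centre (lam n m) (st x1 x2 w x3 S) = pE * (- e1 / e4) + pW * (- f1 / f4)"
      using rel[OF r(2)] by (intro DERIV_eq_local[OF hl(1) c r(1)]) (simp add: defs)
    \<comment> \<open>The two factorisations of \<open>gB j x1 x3\<close> are chosen so that
      \<open>e4\<close> and \<open>f4\<close> cancel; regrouping then replaces \<open>pE\<close> and
      \<open>pW\<close> by the derivatives of \<open>lam n m\<close>.\<close>
    have "(pE * (- e1 / e4) + pW * (- f1 / f4)) * gB j x1 x3
        = pE * (- e1 / e4) * (e2 * e4) + pW * (- f1 / f4) * (f2 * f4)"
      using gB(1,2) by (metis distrib_right)
    also have "\<dots> = pE * (- e2 / e4) * (e1 * e4) + pW * (- f2 / f4) * (f1 * f4)"
      using nz by (simp add: field_simps)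
    finally show ?thesis using dl(1) unfolding qE qW qC gB(3,4) by blast
  qed
  then show ?thesis using d(1) unfolding j_def by blast
qed

text \<open>Coefficients of \<open>gB j x1 x3\<close> and \<open>diag j y x3\<close> as quadratics
  in \<open>x3\<close>. The mixed terms missing here carry the factor
  \<open>e j * e (j+1)\<close>.\<close>

definition "g0 j x1 = a * e j * x1\<^sup>2 + (a * l j + l (j+1) * e j - b * l j) * x1 + l j * l (j+1) - b * k"
definition "g1 j x1 = (a\<^sup>2 - b\<^sup>2) * x1 + (a * l (j+1) + e (j+1) * l j - b * l (j+1))"
definition "rr j = (a + b) * l j - e j * l (j+1)"
definition "h0 j y = a * b * y\<^sup>2 + rr j * y + ((l j)\<^sup>2 - e j * k)"
definition "h1 j y = (a\<^sup>2 + b\<^sup>2) * y + rr j"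

lemma edge_quadratic: "gB j x1 x3 = g0 j x1 + g1 j x1 * x3 + a * e (j+1) * x3\<^sup>2"
proof -
  have "gB j x1 x3 = g0 j x1 + g1 j x1 * x3 + a * e (j+1) * x3\<^sup>2 + (e j * e (j+1)) * x1 * x3"
    by (simp add: edge_def g0_def g1_def algebra_simps power2_eq_square)
  then show ?thesis by (simp add: e_mult)
qed

lemma diag_quadratic: "diag j y x3 = h0 j y + h1 j y * x3 + a * b * x3\<^sup>2"
proof -
  have "diag j y x3 = h0 j y + h1 j y * x3 + a * b * x3\<^sup>2 - (e j * e (j+1)) * y * x3"
    by (simp add: diag_def h0_def h1_def rr_def algebra_simps power2_eq_square)
  then show ?thesis by (simp add: e_mult)
qed

text \<open>The determinant of the linear system for the gradient of \<^const>\<open>lam\<close> that one obtains by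
  comparing coefficients of \<open>x3\<close>, divided by \<open>x2 - w\<close>.\<close>

definition det3 :: "int \<Rightarrow> complex \<Rightarrow> complex \<Rightarrow> complex \<Rightarrow> complex" where
  "det3 j x1 x2 w = (g1 j x1 - e (j+1) / b * h1 j x2) * (a * b * (w + x2) + rr j)
     - (a\<^sup>2 + b\<^sup>2) * (g0 j x1 - e (j+1) / b * h0 j x2)"

lemma gradient_system:
  assumes d: "d > 0" and rel: "\<And>x3. dist x3 x30 < d \<Longrightarrow> p * gB j x1 x3 = q * diag j x2 x3 + r * diag j w x3"
    and nz: "det3 j x1 x2 w \<noteq> 0" "w \<noteq> x2" "a * b * (w + x2) + rr j \<noteq> 0"
  shows "p = 0 \<and> q = 0 \<and> r = 0"
proof -
  have "(p * g0 j x1 - q * h0 j x2 - r * h0 j w) + (p * g1 j x1 - q * h1 j x2 - r * h1 j w) * x3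
      + (p * (a * e (j+1)) - q * (a * b) - r * (a * b)) * x3\<^sup>2 = 0" if "dist x3 x30 < d" for x3
    using rel[OF that] unfolding edge_quadratic diag_quadratic by (simp add: algebra_simps)
  then have z: "p * g0 j x1 - q * h0 j x2 - r * h0 j w = 0" "p * g1 j x1 - q * h1 j x2 - r * h1 j w = 0"
    "p * (a * e (j+1)) - q * (a * b) - r * (a * b) = 0"
    using quadratic_zero[OF d] by blast+
  define \<kappa> where "\<kappa> = e (j+1) / b"
  have "a * (p * e (j+1) - (q + r) * b) = 0" using z(3) by (simp add: algebra_simps)
  then have "p * e (j+1) = (q + r) * b" using a_nz by simp
  \<comment> \<open>The coefficient of the square eliminates \<open>q\<close>; the right-hand sides
    of the other two equations then have the factor \<open>w - x2\<close>.\<close>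
  then have q: "q = p * \<kappa> - r" using b_nz by (simp add: \<kappa>_def field_simps)
  have 1: "p * (g1 j x1 - \<kappa> * h1 j x2) = r * ((a\<^sup>2 + b\<^sup>2) * (w - x2))"
    using z(2) unfolding q h1_def by (simp add: algebra_simps)
  have 2: "p * (g0 j x1 - \<kappa> * h0 j x2) = r * ((w - x2) * (a * b * (w + x2) + rr j))"
    using z(1) unfolding q h0_def by (simp add: algebra_simps power2_eq_square)
  \<comment> \<open>The combination of the two remaining equations in which \<open>r\<close>
    cancels.\<close>
  have "p * det3 j x1 x2 w = (p * (g1 j x1 - \<kappa> * h1 j x2)) * (a * b * (w + x2) + rr j)
      - (a\<^sup>2 + b\<^sup>2) * (p * (g0 j x1 - \<kappa> * h0 j x2))"
    unfolding det3_def \<kappa>_def by (simp add: algebra_simps)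
  also have "\<dots> = 0" unfolding 1 2 by (simp add: algebra_simps)
  finally have p: "p = 0" using nz(1) by simp
  then have r: "r = 0" using 2 nz(2,3) by simp
  show ?thesis using p q r by simp
qed

text \<open>\<open>det3\<close> is affine in \<open>w\<close>. If both coefficients vanished for all
  \<open>x1\<close>, \<open>x2\<close> in the balls, then
  \<kappa>\<open>* (a\<^sup>2 + b\<^sup>2) = 0\<close> and \<open>a\<^sup>2 = b\<^sup>2\<close>, so
  \<open>e (j+1) = 0\<close>, and next \<open>g1\<close> and \<open>g0\<close> would vanish. Then
  \<open>gB\<close> would be identically zero, against \<open>edge_nz\<close>.\<close>

lemma det3_nonzero:
  assumes d: "d > 0"
  shows "\<exists>x1 x2 w. dist x1 c < d \<and> dist x2 f < d \<and> dist w g < d \<and>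
    det3 j x1 x2 w \<noteq> 0 \<and> w \<noteq> x2 \<and> a * b * (w + x2) + rr j \<noteq> 0"
proof -
  define \<kappa> where "\<kappa> = e (j+1) / b"
  define M where "M = (\<lambda>x1 x2. g1 j x1 - \<kappa> * h1 j x2)"
  define N where "N = (\<lambda>x1 x2. M x1 x2 * (a * b * x2 + rr j) - (a\<^sup>2 + b\<^sup>2) * (g0 j x1 - \<kappa> * h0 j x2))"
  have det: "det3 j x1 x2 w = N x1 x2 + (a * b * M x1 x2) * w + 0 * w\<^sup>2" for x1 x2 w
    by (simp add: det3_def N_def M_def \<kappa>_def algebra_simps)
  have "\<exists>x1 x2. dist x1 c < d \<and> dist x2 f < d \<and> (M x1 x2 \<noteq> 0 \<or> N x1 x2 \<noteq> 0)"
  proof (rule ccontr)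
    assume "\<not> ?thesis"
    then have MN: "M x1 x2 = 0" "N x1 x2 = 0" if "dist x1 c < d" "dist x2 f < d" for x1 x2 using that by blast+
    have "(g1 j x1 - \<kappa> * rr j) + (- \<kappa> * (a\<^sup>2 + b\<^sup>2)) * x2 + 0 * x2\<^sup>2 = 0" if "dist x1 c < d" "dist x2 f < d" for x1 x2
      using MN(1)[OF that] by (simp add: M_def h1_def algebra_simps)
    from quadratic_zero[OF d this] have 1: "g1 j x1 = \<kappa> * rr j" "- \<kappa> * (a\<^sup>2 + b\<^sup>2) = 0" if "dist x1 c < d" for x1
      using that by fastforce+
    have "(a * l (j+1) + e (j+1) * l j - b * l (j+1) - \<kappa> * rr j) + (a\<^sup>2 - b\<^sup>2) * x1 + 0 * x1\<^sup>2 = 0" if "dist x1 c < d" for x1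
      using 1(1)[OF that] by (simp add: g1_def algebra_simps)
    then have 2: "a\<^sup>2 - b\<^sup>2 = 0" using quadratic_zero[OF d] by blast
    then have qq: "a\<^sup>2 + b\<^sup>2 = 2 * a\<^sup>2" by simp
    have "\<kappa> * (2 * a\<^sup>2) = 0" using 1(2)[of c] d unfolding qq by simp
    then have \<kappa>: "\<kappa> = 0" using a_nz by simp
    then have e0: "e (j+1) = 0" using b_nz by (simp add: \<kappa>_def)
    have g1: "g1 j y = 0" for y using 1(1)[of c] d 2 \<kappa> by (simp add: g1_def)
    have "(l j * l (j+1) - b * k) + (a * l j + l (j+1) * e j - b * l j) * x1 + (a * e j) * x1\<^sup>2 = 0" if "dist x1 c < d" for x1
    proof -
      have "(a\<^sup>2 + b\<^sup>2) * g0 j x1 = 0" using MN[OF that, of f] d by (simp add: N_def \<kappa>)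
      then have "g0 j x1 = 0" unfolding qq using a_nz by simp
      then show ?thesis by (simp add: g0_def algebra_simps)
    qed
    then have "l j * l (j+1) - b * k = 0" "a * l j + l (j+1) * e j - b * l j = 0" "a * e j = 0"
      using quadratic_zero[OF d] by blast+
    then have "g0 j y = 0" for y by (simp add: g0_def)
    then have "gB j y1 y3 = 0" for y1 y3 unfolding edge_quadratic g1 e0 by simp
    then show False using edge_nz(2) by blast
  qed
  then obtain x1 x2 where x: "dist x1 c < d" "dist x2 f < d" "M x1 x2 \<noteq> 0 \<or> N x1 x2 \<noteq> 0" by blast
  define Z where "Z = {w. N x1 x2 + (a * b * M x1 x2) * w + 0 * w\<^sup>2 = 0} \<union> {x2} \<union> {w. (a * b * x2 + rr j) + (a * b) * w + 0 * w\<^sup>2 = 0}"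
  have "finite Z"
    unfolding Z_def using x(3) a_nz b_nz by (intro finite_UnI finite_quadratic_roots) auto
  moreover have "infinite (ball g d)" using d uncountable_ball[of d g] countable_finite by auto
  ultimately have "\<not> ball g d \<subseteq> Z" using finite_subset by metis
  then obtain w where "w \<in> ball g d" "w \<notin> Z" by blast
  then show ?thesis using x unfolding det Z_def
    by (intro exI[of _ x1] exI[of _ x2] exI[of _ w]) (auto simp: dist_commute algebra_simps)
qed

text \<open>\<open>lam\<close> is independent of the northern value near \<open>u0\<close>, so in
  \<open>lam_gradient_relation\<close> the gradient stays fixed while \<open>x3\<close> varies.
  Hence \<open>lam\<close> is constant on a ball where the system is nonsingular.\<close>

theorem west_derivative_site:
  "\<exists>c. \<forall>v \<in> A n m. pd West (R n m) v * (v $ East - v $ West)\<^sup>2 = c * gA (n+m) (v $ Centre) (v $ East)"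
proof -
  define j where "j = n + m"
  define N0 S0 where "N0 = u0 n (m+1)" "S0 = u0 n (m-1)"
  obtain d1 where d1: "d1 > 0" "\<And>x1 x2 w x3 s. near d1 n m x1 x2 w x3 s \<Longrightarrow> st x1 x2 w x3 s \<in> dom_lam n m \<and>
    pd Centre (lam n m) (st x1 x2 w x3 s) * gB j x1 x3
    = pd East (lam n m) (st x1 x2 w x3 s) * diag j x2 x3 + pd West (lam n m) (st x1 x2 w x3 s) * diag j w x3"
    using lam_gradient_relation[of n m] unfolding j_def by metis
  obtain d2 where d2: "d2 > 0" "\<And>c e w nn s s'. near d2 n m c e w nn s \<Longrightarrow> near d2 n m c e w nn s' \<Longrightarrow>
    pd West (R n m) (st c e w nn s) = pd West (R n m) (st c e w nn s')"
    using south_independent[of n m] by metis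
  obtain d3 where d3: "d3 > 0" "\<And>c e w nn nn' s. near d3 n m c e w nn s \<Longrightarrow> near d3 n m c e w nn' s \<Longrightarrow>
    pd West (R n m) (st c e w nn s) = pd West (R n m) (st c e w nn' s)"
    using north_independent[of n m] by metis
  define d where "d = min d1 (min d2 d3)"
  have d: "d > 0" using d1 d2 d3 by (auto simp: d_def)
  have mono: "near d1 n m c e w nn s" "near d2 n m c e w nn s" "near d3 n m c e w nn s" "near d n m c e w N0 S0" "near d n m c e w nn S0"
    if "near d n m c e w nn s" for c e w nn s using that d by (auto simp: near_def d_def N0_S0_def)
  have indep: "lam n m (st c e w nn s) = lam n m (st c e w N0 S0)" if h: "near d n m c e w nn s" for c e w nn s
    using d2(2)[OF mono(2)[OF h] mono(2)[OF mono(5)[OF h]]] d3(2)[OF mono(3)[OF mono(5)[OF h]] mono(3)[OF mono(4)[OF h]]]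
    by (simp add: lam_def)
  have zero: "pd i (lam n m) (st x1 x2 w nn s) = 0"
    if h: "near d n m x1 x2 w nn s" and nz: "det3 j x1 x2 w \<noteq> 0" "w \<noteq> x2" "a * b * (w + x2) + rr j \<noteq> 0" for i x1 x2 w nn s
  proof -
    have indep_pd: "pd i (lam n m) (st x1 x2 w nn s) =
        (if i \<in> {Centre, East, West} then pd i (lam n m) (st x1 x2 w N0 S0) else 0)" if h: "near d n m x1 x2 w nn s" for i nn s
    proof -
      from h obtain r where r: "r > 0" "\<And>c' e' w' nn' s'. dist c' x1 < r \<Longrightarrow> dist e' x2 < r \<Longrightarrow> dist w' w < r \<Longrightarrow>
        dist nn' nn < r \<Longrightarrow> dist s' s < r \<Longrightarrow> near d n m c' e' w' nn' s'"
        by (rule near_openE) blast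
      have "pd i (lam n m) (st x1 x2 w nn s) = pd i (lam n m) (st x1 x2 w N0 S0)" if i: "i \<in> {Centre, East, West}"
      proof (rule pd_eq_local[OF r(1)])
        fix t :: complex assume "norm t < r"
        then show "lam n m (st x1 x2 w nn s + axis i t) = lam n m (st x1 x2 w N0 S0 + axis i t)"
          using i r indep by (auto simp: st_plus_axis dist_norm)
      qed
      moreover have "pd i (lam n m) (st x1 x2 w nn s) = pd i (\<lambda>_. lam n m (st x1 x2 w N0 S0)) 0" if i: "i \<in> {North, South}"
      proof (rule pd_eq_local[OF r(1)])
        fix t :: complex assume "norm t < r"
        then show "lam n m (st x1 x2 w nn s + axis i t) = lam n m (st x1 x2 w N0 S0)"
          using i r indep by (auto simp: st_plus_axis dist_norm)
      qed
      ultimately show ?thesis by (cases i) (simp_all add: pd_def)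
    qed
    define p q r where "p = pd Centre (lam n m) (st x1 x2 w N0 S0)" "q = pd East (lam n m) (st x1 x2 w N0 S0)"
      "r = pd West (lam n m) (st x1 x2 w N0 S0)"
    have "p * gB j x1 x3 = q * diag j x2 x3 + r * diag j w x3" if "dist x3 N0 < d" for x3
    proof -
      have nr: "near d n m x1 x2 w x3 S0" using h d that by (simp add: near_def N0_S0_def)
      show ?thesis
        using d1(2)[OF mono(1)[OF nr]] indep_pd[OF nr] by (simp add: p_q_r_def)
    qed
    from gradient_system[OF d(1) this nz] show ?thesis
      unfolding indep_pd[OF h] by (cases i) (simp_all add: p_q_r_def)
  qed
  obtain y1 y2 yw where y: "dist y1 (u0 n m) < d" "dist y2 (u0 (n+1) m) < d" "dist yw (u0 (n-1) m) < d"
    "det3 j y1 y2 yw \<noteq> 0" "yw \<noteq> y2" "a * b * (yw + y2) + rr j \<noteq> 0"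
    using det3_nonzero[OF d(1), of "u0 n m" "u0 (n+1) m" "u0 (n-1) m" j] by blast
  define P where "P = st y1 y2 yw N0 S0"
  define W where "W = {v \<in> dom_lam n m. near d n m (v $ Centre) (v $ East) (v $ West) (v $ North) (v $ South) \<and>
    det3 j (v $ Centre) (v $ East) (v $ West) \<noteq> 0 \<and> v $ West \<noteq> v $ East \<and> a * b * (v $ West + v $ East) + rr j \<noteq> 0}"
  have "open {v::complex ^ site. dist (v $ i) c < d}" for i c
    by (intro open_Collect_less continuous_intros)
  moreover have "open {v::complex ^ site. det3 j (v $ Centre) (v $ East) (v $ West) \<noteq> 0}"
    unfolding det3_def g0_def g1_def h0_def h1_def by (intro open_Collect_neq continuous_intros)
  moreover have "open {v::complex ^ site. v $ West \<noteq> v $ East}" "open {v::complex ^ site. a * b * (v $ West + v $ East) + rr j \<noteq> 0}"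
    by (intro open_Collect_neq continuous_intros)+
  ultimately have W: "open W"
    unfolding W_def near_def Collect_conj_eq using open_dom_lam by (intro open_Int) auto
  have "near d n m y1 y2 yw N0 S0" using y d by (simp add: near_def N0_S0_def)
  then have "P \<in> W" using y d1(2) mono(1) unfolding W_def P_def by simp
  then obtain r where r: "r > 0" "ball P r \<subseteq> W" using W open_contains_ball by blast
  define c where "c = lam n m P"
  have const: "lam n m v = c" if "v \<in> ball P r" for v
    unfolding c_def
  proof (rule holo_on_constant[OF _ convex_ball _ that])
    show "holo_on (lam n m) (ball P r)" using holo_on_lam r(2) by (rule holo_on_subset[OF _ order_trans]) (auto simp: W_def)
    show "pd s (lam n m) v = 0" if "v \<in> ball P r" for v s
    proof -
      have "v \<in> W" using that r by blast
      then show ?thesis unfolding W_def using zero[of "v $ Centre" "v $ East" "v $ West" "v $ North" "v $ South" s]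
        by (simp flip: st_surj)
    qed
  qed (use r in simp)
  \<comment> \<open>Multiplied by the discriminant, the identity is holomorphic on all of
    \<open>A n m\<close>, which is connected, and no longer confined to
    \<open>dom_lam\<close>.\<close>
  have "pd West (R n m) v * (v $ East - v $ West)\<^sup>2 - c * gA (n+m) (v $ Centre) (v $ East) = 0" if v: "v \<in> A n m" for v
  proof (rule holo_identity_open[OF _ A_open A_conn _ r(1) _ v])
    show "holo_on (\<lambda>v. pd West (R n m) v * (v $ East - v $ West)\<^sup>2 - c * gA (n+m) (v $ Centre) (v $ East)) (A n m)"
      by (intro holo_on_intros holo_on_pd R_holo A_open)
    show "P \<in> A n m" using \<open>P \<in> W\<close> by (simp add: W_def dom_lam_def)
    fix v assume "dist P v < r"
    then have "v \<in> dom_lam n m" "lam n m v = c" using const r(2) by (auto simp: W_def)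
    then show "pd West (R n m) v * (v $ East - v $ West)\<^sup>2 - c * gA (n+m) (v $ Centre) (v $ East) = 0"
      by (auto simp: lam_def dom_lam_def field_simps)
  qed
  then show ?thesis by (intro exI[of _ c]) auto
qed

text \<open>Evaluating \<open>lam_relation\<close> at \<open>u0\<close> itself compares the
  constants at \<open>(n,m)\<close> and \<open>(n,m+1)\<close>.\<close>

theorem west_derivative:
  "\<exists>c::int \<Rightarrow> complex. \<forall>n m. \<forall>v \<in> A n m. pd West (R n m) v * (v $ East - v $ West)\<^sup>2 = c n * gA (n+m) (v $ Centre) (v $ East)"
proof -
  obtain c where c: "\<And>n m v. v \<in> A n m \<Longrightarrow> pd West (R n m) v * (v $ East - v $ West)\<^sup>2 = c n m * gA (n+m) (v $ Centre) (v $ East)"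
    using west_derivative_site by metis
  have gA0: "gA (n+m) (stencil u0 n m $ Centre) (stencil u0 n m $ East) \<noteq> 0" for n m
    using good_edges(1)[OF gensol_good(1)[OF u0_sol refl]] by (simp add: stencil_eq_st)
  have lam: "lam n m (stencil u0 n m) = c n m" for n m
    using c[OF u0_in] gA0 by (simp add: lam_def)
  have step: "c n m = c n (m+1)" for n m
  proof -
    obtain d where d: "d > 0" "\<And>c e w nn s. near d n m c e w nn s \<Longrightarrow> patch n m c e nn w (u0 (n+2) m) s (u0 n (m+2))"
      using patch_nbhd by metis
    have "lam n m (st (u0 n m) (u0 (n+1) m) (u0 (n-1) m) (u0 n (m+1)) (u0 n (m-1)))
      = lam n (m+1) (st (u0 n (m+1)) (nx (n+m) (u0 n m) (u0 (n+1) m) (u0 n (m+1)))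
         (nx (n+m) (u0 n m) (u0 (n-1) m) (u0 n (m+1))) (u0 n (m+2)) (u0 n m))"
      by (rule lam_relation[OF d(1) d(2)]) (use d(1) in \<open>simp add: near_def\<close>)
    also have "nx (n+m) (u0 n m) (u0 (n+1) m) (u0 n (m+1)) = u0 (n+1) (m+1)"
      using good_nx[OF gensol_good(1)[OF u0_sol refl]] by simp
    also have "nx (n+m) (u0 n m) (u0 (n-1) m) (u0 n (m+1)) = u0 (n-1) (m+1)"
      using good_nx[OF gensol_good(2)[OF u0_sol refl]] by simp
    also have "st (u0 n (m+1)) (u0 (n+1) (m+1)) (u0 (n-1) (m+1)) (u0 n (m+2)) (u0 n m) = stencil u0 n (m+1)"
      by (simp add: stencil_eq_st add.commute[of 2])
    finally show ?thesis using lam by (simp flip: stencil_eq_st)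
  qed
  have "c n m = c n 0" for n m
  proof (induction m rule: int_induct[of _ 0])
    case (step1 i) then show ?case using step[of n i] by simp
  next
    case (step2 i) then show ?case using step[of n "i - 1"] by simp
  qed simp
  then show ?thesis using c by (intro exI[of _ "\<lambda>n. c n 0"]) metis
qed

end

subsection \<open>Classification of the characteristics\<close>

definition edge2 :: "complex \<Rightarrow> complex \<Rightarrow> (int \<Rightarrow> complex) \<Rightarrow> (int \<Rightarrow> complex) \<Rightarrow> int
    \<Rightarrow> complex \<Rightarrow> complex \<Rightarrow> complex" where
  "edge2 a b e l j x y = e (j+1) * (b * y + e j * x + l j) + b * (b * x + e (j+1) * y + l (j+1))
     - a * (a * x + l (j+1))"

text \<open>The characteristic of the known symmetry with the discriminant in place of
  \<open>f\<close>; \<open>edge2\<close> is the derivative of \<open>edge\<close> in its second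
  argument.\<close>

definition rchar :: "complex \<Rightarrow> complex \<Rightarrow> complex \<Rightarrow> (int \<Rightarrow> complex) \<Rightarrow> (int \<Rightarrow> complex) \<Rightarrow> int
    \<Rightarrow> complex \<Rightarrow> complex \<Rightarrow> complex \<Rightarrow> complex" where
  "rchar a b k e l j x y z = edge a b k e l j x y / (y - z) - edge2 a b e l j x y / 2"

lemma has_field_derivative_edge:
  "((\<lambda>y. edge a b k e l j x y) has_field_derivative edge2 a b e l j x y) (at y)"
  unfolding edge_def edge2_def by (auto intro!: derivative_eq_intros simp: algebra_simps)

text \<open>An exact Taylor expansion, as \<open>edge\<close> is quadratic in its second
  argument.\<close>

lemma edge_taylor:
  "edge a b k e l j x z = edge a b k e l j x y + edge2 a b e l j x y * (z - y) + b * e (j+1) * (z - y)\<^sup>2"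
  by (simp add: edge_def edge2_def algebra_simps power2_eq_square)

text \<open>By the Taylor expansion all terms of the quotient rule combine into the discriminant at
  the other neighbour \<open>z\<close>.\<close>

lemma rchar_deriv_first:
  assumes "y \<noteq> z"
  shows "((\<lambda>y. rchar a b k e l j x y z) has_field_derivative - edge a b k e l j x z / (y - z)\<^sup>2) (at y)"
proof -
  have "((\<lambda>y. edge2 a b e l j x y) has_field_derivative 2 * b * e (j+1)) (at y)"
    unfolding edge2_def by (auto intro!: derivative_eq_intros simp: algebra_simps)
  then have "((\<lambda>y. rchar a b k e l j x y z) has_field_derivative
     (edge2 a b e l j x y * (y - z) - edge a b k e l j x y * (1 - 0)) / ((y - z) * (y - z)) - 2 * b * e (j+1) / 2) (at y)"
    unfolding rchar_def using assms
    by (intro DERIV_diff DERIV_divide DERIV_cdivide has_field_derivative_edge DERIV_ident DERIV_const) auto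
  moreover have "(edge2 a b e l j x y * (y - z) - edge a b k e l j x y * (1 - 0)) / ((y - z) * (y - z)) - 2 * b * e (j+1) / 2
     = - edge a b k e l j x z / (y - z)\<^sup>2"
  proof -
    define d where "d = y - z"
    have d: "y - z = d" "z - y = - d" "d \<noteq> 0" using assms by (auto simp: d_def)
    show ?thesis
      unfolding edge_taylor[of a b k e l j x z y] d(1,2) using d(3) by (simp add: field_simps power2_eq_square)
  qed
  ultimately show ?thesis by simp
qed

lemma rchar_deriv_second:
  assumes "y \<noteq> z"
  shows "((\<lambda>z. rchar a b k e l j x y z) has_field_derivative edge a b k e l j x y / (y - z)\<^sup>2) (at z)"
proof -
  have "((\<lambda>z. rchar a b k e l j x y z) has_field_derivative
     (0 * (y - z) - edge a b k e l j x y * (0 - 1)) / ((y - z) * (y - z)) - 0) (at z)"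
    unfolding rchar_def using assms by (intro DERIV_diff DERIV_divide DERIV_ident DERIV_const) auto
  then show ?thesis by (simp add: power2_eq_square)
qed

lemma rchar_mult:
  "y \<noteq> z \<Longrightarrow> rchar a b k e l j x y z * (y - z) = edge a b k e l j x y - (y - z) * (edge2 a b e l j x y / 2)"
proof -
  have "d \<noteq> 0 \<Longrightarrow> (X / d - Y) * d = X - d * Y" for d X Y :: complex
    by (simp add: field_simps)
  then show "y \<noteq> z \<Longrightarrow> ?thesis" unfolding rchar_def by simp
qed

lemma holo_on_edge2:
  "holo_on F A \<Longrightarrow> holo_on G A \<Longrightarrow> holo_on (\<lambda>v. edge2 a b e l j (F v) (G v)) A"
  unfolding edge2_def by (intro holo_on_add holo_on_diff holo_on_mult holo_on_const)

lemma holo_on_rchar: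
  assumes "holo_on F A" "holo_on G A" "holo_on H A" "\<And>v. v \<in> A \<Longrightarrow> G v \<noteq> H v"
  shows "holo_on (\<lambda>v. rchar a b k e l j (F v) (G v) (H v)) A"
  unfolding rchar_def using assms by (intro holo_on_intros holo_on_edge2) auto

lemma dist_st_shift:
  "dist (st c e w n s) (st c e' w' n s) \<le> dist e e' + dist w w'"
proof -
  have "st c e w n s - st c e' w' n s = axis East (e - e') + axis West (w - w')"
    by (simp add: vec_eq_iff all_site axis_component)
  then show ?thesis
    using norm_triangle_ineq[of "axis East (e - e')" "axis West (w - w') :: complex ^ site"] by (simp add: dist_norm)
qed

lemma quadratic_edge:
  "edge a b k e l j x y = ((b * x + l (j+1)) * (e j * x + l j) - a * (l j * x + k))
     + (e (j+1) * (e j * x + l j) + b * (b * x + l (j+1)) - a * (a * x + l (j+1))) * y + b * e (j+1) * y\<^sup>2"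
  by (simp add: edge_def algebra_simps power2_eq_square)

section \<open>From the four outer derivatives to the form of the characteristic\<close>

context bw_symmetry
begin

theorem east_derivative:
  "\<exists>c::int \<Rightarrow> complex. \<forall>n m. \<forall>v \<in> A n m. pd East (R n m) v * (v $ East - v $ West)\<^sup>2 = c n * gA (n+m) (v $ Centre) (v $ West)"
proof -
  interpret H: bw_symmetry a b k e l "hA A" "hR R" "hK K" "hu u0" by (rule symmetry_hflip)
  obtain c where c: "\<And>n m v. v \<in> hA A n m \<Longrightarrow> pd West (hR R n m) v * (v $ East - v $ West)\<^sup>2 = c n * gA (n+m) (v $ Centre) (v $ East)"
    using H.west_derivative by metis
  have "pd East (R n m) v * (v $ East - v $ West)\<^sup>2 = c (-n) * gA (n+m) (v $ Centre) (v $ West)" if v: "v \<in> A n m" for n m v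
  proof -
    have pp: "perm hfl (perm hfl v) = v" by (simp add: vec_eq_iff hfl_invol)
    then have "perm hfl v \<in> hA A (-n) m" using v by (simp add: hA_def)
    from c[OF this] have "pd West (hR R (-n) m) (perm hfl v) * (v $ West - v $ East)\<^sup>2 = c (-n) * gA (-n+m) (v $ Centre) (v $ West)"
      by simp
    moreover have "pd West (hR R (-n) m) (perm hfl v) = pd East (R n m) v"
      using pd_perm[OF hfl_invol, of West "R n m" "perm hfl v"] by (simp add: hR_def[abs_def] pp)
    moreover have "gA (-n+m) = gA (n+m)" by (rule even_shift_all) simp
    ultimately show ?thesis by (simp add: power2_commute)
  qed
  then show ?thesis by (intro exI[of _ "\<lambda>n. c (-n)"]) blast
qed

text \<open>After subtraction of \<open>c * rchar\<close> the remainder does not depend on the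
  western value, while its eastern derivative is
  \<open>(c + c') * (gA j C w / (x - w)\<^sup>2)\<close>. If \<open>c + c'\<close> were nonzero,
  this quotient would not depend on \<open>w\<close>; comparing powers of \<open>x\<close> then
  makes \<open>gA j C\<close> vanish near \<open>w0\<close>, hence everywhere, contradicting the
  genericity of \<open>u0\<close>.\<close>

lemma derivative_coefficients_cancel:
  assumes W: "\<And>v. v \<in> A n m \<Longrightarrow> pd West (R n m) v * (v $ East - v $ West)\<^sup>2 = c * gA (n+m) (v $ Centre) (v $ East)"
    and E: "\<And>v. v \<in> A n m \<Longrightarrow> pd East (R n m) v * (v $ East - v $ West)\<^sup>2 = c' * gA (n+m) (v $ Centre) (v $ West)"
  shows "c' = - c"
proof (rule ccontr)
  assume ne: "c' \<noteq> - c"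
  define C N S j where "C = u0 n m" "N = u0 n (m+1)" "S = u0 n (m-1)" "j = n + m"
  note defs = C_N_S_j_def
  let ?e = "u0 (n+1) m" and ?w = "u0 (n-1) m"
  obtain d where d: "d > 0" "ball (st C ?e ?w N S) d \<subseteq> A n m"
    using A_open u0_in[of n m] open_contains_ball unfolding stencil_eq_st defs by blast
  define w0 where "w0 = (if ?e = ?w then ?w + of_real (d/4) else ?w)"
  define r where "r = min (d/8) (dist ?e w0 / 2)"
  have w0: "w0 \<noteq> ?e" "dist w0 ?w \<le> d/4" using d(1) by (auto simp: w0_def dist_norm)
  have r: "r > 0" using w0 d(1) by (simp add: r_def)
  have inA: "st C x w N S \<in> A n m" and xw: "x \<noteq> w" if "dist x ?e < r" "dist w w0 < r" for x w
  proof -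
    have "dist (st C ?e ?w N S) (st C x w N S) < d"
      using dist_st_shift[of C ?e ?w N S x w] that w0(2) dist_triangle[of ?w w w0] d(1)
      by (simp add: r_def dist_commute)
    then show "st C x w N S \<in> A n m" using d(2) by auto
    show "x \<noteq> w"
    proof
      assume "x = w"
      then have "dist ?e w0 < r + r" using that dist_triangle[of ?e w0 w] by (simp add: dist_commute)
      then show False by (simp add: r_def)
    qed
  qed
  have PW: "pd West (R n m) (st C x w N S) = c * (gA j C x / (x - w)\<^sup>2)"
    and PE: "pd East (R n m) (st C x w N S) = c' * (gA j C w / (x - w)\<^sup>2)" if "dist x ?e < r" "dist w w0 < r" for x w
    using W[OF inA[OF that]] E[OF inA[OF that]] xw[OF that] by (simp_all add: field_simps defs)
  define f where "f = (\<lambda>x w. R n m (st C x w N S) - c * rchar a b k e l j C x w)"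
  have fw: "f x w = f x w'" if "dist x ?e < r" "dist w w0 < r" "dist w' w0 < r" for x w w'
  proof -
    have "\<exists>k. \<forall>w\<in>ball w0 r. f x w = k"
    proof (rule has_field_derivative_zero_constant[OF convex_ball])
      fix z assume "z \<in> ball w0 r"
      then have z: "dist z w0 < r" by (simp add: dist_commute)
      have "(f x has_field_derivative c * (gA j C x / (x - z)\<^sup>2) - c * (gA j C x / (x - z)\<^sup>2)) (at z)"
        unfolding f_def
        using has_field_derivative_st(3)[OF R_holo inA[OF that(1) z]] rchar_deriv_second[OF xw[OF that(1) z]]
        unfolding PW[OF that(1) z] by (intro DERIV_diff DERIV_cmult)
      then show "(f x has_field_derivative 0) (at z within ball w0 r)" by (simp add: has_field_derivative_at_within)
    qed
    then show ?thesis using that by (auto simp: dist_commute)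
  qed
  have fx: "((\<lambda>x. f x w) has_field_derivative (c + c') * (gA j C w / (x - w)\<^sup>2)) (at x)"
    if "dist x ?e < r" "dist w w0 < r" for x w
  proof -
    have "((\<lambda>x. f x w) has_field_derivative c' * (gA j C w / (x - w)\<^sup>2) - c * (- gA j C w / (x - w)\<^sup>2)) (at x)"
      unfolding f_def
      using has_field_derivative_st(2)[OF R_holo inA[OF that]] rchar_deriv_first[OF xw[OF that]]
      unfolding PE[OF that] by (intro DERIV_diff DERIV_cmult)
    then show ?thesis by (simp add: algebra_simps add_divide_distrib)
  qed
  have eq: "gA j C w * (x - w')\<^sup>2 = gA j C w' * (x - w)\<^sup>2"
    if h: "dist x ?e < r" "dist w w0 < r" "dist w' w0 < r" for x w w'
  proof -
    have "(c + c') * (gA j C w / (x - w)\<^sup>2) = (c + c') * (gA j C w' / (x - w')\<^sup>2)"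
    proof (rule DERIV_eq_local[OF fx[OF h(1,2)] fx[OF h(1,3)], of "r - dist x ?e"])
      show "f y w = f y w'" if "dist y x < r - dist x ?e" for y
        using fw[OF _ h(2,3), of y] that dist_triangle[of y ?e x] by simp
    qed (use h in simp)
    moreover have "c + c' \<noteq> 0" using ne by (metis add.commute eq_neg_iff_add_eq_0)
    ultimately have "gA j C w / (x - w)\<^sup>2 = gA j C w' / (x - w')\<^sup>2" by (metis mult_left_cancel)
    then show ?thesis using xw[OF h(1,2)] xw[OF h(1,3)] by (simp add: field_simps)
  qed
  have zero: "gA j C w = 0" if w: "dist w w0 < r" for w
  proof -
    obtain w' where w': "dist w' w0 < r" "w' \<noteq> w"
    proof (cases "w = w0")
      case True
      then show thesis using r that[of "w0 + of_real (r/2)"] by (simp add: dist_norm)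
    next
      case False then show thesis using r that[of w0] by simp
    qed
    have "(gA j C w * w'\<^sup>2 - gA j C w' * w\<^sup>2) + (- 2 * (gA j C w * w' - gA j C w' * w)) * x + (gA j C w - gA j C w') * x\<^sup>2 = 0"
      if "dist x ?e < r" for x
      using eq[OF that w w'(1)] by (simp add: power2_diff algebra_simps)
    then have 1: "- 2 * (gA j C w * w' - gA j C w' * w) = 0" "gA j C w - gA j C w' = 0"
      using quadratic_zero(2,3)[OF r] by blast+
    then have "gA j C w * w' = gA j C w' * w" "gA j C w' = gA j C w" by auto
    then have "gA j C w * (w' - w) = 0" by (simp only: right_diff_distrib) simp
    then show ?thesis using w'(2) by simp
  qed
  have q: "((b * C + l (j+1)) * (e j * C + l j) - a * (l j * C + k))
     + (e (j+1) * (e j * C + l j) + b * (b * C + l (j+1)) - a * (a * C + l (j+1))) * y + b * e (j+1) * y\<^sup>2 = 0" if "dist y w0 < r" for y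
    using zero[OF that] unfolding quadratic_edge .
  have "(b * C + l (j+1)) * (e j * C + l j) - a * (l j * C + k) = 0"
    "e (j+1) * (e j * C + l j) + b * (b * C + l (j+1)) - a * (a * C + l (j+1)) = 0" "b * e (j+1) = 0"
    using quadratic_zero[OF r q] by blast+
  then have "gA j C ?e = 0" unfolding quadratic_edge by simp
  then show False
    using good_edges(1)[OF gensol_good(1)[OF u0_sol refl]] by (simp add: defs)
qed

theorem horizontal_derivatives:
  "\<exists>c::int \<Rightarrow> complex. \<forall>n m. \<forall>v \<in> A n m. v $ East \<noteq> v $ West \<longrightarrow>
     pd West (R n m) v = c n * (gA (n+m) (v $ Centre) (v $ East) / (v $ East - v $ West)\<^sup>2) \<and>
     pd East (R n m) v = c n * (- gA (n+m) (v $ Centre) (v $ West) / (v $ East - v $ West)\<^sup>2)"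
proof -
  obtain c where c: "\<And>n m v. v \<in> A n m \<Longrightarrow> pd West (R n m) v * (v $ East - v $ West)\<^sup>2 = c n * gA (n+m) (v $ Centre) (v $ East)"
    using west_derivative by metis
  obtain c' where c': "\<And>n m v. v \<in> A n m \<Longrightarrow> pd East (R n m) v * (v $ East - v $ West)\<^sup>2 = c' n * gA (n+m) (v $ Centre) (v $ West)"
    using east_derivative by metis
  have "c' n = - c n" for n
    using derivative_coefficients_cancel[OF c c'] .
  then show ?thesis
    using c c' by (intro exI[of _ c]) (auto simp: field_simps)
qed

theorem vertical_derivatives:
  "\<exists>c::int \<Rightarrow> complex. \<forall>n m. \<forall>v \<in> A n m. v $ North \<noteq> v $ South \<longrightarrow>
     pd South (R n m) v = c m * (gB (n+m) (v $ Centre) (v $ North) / (v $ North - v $ South)\<^sup>2) \<and>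
     pd North (R n m) v = c m * (- gB (n+m) (v $ Centre) (v $ South) / (v $ North - v $ South)\<^sup>2)"
proof -
  interpret T: bw_symmetry b a k e l "tA A" "tR R" "tK K" "tu u0" by (rule symmetry_transpose)
  obtain c where c: "\<And>n m v. v \<in> tA A n m \<Longrightarrow> v $ East \<noteq> v $ West \<Longrightarrow>
     pd West (tR R n m) v = c n * (gB (n+m) (v $ Centre) (v $ East) / (v $ East - v $ West)\<^sup>2) \<and>
     pd East (tR R n m) v = c n * (- gB (n+m) (v $ Centre) (v $ West) / (v $ East - v $ West)\<^sup>2)"
    using T.horizontal_derivatives by metis
  have "pd South (R n m) v = c m * (gB (n+m) (v $ Centre) (v $ North) / (v $ North - v $ South)\<^sup>2) \<and>
     pd North (R n m) v = c m * (- gB (n+m) (v $ Centre) (v $ South) / (v $ North - v $ South)\<^sup>2)"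
    if v: "v \<in> A n m" "v $ North \<noteq> v $ South" for n m v
  proof -
    have pp: "perm tps (perm tps v) = v" by (simp add: vec_eq_iff tps_invol)
    have "perm tps v \<in> tA A m n" using v by (simp add: tA_def pp)
    moreover have "pd West (tR R m n) (perm tps v) = pd South (R n m) v" "pd East (tR R m n) (perm tps v) = pd North (R n m) v"
      using pd_perm[OF tps_invol, of _ "R n m" "perm tps v"] by (simp_all add: tR_def[abs_def] pp)
    ultimately show ?thesis using c[of "perm tps v" m n] v(2) by (simp add: add.commute)
  qed
  then show ?thesis by blast
qed

text \<open>Off the hyperplanes \<open>East = West\<close> and \<open>North = South\<close>,
  subtracting the two known parts leaves a function \<Psi> whose only possibly nonzero partial
  derivative is the central one. It remains to see that \<Psi> is single-valued in the central
  value.\<close>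

theorem classification:
  assumes slices: "\<And>n m c. connected {v \<in> A n m. v $ Centre = c}"
  shows "\<exists>ca cb (\<psi> :: int \<Rightarrow> int \<Rightarrow> complex \<Rightarrow> complex). \<forall>n m. \<forall>v \<in> A n m. v $ East \<noteq> v $ West \<longrightarrow> v $ North \<noteq> v $ South \<longrightarrow>
    R n m v = ca n * rchar a b k e l (n+m) (v $ Centre) (v $ East) (v $ West)
      + cb m * rchar b a k e l (n+m) (v $ Centre) (v $ North) (v $ South) + \<psi> n m (v $ Centre)"
proof -
  obtain ca :: "int \<Rightarrow> complex" where ca: "\<And>n m v. v \<in> A n m \<Longrightarrow> v $ East \<noteq> v $ West \<Longrightarrow>
     pd West (R n m) v = ca n * (gA (n+m) (v $ Centre) (v $ East) / (v $ East - v $ West)\<^sup>2) \<and>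
     pd East (R n m) v = ca n * (- gA (n+m) (v $ Centre) (v $ West) / (v $ East - v $ West)\<^sup>2)"
    using horizontal_derivatives by metis
  obtain cb :: "int \<Rightarrow> complex" where cb: "\<And>n m v. v \<in> A n m \<Longrightarrow> v $ North \<noteq> v $ South \<Longrightarrow>
     pd South (R n m) v = cb m * (gB (n+m) (v $ Centre) (v $ North) / (v $ North - v $ South)\<^sup>2) \<and>
     pd North (R n m) v = cb m * (- gB (n+m) (v $ Centre) (v $ South) / (v $ North - v $ South)\<^sup>2)"
    using vertical_derivatives by metis
  define D where "D = (\<lambda>n m. {v \<in> A n m. v $ East \<noteq> v $ West \<and> v $ North \<noteq> v $ South})"
  define \<Psi> where "\<Psi> = (\<lambda>n m (v::complex ^ site). R n m v - ca n * rchar a b k e l (n+m) (v $ Centre) (v $ East) (v $ West)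
      - cb m * rchar b a k e l (n+m) (v $ Centre) (v $ North) (v $ South))"
  have D_open: "open (D n m)" for n m
  proof -
    have "open {v::complex ^ site. v $ i \<noteq> v $ i'}" for i i'
      by (intro open_Collect_neq continuous_intros)
    then show ?thesis unfolding D_def Collect_conj_eq using A_open by (intro open_Int) auto
  qed
  have \<Psi>_holo: "holo_on (\<Psi> n m) (D n m)" for n m
    unfolding \<Psi>_def by (intro holo_on_intros holo_on_rchar holo_on_subset[OF R_holo]) (auto simp: D_def)
  have \<Psi>_pd: "pd i (\<Psi> n m) v = 0" if v: "v \<in> D n m" and i: "i \<noteq> Centre" for i n m v
  proof -
    have vA: "v \<in> A n m" and ne: "v $ East \<noteq> v $ West" "v $ North \<noteq> v $ South" using v by (auto simp: D_def)
    note hR = has_field_derivative_pd[OF R_holo vA]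
    have shift: "((\<lambda>t. f (x + t)) has_field_derivative D) (at 0)" if "(f has_field_derivative D) (at x)" for f D and x :: complex
      using that DERIV_shift[of f D 0 x] by (simp add: add.commute)
    have "((\<lambda>t. \<Psi> n m (v + axis i t)) has_field_derivative 0) (at 0)"
    proof (cases i)
      case East
      have "((\<lambda>t. R n m (v + axis East t) - ca n * rchar a b k e l (n+m) (v $ Centre) (v $ East + t) (v $ West)
          - cb m * rchar b a k e l (n+m) (v $ Centre) (v $ North) (v $ South)) has_field_derivative
          pd East (R n m) v - ca n * (- gA (n+m) (v $ Centre) (v $ West) / (v $ East - v $ West)\<^sup>2) - 0) (at 0)"
        by (intro DERIV_diff DERIV_cmult DERIV_const hR shift rchar_deriv_first ne)
      then show ?thesis using ca[OF vA ne(1)] by (simp add: East \<Psi>_def axis_component)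
    next
      case West
      have "((\<lambda>t. R n m (v + axis West t) - ca n * rchar a b k e l (n+m) (v $ Centre) (v $ East) (v $ West + t)
          - cb m * rchar b a k e l (n+m) (v $ Centre) (v $ North) (v $ South)) has_field_derivative
          pd West (R n m) v - ca n * (gA (n+m) (v $ Centre) (v $ East) / (v $ East - v $ West)\<^sup>2) - 0) (at 0)"
        by (intro DERIV_diff DERIV_cmult DERIV_const hR shift rchar_deriv_second ne)
      then show ?thesis using ca[OF vA ne(1)] by (simp add: West \<Psi>_def axis_component)
    next
      case North
      have "((\<lambda>t. R n m (v + axis North t) - ca n * rchar a b k e l (n+m) (v $ Centre) (v $ East) (v $ West)
          - cb m * rchar b a k e l (n+m) (v $ Centre) (v $ North + t) (v $ South)) has_field_derivative
          pd North (R n m) v - 0 - cb m * (- gB (n+m) (v $ Centre) (v $ South) / (v $ North - v $ South)\<^sup>2)) (at 0)"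
        by (intro DERIV_diff DERIV_cmult DERIV_const hR shift rchar_deriv_first ne)
      then show ?thesis using cb[OF vA ne(2)] by (simp add: North \<Psi>_def axis_component)
    next
      case South
      have "((\<lambda>t. R n m (v + axis South t) - ca n * rchar a b k e l (n+m) (v $ Centre) (v $ East) (v $ West)
          - cb m * rchar b a k e l (n+m) (v $ Centre) (v $ North) (v $ South + t)) has_field_derivative
          pd South (R n m) v - 0 - cb m * (gB (n+m) (v $ Centre) (v $ North) / (v $ North - v $ South)\<^sup>2)) (at 0)"
        by (intro DERIV_diff DERIV_cmult DERIV_const hR shift rchar_deriv_second ne)
      then show ?thesis using cb[OF vA ne(2)] by (simp add: South \<Psi>_def axis_component)
    qed (use i in simp)
    then show ?thesis unfolding pd_def by (rule DERIV_imp_deriv)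
  qed
  have const: "\<Psi> n m q = \<Psi> n m p" if p: "p \<in> D n m" and q: "q \<in> D n m" and pq: "p $ Centre = q $ Centre" for n m p q
  proof -
    obtain r where r: "r > 0" "ball p r \<subseteq> D n m" using p D_open open_contains_ball by blast
    have local: "\<Psi> n m v = \<Psi> n m p" if v: "dist p v < r" "v $ Centre = p $ Centre" for v
    proof -
      define \<gamma> where "\<gamma> = (\<lambda>t::complex. p + t *s (v - p))"
      define U where "U = \<gamma> -` ball p r"
      have "convex U" unfolding U_def \<gamma>_def by (rule convex_line_ball)
      moreover have "((\<Psi> n m \<circ> \<gamma>) has_field_derivative 0) (at t within U)" if "t \<in> U" for t
      proof -
        have "((\<lambda>t. \<gamma> t $ s) has_field_derivative (v - p) $ s) (at t)" for s
          unfolding \<gamma>_def by (auto intro!: derivative_eq_intros)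
        moreover have "\<gamma> t \<in> D n m" using that r by (auto simp: U_def)
        ultimately have "((\<lambda>t. \<Psi> n m (\<gamma> t)) has_field_derivative (\<Sum>s\<in>UNIV. pd s (\<Psi> n m) (\<gamma> t) * (v - p) $ s)) (at t)"
          using holo_on_chain[OF \<Psi>_holo, of \<gamma> t n m "\<lambda>s. (v - p) $ s"] by blast
        moreover have "(\<Sum>s\<in>UNIV. pd s (\<Psi> n m) (\<gamma> t) * (v - p) $ s) = 0"
          using \<Psi>_pd[OF \<open>\<gamma> t \<in> D n m\<close>] v(2) by (simp add: sum_site)
        ultimately show ?thesis by (simp add: o_def has_field_derivative_at_within)
      qed
      ultimately obtain c where c: "\<And>t. t \<in> U \<Longrightarrow> (\<Psi> n m \<circ> \<gamma>) t = c"
        using has_field_derivative_zero_constant[of U "\<Psi> n m \<circ> \<gamma>"] by blast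
      have "0 \<in> U" "1 \<in> U" using v r(1) by (auto simp: U_def \<gamma>_def)
      then show ?thesis using c[of 0] c[of 1] by (simp add: \<gamma>_def)
    qed
    define h where "h = (\<lambda>v::complex ^ site. gA (n+m) (v $ Centre) (v $ East) - (v $ East - v $ West) * (edge2 a b e l (n+m) (v $ Centre) (v $ East) / 2))"
    define h' where "h' = (\<lambda>v::complex ^ site. gB (n+m) (v $ Centre) (v $ North) - (v $ North - v $ South) * (edge2 b a e l (n+m) (v $ Centre) (v $ North) / 2))"
    \<comment> \<open>Connectedness is known for the slices of \<open>A\<close>, not for those of
      \<open>D\<close> with the hyperplanes removed. Clearing denominators gives a function
      holomorphic across them, to which \<open>holo_identity\<close> applies.\<close>
    define H where "H = (\<lambda>v::complex ^ site. (R n m v - \<Psi> n m p) * (v $ East - v $ West) * (v $ North - v $ South)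
      - ca n * h v * (v $ North - v $ South) - cb m * h' v * (v $ East - v $ West))"
    have H: "H v = (\<Psi> n m v - \<Psi> n m p) * (v $ East - v $ West) * (v $ North - v $ South)" if "v \<in> D n m" for v
    proof -
      have h: "rchar a b k e l (n+m) (v $ Centre) (v $ East) (v $ West) * (v $ East - v $ West) = h v"
        "rchar b a k e l (n+m) (v $ Centre) (v $ North) (v $ South) * (v $ North - v $ South) = h' v"
        using that by (auto simp: D_def h_def h'_def rchar_mult)
      show ?thesis unfolding H_def h[symmetric] \<Psi>_def by (simp add: algebra_simps)
    qed
    have "H q = 0"
    proof (rule holo_identity[where S="{v \<in> A n m. v $ Centre = p $ Centre}" and A="A n m" and I="{Centre}" and c="\<lambda>_. p $ Centre" and p=p])
      show "holo_on H (A n m)" unfolding H_def h_def h'_def by (intro holo_on_intros holo_on_edge2 R_holo) auto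
      show "connected {v \<in> A n m. v $ Centre = p $ Centre}" by (rule slices)
      show "p \<in> {v \<in> A n m. v $ Centre = p $ Centre}" "q \<in> {v \<in> A n m. v $ Centre = p $ Centre}"
        using p q pq by (auto simp: D_def)
      show "r > 0" by (rule r)
      fix v assume v: "v \<in> {v \<in> A n m. v $ Centre = p $ Centre}"
      then obtain r' where "r' > 0" "ball v r' \<subseteq> A n m" using A_open open_contains_ball by blast
      then show "\<exists>r>0. ball v r \<inter> {w. \<forall>i\<in>{Centre}. w $ i = p $ Centre} \<subseteq> {v \<in> A n m. v $ Centre = p $ Centre}"
        by blast
      show "v $ i = p $ Centre" if "i \<in> {Centre}" for i using v that by simp
      show "H v = 0" if "dist p v < r"
        using H[of v] local[OF that] v r(2) that by auto
    qed auto
    then show ?thesis using H[OF q] q by (simp add: D_def)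
  qed
  \<comment> \<open>The value of \<Psi> at any point of the slice will do, by
    \<open>const\<close>.\<close>
  define \<psi> where "\<psi> = (\<lambda>n m c. \<Psi> n m (SOME p. p \<in> D n m \<and> p $ Centre = c))"
  have "\<Psi> n m v = \<psi> n m (v $ Centre)" if "v \<in> D n m" for n m v
  proof -
    have "(SOME p. p \<in> D n m \<and> p $ Centre = v $ Centre) \<in> D n m \<and> (SOME p. p \<in> D n m \<and> p $ Centre = v $ Centre) $ Centre = v $ Centre"
      by (rule someI[of _ v]) (use that in simp)
    then show ?thesis unfolding \<psi>_def using const that by metis
  qed
  then show ?thesis
    by (intro exI[of _ ca] exI[of _ cb] exI[of _ \<psi>]) (auto simp: D_def \<Psi>_def algebra_simps)
qed

end

subsection \<open>The three-point symmetries\<close>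

text \<open>Expanding about the other neighbour exhibits the east-west antisymmetry of
  \<open>rchar\<close>; in the criterion it lets the stencils centred on the right side of the cell
  use the edge shared with the left side.\<close>

lemma rchar_swap:
  assumes "y \<noteq> z"
  shows "rchar a b k e l j x y z = edge a b k e l j x z / (y - z) + edge2 a b e l j x z / 2"
proof -
  have 1: "edge2 a b e l j x y = edge2 a b e l j x z + 2 * (b * e (j+1) * (y - z))"
    by (simp add: edge2_def algebra_simps)
  have 2: "d \<noteq> 0 \<Longrightarrow> (g + p * d + q * d\<^sup>2) / d - (p + 2 * (q * d)) / 2 = g / d + p / 2" for g p q d :: complex
    by (simp add: field_simps power2_eq_square)
  show ?thesis
    unfolding rchar_def edge_taylor[of a b k e l j x y z] 1 using assms by (intro 2) simp
qed

context bw_quad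
begin

lemma good_diff:
  assumes g: "gd j x1 x2 x3 x4" "gd j x1 w x3 w'"
  shows "(x4 - w') * E j x3 w x1 = - E (j+1) x1 x4 x3 * (x2 - w)"
proof -
  have nz: "E j x3 x2 x1 \<noteq> 0" "E j x3 w x1 \<noteq> 0" using g by (auto simp: good_def)
  have Q: "Q j x1 x2 x3 x4 = 0" using g by (simp add: good_def)
  have "(x4 - w') * (E j x3 x2 x1 * E j x3 w x1) = - (E (j+1) x1 x4 x3 * E j x3 x2 x1) * (x2 - w)"
    using nx_diff[OF nz] unfolding E24[OF Q] good_nx[OF g(1), symmetric] good_nx[OF g(2), symmetric] .
  then have "E j x3 x2 x1 * ((x4 - w') * E j x3 w x1) = E j x3 x2 x1 * (- E (j+1) x1 x4 x3 * (x2 - w))"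
    by (simp add: algebra_simps)
  then show ?thesis by (rule mult_left_cancel[THEN iffD1, OF nz(1)])
qed

text \<open>The Moebius map from row to row is injective, so the condition
  \<open>East \<noteq> West\<close> is inherited upwards and downwards.\<close>

lemma good_distinct:
  assumes g: "gd j x1 x2 x3 x4" "gd j x1 w x3 w'"
  shows "x4 \<noteq> w' \<longleftrightarrow> x2 \<noteq> w"
  using good_diff[OF g] g unfolding good_def by (metis eq_iff_diff_eq_0 mult_eq_0_iff neg_equal_0_iff_equal)

text \<open>The fractions at the two left vertices of the cell. With \<open>good_diff\<close> their
  sum contains the difference quotient of \<open>E j x3 x2 x1\<close> in \<open>x2\<close>, which is
  \<open>b\<close>.\<close>

lemma edge_half_sum:
  assumes g: "gd j x1 x2 x3 x4" "gd j x1 w x3 w'" and ne: "x2 \<noteq> w"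
  shows "gA j x1 x2 / (x2 - w) * E j x2 x3 x4 + gA (j+1) x3 x4 / (x4 - w') * E (j+1) x4 x1 x2
    = b * E j x2 x3 x4 * E (j+1) x4 x1 x2"
proof -
  define e1 e2 e3 e4 f4 where "e1 = E j x2 x3 x4" "e2 = E (j+1) x1 x4 x3" "e3 = E (j+1) x4 x1 x2" "e4 = E j x3 x2 x1"
    "f4 = E j x3 w x1"
  note defs = e1_e2_e3_e4_f4_def
  have Q: "Q j x1 x2 x3 x4 = 0" using g by (simp add: good_def)
  have ne': "x4 - w' \<noteq> 0" "x2 - w \<noteq> 0" using good_distinct[OF g] ne by auto
  have diff: "(x4 - w') * f4 = - e2 * (x2 - w)" using good_diff[OF g] by (simp add: defs)
  have ef: "e4 - f4 = b * (x2 - w)" by (simp add: defs dq_def algebra_simps)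
  have f: "e2 / (x4 - w') = - f4 / (x2 - w)" using diff ne' by (simp add: field_simps)
  have "e3 * e4 / (x2 - w) * e1 + e1 * e2 / (x4 - w') * e3 = e1 * e3 * (e4 / (x2 - w) + e2 / (x4 - w'))"
    by (simp add: algebra_simps)
  also have "\<dots> = e1 * e3 * ((e4 - f4) / (x2 - w))"
    unfolding f by (simp add: diff_divide_distrib)
  also have "\<dots> = b * e1 * e3" unfolding ef using ne' by simp
  finally show ?thesis using E34[OF Q] E12[OF Q] by (simp add: defs)
qed

text \<open>The left fractions add up to \<open>b * e1 * e3\<close>, the right ones by reflection to
  \<open>- (b * e2 * e4)\<close>; the \<open>edge2\<close> terms cancel this remainder.\<close>

theorem rchar_symmetry:
  assumes g: "gd j x1 x2 x3 x4" "gd j x1 w x3 w'" "gd (j+1) x2 y x4 y'" and ne: "x2 \<noteq> w" "y \<noteq> x1"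
  shows "dQ j x1 x2 x3 x4 (rchar a b k e l j x1 x2 w) (rchar a b k e l (j+1) x2 y x1)
    (rchar a b k e l (j+1) x3 x4 w') (rchar a b k e l j x4 y' x3) = 0"
proof -
  have g': "gd (j+1) x2 x1 x4 x3" using g(1) by (simp add: good_hflip)
  have ne': "y' \<noteq> x3" using good_distinct[OF g(3) g'] ne by simp
  define e1 e2 e3 e4 where "e1 = E j x2 x3 x4" "e2 = E (j+1) x1 x4 x3" "e3 = E (j+1) x4 x1 x2" "e4 = E j x3 x2 x1"
  note defs = e1_e2_e3_e4_def
  define L1 L2 R1 R2 where "L1 = gA j x1 x2 / (x2 - w)" "L2 = gA (j+1) x3 x4 / (x4 - w')"
    "R1 = gA (j+1) x2 x1 / (y - x1)" "R2 = gA j x4 x3 / (y' - x3)"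
  have L: "L1 * e1 + L2 * e3 = b * e1 * e3"
    using edge_half_sum[OF g(1,2) ne(1)] by (simp add: defs L1_L2_R1_R2_def)
  have "gA (j+1) x2 x1 / (x1 - y) * e2 + gA j x4 x3 / (x3 - y') * e4 = b * e2 * e4"
    using edge_half_sum[OF g' g(3)] ne(2) even_shift_all(4)[of "2 + j" j] by (simp add: defs)
  moreover have "gA (j+1) x2 x1 / (x1 - y) = - R1" "gA j x4 x3 / (x3 - y') = - R2"
    unfolding L1_L2_R1_R2_def by (metis minus_diff_eq minus_divide_right)+
  ultimately have "- R1 * e2 + - R2 * e4 = b * e2 * e4" by (simp only:)
  then have R: "R1 * e2 + R2 * e4 = - (b * e2 * e4)"
    by (metis (no_types) minus_add_distrib minus_minus mult_minus_left)
  \<comment> \<open>Each derivative of a discriminant is a linear combination of the derivatives of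
    the equation, by differentiating the product formulas on solutions; the sum then reduces to
    products of \<open>e1\<close>, \<open>e2\<close>, \<open>e3\<close>, \<open>e4\<close>.\<close>
  have d: "edge2 a b e l j x1 x2 = e (j+1) * e4 + b * e3 - a * e2" "edge2 a b e l (j+1) x2 x1 = b * e4 + e j * e3 - a * e1"
    "edge2 a b e l (j+1) x3 x4 = e j * e2 + b * e1 - a * e4" "edge2 a b e l j x4 x3 = b * e2 + e (j+1) * e1 - a * e3"
    by (simp_all add: edge2_def defs dq_def algebra_simps)
  have r1: "rchar a b k e l j x1 x2 w = L1 - edge2 a b e l j x1 x2 / 2"
    "rchar a b k e l (j+1) x3 x4 w' = L2 - edge2 a b e l (j+1) x3 x4 / 2"
    by (simp_all add: rchar_def L1_L2_R1_R2_def)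
  have r2: "rchar a b k e l (j+1) x2 y x1 = R1 + edge2 a b e l (j+1) x2 x1 / 2"
    "rchar a b k e l j x4 y' x3 = R2 + edge2 a b e l j x4 x3 / 2"
    using rchar_swap[OF ne(2)] rchar_swap[OF ne'] by (simp_all add: L1_L2_R1_R2_def)
  have "rchar a b k e l j x1 x2 w * e1 + rchar a b k e l (j+1) x2 y x1 * e2
    + rchar a b k e l (j+1) x3 x4 w' * e3 + rchar a b k e l j x4 y' x3 * e4
    = (L1 * e1 + L2 * e3) + (R1 * e2 + R2 * e4) - (edge2 a b e l j x1 x2 * e1 + edge2 a b e l (j+1) x3 x4 * e3
      - edge2 a b e l (j+1) x2 x1 * e2 - edge2 a b e l j x4 x3 * e4) / 2"
    unfolding r1 r2 by (simp add: algebra_simps add_divide_distrib diff_divide_distrib)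
  also have "\<dots> = 0" unfolding L R d by (simp add: field_simps)
  finally show ?thesis by (simp add: defs dquad_def)
qed

lemma finite_edge_roots:
  assumes "gA j x y0 \<noteq> 0" shows "finite {y. gA j x y = 0}"
proof -
  let ?p = "(b * x + l (j+1)) * (e j * x + l j) - a * (l j * x + k)"
  let ?q = "e (j+1) * (e j * x + l j) + b * (b * x + l (j+1)) - a * (a * x + l (j+1))"
  have "?p \<noteq> 0 \<or> ?q \<noteq> 0 \<or> b * e (j+1) \<noteq> 0" using assms unfolding quadratic_edge by auto
  then show ?thesis unfolding quadratic_edge by (rule finite_quadratic_roots)
qed

text \<open>Injective sequences \<open>f\<close> and \<open>g\<close> are chosen with
  \<open>gA 0 (f i) (g i')\<close> nonzero for all pairs and placed on the even and odd sites. As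
  \<open>n+1\<close> and \<open>n-1\<close> have the same parity, injectivity separates their
  values.\<close>

lemma row_exists:
  "\<exists>x :: int \<Rightarrow> complex. \<forall>n. gA n (x n) (x (n+1)) \<noteq> 0 \<and> x (n+1) \<noteq> x (n-1)"
proof -
  have inj: "\<exists>f :: int \<Rightarrow> complex. inj f \<and> range f \<subseteq> - B" if "countable B" for B
  proof -
    have "uncountable (- B)"
    proof
      assume "countable (- B)"
      then have "countable (B \<union> - B)" using that by (intro countable_Un) auto
      then show False using uncountable_UNIV_complex by simp
    qed
    then have "infinite (- B)" using countable_finite by blast
    then obtain f :: "nat \<Rightarrow> complex" where "inj f" "range f \<subseteq> - B" using infinite_countable_subset by blast
    then show ?thesis by (intro exI[of _ "f \<circ> int_encode"]) (auto intro: inj_compose inj_int_encode)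
  qed
  obtain xs ys where xy: "gA 0 xs ys \<noteq> 0" using edge_nz(1) by blast
  have "finite {x. gA 0 x ys = 0}"
    using finite_edge_roots[of 1 ys xs] xy edge_flip[of 0 ys] by simp
  then obtain f :: "int \<Rightarrow> complex" where f: "inj f" "range f \<subseteq> - {x. gA 0 x ys = 0}"
    using inj[OF countable_finite] by blast
  have "countable (\<Union>i. {y. gA 0 (f i) y = 0})"
    using finite_edge_roots[of 0 _ ys] f(2) by (intro countable_UN) (auto intro!: countable_finite)
  then obtain g :: "int \<Rightarrow> complex" where g: "inj g" "range g \<subseteq> - (\<Union>i. {y. gA 0 (f i) y = 0})"
    using inj by blast
  have nz: "gA 0 (f i) (g i') \<noteq> 0" for i i' using g(2) by blast
  define x where "x = (\<lambda>n. if even n then f n else g n)"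
  have "gA n (x n) (x (n+1)) \<noteq> 0" for n
  proof (cases "even n")
    case True
    then have "gA n = gA 0" by (intro even_shift_all) simp
    then show ?thesis using True nz by (simp add: x_def)
  next
    case False
    then have "gA n = gA (0 + 1)" by (intro even_shift_all) simp
    then show ?thesis using False nz edge_flip[of 0 "g n" "f (n+1)"] by (simp add: x_def)
  qed
  moreover have "x (n+1) \<noteq> x (n-1)" for n
    using injD[OF f(1), of "n+1" "n-1"] injD[OF g(1), of "n+1" "n-1"] by (auto simp: x_def)
  ultimately show ?thesis by blast
qed

lemma gensol_distinct:
  assumes u: "gensol a b k e l u" and "\<And>n. u (n+1) 0 \<noteq> u (n-1) 0"
  shows "u (n+1) m \<noteq> u (n-1) m"
proof -
  have step: "u (n+1) (m+1) \<noteq> u (n-1) (m+1) \<longleftrightarrow> u (n+1) m \<noteq> u (n-1) m" for n m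
    using good_distinct[OF gensol_good(1,2)[OF u refl]] .
  show ?thesis
  proof (induction m rule: int_induct[of _ 0])
    case base show ?case by (rule assms(2))
  next
    case (step1 i) then show ?case using step[of n i] by simp
  next
    case (step2 i) then show ?case using step[of n "i - 1"] by simp
  qed
qed

theorem gensol_exists: "\<exists>u. gensol a b k e l u \<and> (\<forall>n m. u (n+1) m \<noteq> u (n-1) m)"
proof -
  obtain x :: "int \<Rightarrow> complex" where x: "\<And>n. gA (n + 0) (x n) (x (n+1)) \<noteq> 0" "\<And>n. x (n+1) \<noteq> x (n-1)"
    using row_exists by auto
  obtain u where u: "gensol a b k e l u" "\<And>n. u n 0 = x n"
    using gensol_extension[OF x(1), of "\<lambda>_. UNIV"] by auto
  show ?thesis using gensol_distinct[OF u(1)] u x(2) by (intro exI[of _ u]) simp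
qed

end

text \<open>The complex line through two points of the set meets the hyperplane in finitely many
  parameters, and the plane minus a finite set is connected. Over the reals this would fail.\<close>

lemma connected_complement_hyperplane:
  fixes i i' :: site and S :: "(complex ^ site) set"
  assumes S: "\<And>p q t. p \<in> S \<Longrightarrow> q \<in> S \<Longrightarrow> p + t *s (q - p) \<in> S"
  shows "connected {v \<in> S. v $ i \<noteq> v $ i'}"
  unfolding connected_iff_connected_component
proof (intro ballI)
  fix p q assume pq: "p \<in> {v \<in> S. v $ i \<noteq> v $ i'}" "q \<in> {v \<in> S. v $ i \<noteq> v $ i'}"
  define \<gamma> where "\<gamma> = (\<lambda>t::complex. p + t *s (q - p))"
  define T where "T = {t. \<gamma> t $ i = \<gamma> t $ i'}"
  have "\<gamma> t $ i - \<gamma> t $ i' = (p $ i - p $ i') + ((q $ i - q $ i') - (p $ i - p $ i')) * t + 0 * t\<^sup>2" for t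
    by (simp add: \<gamma>_def algebra_simps)
  then have "T = {t. (p $ i - p $ i') + ((q $ i - q $ i') - (p $ i - p $ i')) * t + 0 * t\<^sup>2 = 0}"
    unfolding T_def by (metis eq_iff_diff_eq_0)
  then have "finite T" using pq by (simp only:) (rule finite_quadratic_roots, auto)
  then have "connected (- T)"
    by (intro path_connected_imp_connected path_connected_complement_countable countable_finite) auto
  moreover have "continuous_on (- T) \<gamma>"
    unfolding \<gamma>_def vector_scalar_mult_def plus_vec_def by (intro continuous_intros)
  ultimately have "connected (\<gamma> ` (- T))" by (rule connected_continuous_image[rotated])
  moreover have "\<gamma> ` (- T) \<subseteq> {v \<in> S. v $ i \<noteq> v $ i'}"
    using S pq unfolding T_def \<gamma>_def by auto
  moreover have "0 \<in> - T" "1 \<in> - T" using pq by (auto simp: T_def \<gamma>_def)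
  then have "p \<in> \<gamma> ` (- T)" "q \<in> \<gamma> ` (- T)" by (auto simp: \<gamma>_def intro: image_eqI[of _ _ 0] image_eqI[of _ _ 1])
  ultimately show "connected_component {v \<in> S. v $ i \<noteq> v $ i'} p q"
    unfolding connected_component_def by blast
qed

subsection \<open>The deformed H equations\<close>

text \<open>The coefficients of \<open>quad\<close> obtained by expanding the three equations;
  \<open>cL0\<close> and \<open>cL1\<close> are the parts of the linear coefficient without and with
  the colour weight \<open>wt\<close>.\<close>

fun cA :: "family \<Rightarrow> complex \<Rightarrow> complex \<Rightarrow> complex" where
  "cA H1 \<alpha> \<beta> = 1" | "cA H2 \<alpha> \<beta> = 1" | "cA H3 \<alpha> \<beta> = \<alpha>"

fun cB :: "family \<Rightarrow> complex \<Rightarrow> complex \<Rightarrow> complex" where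
  "cB H1 \<alpha> \<beta> = - 1" | "cB H2 \<alpha> \<beta> = - 1" | "cB H3 \<alpha> \<beta> = - \<beta>"

fun cK :: "family \<Rightarrow> complex \<Rightarrow> complex \<Rightarrow> complex \<Rightarrow> complex \<Rightarrow> complex" where
  "cK H1 \<epsilon> \<delta> \<alpha> \<beta> = - (\<alpha> - \<beta>)"
| "cK H2 \<epsilon> \<delta> \<alpha> \<beta> = - \<alpha>\<^sup>2 + \<beta>\<^sup>2 - \<epsilon> * (\<beta> - \<alpha>) ^ 3 - \<epsilon> * (\<beta> - \<alpha>) * (\<alpha> + \<beta>)\<^sup>2"
| "cK H3 \<epsilon> \<delta> \<alpha> \<beta> = (\<alpha>\<^sup>2 - \<beta>\<^sup>2) * \<delta>"

fun cE :: "family \<Rightarrow> complex \<Rightarrow> complex \<Rightarrow> complex \<Rightarrow> complex" where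
  "cE H1 \<epsilon> \<alpha> \<beta> = \<epsilon> * (\<alpha> - \<beta>)"
| "cE H2 \<epsilon> \<alpha> \<beta> = - 4 * \<epsilon> * (\<beta> - \<alpha>)"
| "cE H3 \<epsilon> \<alpha> \<beta> = - \<epsilon> * (\<alpha>\<^sup>2 - \<beta>\<^sup>2) / (\<alpha> * \<beta>)"

fun cL0 :: "family \<Rightarrow> complex \<Rightarrow> complex \<Rightarrow> complex" where
  "cL0 H1 \<alpha> \<beta> = 0" | "cL0 H2 \<alpha> \<beta> = \<beta> - \<alpha>" | "cL0 H3 \<alpha> \<beta> = 0"

fun cL1 :: "family \<Rightarrow> complex \<Rightarrow> complex \<Rightarrow> complex \<Rightarrow> complex" where
  "cL1 H1 \<epsilon> \<alpha> \<beta> = 0" | "cL1 H2 \<epsilon> \<alpha> \<beta> = - 2 * \<epsilon> * (\<beta> - \<alpha>) * (\<alpha> + \<beta>)" | "cL1 H3 \<epsilon> \<alpha> \<beta> = 0"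

definition wt :: "complex \<Rightarrow> int \<Rightarrow> complex" where
  "wt \<sigma> j = (1 - \<sigma> * (-1) powi j) / 2"

definition ce :: "family \<Rightarrow> complex \<Rightarrow> complex \<Rightarrow> complex \<Rightarrow> complex \<Rightarrow> int \<Rightarrow> complex" where
  "ce fam \<sigma> \<epsilon> \<alpha> \<beta> j = cE fam \<epsilon> \<alpha> \<beta> * wt \<sigma> j"

definition cl :: "family \<Rightarrow> complex \<Rightarrow> complex \<Rightarrow> complex \<Rightarrow> complex \<Rightarrow> int \<Rightarrow> complex" where
  "cl fam \<sigma> \<epsilon> \<alpha> \<beta> j = cL0 fam \<alpha> \<beta> + cL1 fam \<epsilon> \<alpha> \<beta> * wt \<sigma> j"

lemma minus_one_powi_Suc: "(-1::complex) powi (j + 1) = - ((-1) powi j)"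
  by (simp add: power_int_add)

lemma wt_Suc: "wt \<sigma> (j + 1) = 1 - wt \<sigma> j"
  unfolding wt_def minus_one_powi_Suc by (simp add: field_simps)

lemma wt_cases:
  assumes "\<sigma> \<in> {1, -1}" shows "wt \<sigma> j = 0 \<or> wt \<sigma> j = 1"
proof -
  have "(-1::complex) powi j = 1 \<or> (-1::complex) powi j = -1"
    by (metis power_int_minus_left_even power_int_minus_left_odd power_int_1_left)
  then show ?thesis using assms by (auto simp: wt_def)
qed

lemma wY_eq: "wY \<sigma> n m = wt \<sigma> (n + m)" and wX_eq: "wX \<sigma> n m = 1 - wt \<sigma> (n + m)"
  by (simp_all add: wX_def wY_def wt_def field_simps)

lemma E_eq_quad:
  assumes \<sigma>: "\<sigma> \<in> {1, -1}"
  shows "\<E> fam \<sigma> \<epsilon> \<delta> n m \<alpha> \<beta> x1 x2 x3 x4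
    = quad (cA fam \<alpha> \<beta>) (cB fam \<alpha> \<beta>) (cK fam \<epsilon> \<delta> \<alpha> \<beta>) (ce fam \<sigma> \<epsilon> \<alpha> \<beta>) (cl fam \<sigma> \<epsilon> \<alpha> \<beta>) (n + m) x1 x2 x3 x4"
proof (cases fam)
  case H1 show ?thesis
    unfolding H1 quad_def ce_def cl_def wt_Suc by (simp add: wX_eq wY_eq algebra_simps)
next
  case H2
  \<comment> \<open>Expanding the product in \<open>H2\<close> gives squares and products of the
    weights; these simplify only because one weight is 1 and the other 0.\<close>
  show ?thesis using wt_cases[OF \<sigma>, of "n + m"]
    unfolding H2 quad_def ce_def cl_def wt_Suc
    by (auto simp: wX_eq wY_eq algebra_simps power2_eq_square power3_eq_cube)
next
  case H3
  define q where "q = \<epsilon> * (\<alpha>\<^sup>2 - \<beta>\<^sup>2) / (\<alpha> * \<beta>)"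
  have q: "cE H3 \<epsilon> \<alpha> \<beta> = - q" by (simp add: q_def)
  show ?thesis unfolding H3 quad_def ce_def cl_def wt_Suc q \<E>.simps q_def[symmetric]
    by (simp add: wX_eq wY_eq algebra_simps)
qed

text \<open>The factor between the horizontal discriminant and \<open>f\<close>. Vertical edges
  carry the opposite sign, as the equations change sign under exchange of the two directions and
  parameters.\<close>

fun kA :: "family \<Rightarrow> complex \<Rightarrow> complex \<Rightarrow> complex" where
  "kA H1 \<alpha> \<beta> = \<alpha> - \<beta>" | "kA H2 \<alpha> \<beta> = \<alpha> - \<beta>" | "kA H3 \<alpha> \<beta> = \<beta>\<^sup>2 - \<alpha>\<^sup>2"

lemma ff_nonzero:
  assumes \<sigma>: "\<sigma> \<in> {1, -1}" and "\<alpha> \<noteq> 0 \<or> fam \<noteq> H3"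
  shows "\<exists>u x. ff fam \<sigma> \<epsilon> \<delta> n m u x \<alpha> \<noteq> 0"
proof (cases fam)
  case H1 then show ?thesis by (intro exI[of _ 0]) simp
next
  case H2
  have "ff fam \<sigma> \<epsilon> \<delta> n m (- \<alpha>) 1 \<alpha> \<noteq> 0 \<or> ff fam \<sigma> \<epsilon> \<delta> n m 1 (- \<alpha>) \<alpha> \<noteq> 0"
    using wt_cases[OF \<sigma>, of "n + m"] by (auto simp: H2 wX_eq wY_eq)
  then show ?thesis by blast
next
  case H3
  \<comment> \<open>Chosen so that \<open>f\<close> takes the value 1 when the argument equal to 1
    is the one whose square survives.\<close>
  define c where "c = 1 - \<delta> * \<alpha> + \<epsilon> / \<alpha>"
  have "ff fam \<sigma> \<epsilon> \<delta> n m 1 c \<alpha> = 1 \<or> ff fam \<sigma> \<epsilon> \<delta> n m c 1 \<alpha> = 1"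
    using wt_cases[OF \<sigma>, of "n + m"] by (auto simp: H3 wX_eq wY_eq c_def)
  then show ?thesis by (metis zero_neq_one)
qed

abbreviation criterion_lhs :: "quad \<Rightarrow> characteristic \<Rightarrow> param_coeff \<Rightarrow> param_coeff \<Rightarrow> complex \<Rightarrow> complex
    \<Rightarrow> (int \<Rightarrow> int \<Rightarrow> complex) \<Rightarrow> int \<Rightarrow> int \<Rightarrow> complex" where
  "criterion_lhs Q R \<xi> \<zeta> \<alpha> \<beta> u n m \<equiv> R n m \<alpha> \<beta> (stencil u n m) * on_quad (D1 Q) \<alpha> \<beta> u n m
        + R (n+1) m \<alpha> \<beta> (stencil u (n+1) m) * on_quad (D2 Q) \<alpha> \<beta> u n m
        + R n (m+1) \<alpha> \<beta> (stencil u n (m+1)) * on_quad (D3 Q) \<alpha> \<beta> u n m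
        + R (n+1) (m+1) \<alpha> \<beta> (stencil u (n+1) (m+1)) * on_quad (D4 Q) \<alpha> \<beta> u n m
        + \<xi> n m \<alpha> \<beta> * on_quad (D\<alpha> Q) \<alpha> \<beta> u n m
        + \<zeta> n m \<alpha> \<beta> * on_quad (D\<beta> Q) \<alpha> \<beta> u n m"

lemma infinitesimal_criterionD:
  assumes crit: "infinitesimal_criterion Q D R \<xi> \<zeta> \<alpha> \<beta>" and u: "generic_solution Q \<alpha> \<beta> u"
    and s: "stencil u n m \<in> D n m \<alpha> \<beta>" "stencil u (n+1) m \<in> D (n+1) m \<alpha> \<beta>"
      "stencil u n (m+1) \<in> D n (m+1) \<alpha> \<beta>" "stencil u (n+1) (m+1) \<in> D (n+1) (m+1) \<alpha> \<beta>"
  shows "criterion_lhs Q R \<xi> \<zeta> \<alpha> \<beta> u n m = 0"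
proof -
  have "\<forall>i\<in>{0,1}. \<forall>j\<in>{0,1}. stencil u (n+i) (m+j) \<in> D (n+i) (m+j) \<alpha> \<beta>"
    using s by simp
  then show ?thesis using crit u unfolding infinitesimal_criterion_def by blast
qed

locale deformed_H =
  fixes fam :: family and \<sigma> \<epsilon> \<delta> \<alpha> \<beta> :: complex
  assumes sgn: "\<sigma> \<in> {1, -1}" and generic: "(\<alpha>, \<beta>) \<in> generic_params fam"
begin

abbreviation "ca \<equiv> cA fam \<alpha> \<beta>"
abbreviation "cb \<equiv> cB fam \<alpha> \<beta>"
abbreviation "ck \<equiv> cK fam \<epsilon> \<delta> \<alpha> \<beta>"
abbreviation "cee \<equiv> ce fam \<sigma> \<epsilon> \<alpha> \<beta>"
abbreviation "cll \<equiv> cl fam \<sigma> \<epsilon> \<alpha> \<beta>"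
abbreviation "kap \<equiv> kA fam \<alpha> \<beta>"
abbreviation "EE \<equiv> \<E> fam \<sigma> \<epsilon> \<delta>"

lemma edge_eq_ff:
  shows "edge ca cb ck cee cll (n + m) u x
      = kap * ff fam \<sigma> \<epsilon> \<delta> n m u x \<alpha>" (is ?H)
    and "edge cb ca ck cee cll (n + m) u x
      = - kap * ff fam \<sigma> \<epsilon> \<delta> n m u x \<beta>" (is ?V)
proof -
  have "?H \<and> ?V"
  proof (cases fam)
    case H1 show ?thesis using wt_cases[OF sgn, of "n + m"]
      unfolding H1 edge_def ce_def cl_def wt_Suc
      by (auto simp: wX_eq wY_eq algebra_simps power2_eq_square)
  next
    case H2
    show ?thesis using wt_cases[OF sgn, of "n + m"]
      unfolding H2 edge_def ce_def cl_def wt_Suc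
      by (auto simp: wX_eq wY_eq algebra_simps power2_eq_square power3_eq_cube)
  next
    case H3
    then have nz: "\<alpha> \<noteq> 0" "\<beta> \<noteq> 0" using generic by auto
    define q where "q = \<epsilon> * (\<alpha>\<^sup>2 - \<beta>\<^sup>2) / (\<alpha> * \<beta>)"
    have q: "cE H3 \<epsilon> \<alpha> \<beta> = - q" by (simp add: q_def)
    have z: "\<beta> * q - \<epsilon> / \<alpha> * (\<alpha>\<^sup>2 - \<beta>\<^sup>2) = 0" "\<alpha> * q - \<epsilon> / \<beta> * (\<alpha>\<^sup>2 - \<beta>\<^sup>2) = 0"
      using nz by (simp_all add: q_def)
    define r r' where "r = \<epsilon> / \<alpha>" "r' = \<epsilon> / \<beta>"
    let ?w = "wt \<sigma> (n + m) * u\<^sup>2 + (1 - wt \<sigma> (n + m)) * x\<^sup>2"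
    have "edge ca cb ck cee cll (n + m) u x
        = kap * (u * x + \<delta> * \<alpha> - r * ?w) + (\<beta> * q - r * (\<alpha>\<^sup>2 - \<beta>\<^sup>2)) * ?w"
      "edge cb ca ck cee cll (n + m) u x
        = - kap * (u * x + \<delta> * \<beta> - r' * ?w) - (\<alpha> * q - r' * (\<alpha>\<^sup>2 - \<beta>\<^sup>2)) * ?w"
      using wt_cases[OF sgn, of "n + m"]
      unfolding H3 edge_def ce_def cl_def wt_Suc q
      by (auto simp: algebra_simps power2_eq_square)
    then show ?thesis unfolding r_r'_def z H3 by (simp add: wX_eq wY_eq)
  qed
  then show ?H ?V by blast+
qed

lemma kap_nonzero: "kap \<noteq> 0"
  using generic by (cases fam) auto

sublocale bw_quad ca cb ck cee cll
proof
  show "ca \<noteq> 0" "cb \<noteq> 0" using generic by (cases fam; auto)+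
  fix j
  have wt: "wt \<sigma> (j + 2) = wt \<sigma> j" using wt_Suc[of \<sigma> "j + 1"] wt_Suc[of \<sigma> j] by (simp add: add.assoc)
  show "cee (j + 2) = cee j" "cll (j + 2) = cll j"
    by (simp_all add: ce_def cl_def wt)
  show "cee j * cee (j + 1) = 0"
    using wt_cases[OF sgn, of j] by (auto simp: ce_def wt_Suc)
  have nz: "\<alpha> \<noteq> 0 \<or> fam \<noteq> H3" "\<beta> \<noteq> 0 \<or> fam \<noteq> H3" using generic by (cases fam; auto)+
  show "\<exists>x y. edge ca cb ck cee cll j x y \<noteq> 0"
    using ff_nonzero[OF sgn nz(1), of \<epsilon> \<delta> j 0] edge_eq_ff(1)[of j 0] kap_nonzero by simp
  show "\<exists>x y. edge cb ca ck cee cll j x y \<noteq> 0"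
    using ff_nonzero[OF sgn nz(2), of \<epsilon> \<delta> j 0] edge_eq_ff(2)[of j 0] kap_nonzero by simp
qed

lemma EE: "EE n m \<alpha> \<beta> = Q (n + m)"
  by (simp add: fun_eq_iff E_eq_quad[OF sgn])

lemma D_eq:
  "D1 EE n m \<alpha> \<beta> x1 x2 x3 x4 = E (n+m) x2 x3 x4"
  "D2 EE n m \<alpha> \<beta> x1 x2 x3 x4 = E (n+m+1) x1 x4 x3"
  "D3 EE n m \<alpha> \<beta> x1 x2 x3 x4 = E (n+m+1) x4 x1 x2"
  "D4 EE n m \<alpha> \<beta> x1 x2 x3 x4 = E (n+m) x3 x2 x1"
  unfolding D1_def D2_def D3_def D4_def EE
  by (rule DERIV_imp_deriv; unfold quad_def; auto intro!: derivative_eq_intros simp: dq_def algebra_simps)+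

lemma generic_solution_iff: "generic_solution EE \<alpha> \<beta> u \<longleftrightarrow> gensol ca cb ck cee cll u"
  by (simp add: generic_solution_def gensol_def good_def on_quad_def D_eq EE)

lemma rchar_Rn: "rchar ca cb ck cee cll (n+m) (v $ Centre) (v $ East) (v $ West) = kap * Rn fam \<sigma> \<epsilon> \<delta> n m \<alpha> \<beta> v"
proof -
  have k: "kap \<noteq> 0" using kap_nonzero .
  have ff: "(\<lambda>x. ff fam \<sigma> \<epsilon> \<delta> n m (v $ Centre) x \<alpha>) = (\<lambda>x. gA (n+m) (v $ Centre) x / kap)"
    using edge_eq_ff(1) k by simp
  have "((\<lambda>x. ff fam \<sigma> \<epsilon> \<delta> n m (v $ Centre) x \<alpha>) has_field_derivative
      edge2 ca cb cee cll (n+m) (v $ Centre) (v $ East) / kap) (at (v $ East))"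
    unfolding ff by (rule DERIV_cdivide[OF has_field_derivative_edge])
  from DERIV_imp_deriv[OF this] show ?thesis
    unfolding rchar_def Rn_def edge_eq_ff(1) using k by (simp add: field_simps)
qed

lemma rchar_Rm: "rchar cb ca ck cee cll (n+m) (v $ Centre) (v $ North) (v $ South) = - kap * Rm fam \<sigma> \<epsilon> \<delta> n m \<alpha> \<beta> v"
proof -
  have k: "- kap \<noteq> 0" using kap_nonzero by simp
  have ff: "(\<lambda>x. ff fam \<sigma> \<epsilon> \<delta> n m (v $ Centre) x \<beta>) = (\<lambda>x. gB (n+m) (v $ Centre) x / (- kap))"
    using edge_eq_ff(2) k by simp
  have "((\<lambda>x. ff fam \<sigma> \<epsilon> \<delta> n m (v $ Centre) x \<beta>) has_field_derivative
      edge2 cb ca cee cll (n+m) (v $ Centre) (v $ North) / (- kap)) (at (v $ North))"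
    unfolding ff by (rule DERIV_cdivide[OF has_field_derivative_edge])
  from DERIV_imp_deriv[OF this] show ?thesis
    unfolding rchar_def Rm_def edge_eq_ff(2) using k by (simp add: field_simps)
qed

text \<open>Used to see that the \<xi> and \<zeta> terms are continuous in the four values of the
  cell; the precise coefficients do not matter, so they remain existential.\<close>

lemma parameter_derivatives:
  shows "\<exists>a' b' k' e' l'. \<forall>n m x1 x2 x3 x4. D\<alpha> EE n m \<alpha> \<beta> x1 x2 x3 x4 = quad a' b' k' e' l' (n+m) x1 x2 x3 x4" (is "?P D\<alpha>")
    and "\<exists>a' b' k' e' l'. \<forall>n m x1 x2 x3 x4. D\<beta> EE n m \<alpha> \<beta> x1 x2 x3 x4 = quad a' b' k' e' l' (n+m) x1 x2 x3 x4" (is "?P D\<beta>")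
proof -
  have nz: "fam = H3 \<Longrightarrow> \<alpha> \<noteq> 0 \<and> \<beta> \<noteq> 0" using generic by auto
  have "(\<lambda>t. cA fam t \<beta>) field_differentiable at \<alpha>" "(\<lambda>t. cB fam t \<beta>) field_differentiable at \<alpha>"
    "(\<lambda>t. cL0 fam t \<beta>) field_differentiable at \<alpha>" "(\<lambda>t. cL1 fam \<epsilon> t \<beta>) field_differentiable at \<alpha>"
    "(\<lambda>t. cK fam \<epsilon> \<delta> t \<beta>) field_differentiable at \<alpha>"
    by (cases fam; simp; intro derivative_intros)+
  moreover have "(\<lambda>t. cE fam \<epsilon> t \<beta>) field_differentiable at \<alpha>"
    using nz by (cases fam; simp; intro derivative_intros; simp)
  ultimately obtain a' b' k' e' l0 l1 where d: "((\<lambda>t. cA fam t \<beta>) has_field_derivative a') (at \<alpha>)"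
    "((\<lambda>t. cB fam t \<beta>) has_field_derivative b') (at \<alpha>)" "((\<lambda>t. cK fam \<epsilon> \<delta> t \<beta>) has_field_derivative k') (at \<alpha>)"
    "((\<lambda>t. cE fam \<epsilon> t \<beta>) has_field_derivative e') (at \<alpha>)" "((\<lambda>t. cL0 fam t \<beta>) has_field_derivative l0) (at \<alpha>)"
    "((\<lambda>t. cL1 fam \<epsilon> t \<beta>) has_field_derivative l1) (at \<alpha>)"
    unfolding field_differentiable_def by blast
  have "D\<alpha> EE n m \<alpha> \<beta> x1 x2 x3 x4 = quad a' b' k' (\<lambda>j. e' * wt \<sigma> j) (\<lambda>j. l0 + l1 * wt \<sigma> j) (n+m) x1 x2 x3 x4" for n m x1 x2 x3 x4
    unfolding D\<alpha>_def E_eq_quad[OF sgn] quad_def ce_def cl_def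
    by (rule DERIV_imp_deriv) (auto intro!: derivative_eq_intros d simp: algebra_simps)
  then show "?P D\<alpha>" by blast
  have "(\<lambda>t. cA fam \<alpha> t) field_differentiable at \<beta>" "(\<lambda>t. cB fam \<alpha> t) field_differentiable at \<beta>"
    "(\<lambda>t. cL0 fam \<alpha> t) field_differentiable at \<beta>" "(\<lambda>t. cL1 fam \<epsilon> \<alpha> t) field_differentiable at \<beta>"
    "(\<lambda>t. cK fam \<epsilon> \<delta> \<alpha> t) field_differentiable at \<beta>"
    by (cases fam; simp; intro derivative_intros)+
  moreover have "(\<lambda>t. cE fam \<epsilon> \<alpha> t) field_differentiable at \<beta>"
    using nz by (cases fam; simp; intro derivative_intros; simp)
  ultimately obtain a' b' k' e' l0 l1 where d: "((\<lambda>t. cA fam \<alpha> t) has_field_derivative a') (at \<beta>)"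
    "((\<lambda>t. cB fam \<alpha> t) has_field_derivative b') (at \<beta>)" "((\<lambda>t. cK fam \<epsilon> \<delta> \<alpha> t) has_field_derivative k') (at \<beta>)"
    "((\<lambda>t. cE fam \<epsilon> \<alpha> t) has_field_derivative e') (at \<beta>)" "((\<lambda>t. cL0 fam \<alpha> t) has_field_derivative l0) (at \<beta>)"
    "((\<lambda>t. cL1 fam \<epsilon> \<alpha> t) has_field_derivative l1) (at \<beta>)"
    unfolding field_differentiable_def by blast
  have "D\<beta> EE n m \<alpha> \<beta> x1 x2 x3 x4 = quad a' b' k' (\<lambda>j. e' * wt \<sigma> j) (\<lambda>j. l0 + l1 * wt \<sigma> j) (n+m) x1 x2 x3 x4" for n m x1 x2 x3 x4
    unfolding D\<beta>_def E_eq_quad[OF sgn] quad_def ce_def cl_def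
    by (rule DERIV_imp_deriv) (auto intro!: derivative_eq_intros d simp: algebra_simps)
  then show "?P D\<beta>" by blast
qed

lemma rchar_shift:
  "rchar ca cb ck cee cll (j + 2) = rchar ca cb ck cee cll j" "rchar cb ca ck cee cll (j + 2) = rchar cb ca ck cee cll j"
proof -
  have "gA (j + 2) = gA j" "gB (j + 2) = gB j" by (rule even_shift_all; simp)+
  moreover have "edge2 ca cb cee cll (j + 2) = edge2 ca cb cee cll j" "edge2 cb ca cee cll (j + 2) = edge2 cb ca cee cll j"
    using even_shift[of "j + 2" j] by (simp_all add: fun_eq_iff edge2_def)
  ultimately show "rchar ca cb ck cee cll (j + 2) = rchar ca cb ck cee cll j" "rchar cb ca ck cee cll (j + 2) = rchar cb ca ck cee cll j"
    by (simp_all add: fun_eq_iff rchar_def)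
qed

lemma gensol_exists_vertical: "\<exists>u. gensol ca cb ck cee cll u \<and> (\<forall>n m. u n (m+1) \<noteq> u n (m-1))"
proof -
  obtain u where u: "gensol cb ca ck cee cll u" "\<And>n m. u (n+1) m \<noteq> u (n-1) m"
    using bw_quad.gensol_exists[OF bw_quad_transpose] by blast
  have "gensol ca cb ck cee cll (tu u)" using u(1) by (simp only: gensol_transpose)
  then show ?thesis using u(2) by (intro exI[of _ "tu u"]) (simp add: tu_def)
qed

lemma admissible_hyperplane_complement:
  assumes "generic_solution EE \<alpha> \<beta> u" "\<And>n m. stencil u n m $ i \<noteq> stencil u n m $ i'" "i \<noteq> Centre" "i' \<noteq> Centre"
  shows "admissible_domain EE \<alpha> \<beta> (\<lambda>n m. {v. v $ i \<noteq> v $ i'})"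
proof -
  have "open {v::complex ^ site. v $ i \<noteq> v $ i'}"
    by (intro open_Collect_neq continuous_intros)
  moreover have "connected {v::complex ^ site. v $ i \<noteq> v $ i'}"
    using connected_complement_hyperplane[of UNIV i i'] by simp
  moreover have "connected {v \<in> {v::complex ^ site. v $ i \<noteq> v $ i'}. v $ Centre = c}" for c
    using connected_complement_hyperplane[of "{v. v $ Centre = c}" i i'] by (simp add: conj_commute)
  ultimately show ?thesis unfolding admissible_domain_def using assms by blast
qed

section \<open>Verification of the known symmetries and classification at fixed parameters\<close>

theorem horizontal_symmetry:
  "admissible_domain EE \<alpha> \<beta> (\<lambda>n m. dom_n n m \<alpha> \<beta>)"
  "holo_on (Rn fam \<sigma> \<epsilon> \<delta> n m \<alpha> \<beta>) (dom_n n m \<alpha> \<beta>)"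
  "infinitesimal_criterion EE dom_n (Rn fam \<sigma> \<epsilon> \<delta>) (\<lambda>_ _ _ _. 0) (\<lambda>_ _ _ _. 0) \<alpha> \<beta>"
proof -
  have k: "kap \<noteq> 0" using kap_nonzero .
  have Rn: "Rn fam \<sigma> \<epsilon> \<delta> n m \<alpha> \<beta> v = rchar ca cb ck cee cll (n+m) (v $ Centre) (v $ East) (v $ West) / kap" for n m v
    using rchar_Rn[of n m v] k by simp
  obtain u where u: "gensol ca cb ck cee cll u" "\<And>n m. u (n+1) m \<noteq> u (n-1) m" using gensol_exists by blast
  then show "admissible_domain EE \<alpha> \<beta> (\<lambda>n m. dom_n n m \<alpha> \<beta>)"
    unfolding dom_n_def using admissible_hyperplane_complement[of u East West]
    by (simp add: generic_solution_iff stencil_eq_st)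
  show "holo_on (Rn fam \<sigma> \<epsilon> \<delta> n m \<alpha> \<beta>) (dom_n n m \<alpha> \<beta>)"
    unfolding Rn[abs_def] using k by (intro holo_on_intros holo_on_rchar) (auto simp: dom_n_def)
  show "infinitesimal_criterion EE dom_n (Rn fam \<sigma> \<epsilon> \<delta>) (\<lambda>_ _ _ _. 0) (\<lambda>_ _ _ _. 0) \<alpha> \<beta>"
    unfolding infinitesimal_criterion_def
  proof (intro allI impI)
    fix u n m
    assume "generic_solution EE \<alpha> \<beta> u" and s: "\<forall>i\<in>{0,1}. \<forall>j\<in>{0,1}. stencil u (n+i) (m+j) \<in> dom_n (n+i) (m+j) \<alpha> \<beta>"
    then have u: "gensol ca cb ck cee cll u" by (simp add: generic_solution_iff)
    have ne: "u (n+1) m \<noteq> u (n-1) m" "u (n+2) m \<noteq> u n m"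
      using s by (auto simp: dom_n_def stencil_eq_st add.commute)
    have "dQ (n+m) (u n m) (u (n+1) m) (u n (m+1)) (u (n+1) (m+1)) (rchar ca cb ck cee cll (n+m) (u n m) (u (n+1) m) (u (n-1) m))
        (rchar ca cb ck cee cll (n+m+1) (u (n+1) m) (u (n+2) m) (u n m)) (rchar ca cb ck cee cll (n+m+1) (u n (m+1)) (u (n+1) (m+1)) (u (n-1) (m+1)))
        (rchar ca cb ck cee cll (n+m) (u (n+1) (m+1)) (u (n+2) (m+1)) (u n (m+1))) = 0"
      using rchar_symmetry[OF gensol_good(1,2,4)[OF u refl] ne] .
    then have "criterion_lhs EE (Rn fam \<sigma> \<epsilon> \<delta>) (\<lambda>_ _ _ _. 0) (\<lambda>_ _ _ _. 0) \<alpha> \<beta> u n m * kap = 0"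
      using k rchar_shift[of "n+m"] by (simp add: Rn stencil_eq_st dquad_def on_quad_def D_eq distrib_right add_ac)
    then show "criterion_lhs EE (Rn fam \<sigma> \<epsilon> \<delta>) (\<lambda>_ _ _ _. 0) (\<lambda>_ _ _ _. 0) \<alpha> \<beta> u n m = 0"
      using k by simp
  qed
qed

theorem vertical_symmetry:
  "admissible_domain EE \<alpha> \<beta> (\<lambda>n m. dom_m n m \<alpha> \<beta>)"
  "holo_on (Rm fam \<sigma> \<epsilon> \<delta> n m \<alpha> \<beta>) (dom_m n m \<alpha> \<beta>)"
  "infinitesimal_criterion EE dom_m (Rm fam \<sigma> \<epsilon> \<delta>) (\<lambda>_ _ _ _. 0) (\<lambda>_ _ _ _. 0) \<alpha> \<beta>"
proof -
  define c where "c = - kap"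
  have k: "c \<noteq> 0" using kap_nonzero by (simp add: c_def)
  have Rm: "Rm fam \<sigma> \<epsilon> \<delta> n m \<alpha> \<beta> v = rchar cb ca ck cee cll (n+m) (v $ Centre) (v $ North) (v $ South) / c" for n m v
    using rchar_Rm[of n m v] k unfolding c_def by (simp del: minus_mult_left)
  obtain u where u: "gensol ca cb ck cee cll u" "\<And>n m. u n (m+1) \<noteq> u n (m-1)" using gensol_exists_vertical by blast
  then show "admissible_domain EE \<alpha> \<beta> (\<lambda>n m. dom_m n m \<alpha> \<beta>)"
    unfolding dom_m_def using admissible_hyperplane_complement[of u North South]
    by (simp add: generic_solution_iff stencil_eq_st)
  show "holo_on (Rm fam \<sigma> \<epsilon> \<delta> n m \<alpha> \<beta>) (dom_m n m \<alpha> \<beta>)"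
    unfolding Rm[abs_def] using k by (intro holo_on_intros holo_on_rchar) (auto simp: dom_m_def)
  show "infinitesimal_criterion EE dom_m (Rm fam \<sigma> \<epsilon> \<delta>) (\<lambda>_ _ _ _. 0) (\<lambda>_ _ _ _. 0) \<alpha> \<beta>"
    unfolding infinitesimal_criterion_def
  proof (intro allI impI)
    fix u n m
    assume "generic_solution EE \<alpha> \<beta> u" and s: "\<forall>i\<in>{0,1}. \<forall>j\<in>{0,1}. stencil u (n+i) (m+j) \<in> dom_m (n+i) (m+j) \<alpha> \<beta>"
    then have u: "gensol ca cb ck cee cll u" by (simp add: generic_solution_iff)
    have ne: "u n (m+1) \<noteq> u n (m-1)" "u n (m+2) \<noteq> u n m"
      using s by (auto simp: dom_m_def stencil_eq_st add.commute)
    note g = gensol_good[OF u refl, of n m, folded good_transpose[of cb ca ck cee cll]]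
    have "dQ (n+m) (u n m) (u (n+1) m) (u n (m+1)) (u (n+1) (m+1)) (rchar cb ca ck cee cll (n+m) (u n m) (u n (m+1)) (u n (m-1)))
        (rchar cb ca ck cee cll (n+m+1) (u (n+1) m) (u (n+1) (m+1)) (u (n+1) (m-1))) (rchar cb ca ck cee cll (n+m+1) (u n (m+1)) (u n (m+2)) (u n m))
        (rchar cb ca ck cee cll (n+m) (u (n+1) (m+1)) (u (n+1) (m+2)) (u (n+1) m)) = 0"
      using bw_quad.rchar_symmetry[OF bw_quad_transpose g(1,3,5) ne] unfolding dquad_transpose[of cb ca] .
    then have "criterion_lhs EE (Rm fam \<sigma> \<epsilon> \<delta>) (\<lambda>_ _ _ _. 0) (\<lambda>_ _ _ _. 0) \<alpha> \<beta> u n m * c = 0"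
      using k rchar_shift[of "n+m"] by (simp add: Rm stencil_eq_st dquad_def on_quad_def D_eq distrib_right add_ac)
    then show "criterion_lhs EE (Rm fam \<sigma> \<epsilon> \<delta>) (\<lambda>_ _ _ _. 0) (\<lambda>_ _ _ _. 0) \<alpha> \<beta> u n m = 0"
      using k by simp
  qed
qed

lemma tendsto_quad:
  assumes "(f1 \<longlongrightarrow> x1) F" "(f2 \<longlongrightarrow> x2) F" "(f3 \<longlongrightarrow> x3) F" "(f4 \<longlongrightarrow> x4) F"
  shows "((\<lambda>t. quad a b k e l j (f1 t) (f2 t) (f3 t) (f4 t)) \<longlongrightarrow> quad a b k e l j x1 x2 x3 x4) F"
  unfolding quad_def using assms by (intro tendsto_intros)

theorem five_point_classification:
  assumes adm: "admissible_domain EE \<alpha> \<beta> (\<lambda>n m. D n m \<alpha> \<beta>)"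
    and holo: "\<And>n m. holo_on (R n m \<alpha> \<beta>) (D n m \<alpha> \<beta>)"
    and crit: "infinitesimal_criterion EE D R \<xi> \<zeta> \<alpha> \<beta>"
  shows "\<exists>a b \<psi>. \<forall>n m. \<forall>v \<in> D n m \<alpha> \<beta> \<inter> dom_n n m \<alpha> \<beta> \<inter> dom_m n m \<alpha> \<beta>.
    R n m \<alpha> \<beta> v = a n * Rn fam \<sigma> \<epsilon> \<delta> n m \<alpha> \<beta> v + b m * Rm fam \<sigma> \<epsilon> \<delta> n m \<alpha> \<beta> v + 1/2 * \<psi> n m (v $ Centre)"
proof -
  obtain u0 where u0: "generic_solution EE \<alpha> \<beta> u0" "\<And>n m. stencil u0 n m \<in> D n m \<alpha> \<beta>"
    and D: "\<And>n m. open (D n m \<alpha> \<beta>)" "\<And>n m. connected (D n m \<alpha> \<beta>)" "\<And>n m c. connected {v \<in> D n m \<alpha> \<beta>. v $ Centre = c}"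
    using adm unfolding admissible_domain_def by blast
  define K where "K = (\<lambda>n m x1 x2 x3 x4. \<xi> n m \<alpha> \<beta> * D\<alpha> EE n m \<alpha> \<beta> x1 x2 x3 x4 + \<zeta> n m \<alpha> \<beta> * D\<beta> EE n m \<alpha> \<beta> x1 x2 x3 x4)"
  interpret S: bw_symmetry ca cb ck cee cll "\<lambda>n m. D n m \<alpha> \<beta>" "\<lambda>n m. R n m \<alpha> \<beta>" K u0
  proof unfold_locales
    fix n m
    show "open (D n m \<alpha> \<beta>)" "connected (D n m \<alpha> \<beta>)" "holo_on (R n m \<alpha> \<beta>) (D n m \<alpha> \<beta>)" by (rule D holo)+
    show "gensol ca cb ck cee cll u0" using u0(1) by (simp add: generic_solution_iff)
    show "stencil u0 n m \<in> D n m \<alpha> \<beta>" by (rule u0)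
    obtain a' b' k' e' l' where da: "\<And>n m x1 x2 x3 x4. D\<alpha> EE n m \<alpha> \<beta> x1 x2 x3 x4 = quad a' b' k' e' l' (n+m) x1 x2 x3 x4"
      using parameter_derivatives(1) by blast
    obtain a'' b'' k'' e'' l'' where db: "\<And>n m x1 x2 x3 x4. D\<beta> EE n m \<alpha> \<beta> x1 x2 x3 x4 = quad a'' b'' k'' e'' l'' (n+m) x1 x2 x3 x4"
      using parameter_derivatives(2) by blast
    fix f1 f2 f3 f4 :: "nat \<Rightarrow> complex" and x1 x2 x3 x4
    assume "f1 \<longlonglongrightarrow> x1" "f2 \<longlonglongrightarrow> x2" "f3 \<longlonglongrightarrow> x3" "f4 \<longlonglongrightarrow> x4"
    then show "(\<lambda>i. K n m (f1 i) (f2 i) (f3 i) (f4 i)) \<longlonglongrightarrow> K n m x1 x2 x3 x4"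
      unfolding K_def da db by (intro tendsto_add tendsto_mult tendsto_const tendsto_quad)
  next
    fix u n m
    assume u: "gensol ca cb ck cee cll u" and s: "stencil u n m \<in> D n m \<alpha> \<beta>" "stencil u (n+1) m \<in> D (n+1) m \<alpha> \<beta>"
      "stencil u n (m+1) \<in> D n (m+1) \<alpha> \<beta>" "stencil u (n+1) (m+1) \<in> D (n+1) (m+1) \<alpha> \<beta>"
    have "generic_solution EE \<alpha> \<beta> u" using u by (simp add: generic_solution_iff)
    then have "criterion_lhs EE R \<xi> \<zeta> \<alpha> \<beta> u n m = 0"
      by (intro infinitesimal_criterionD[OF crit] s)
    then show "dQ (n+m) (u n m) (u (n+1) m) (u n (m+1)) (u (n+1) (m+1)) (R n m \<alpha> \<beta> (stencil u n m)) (R (n+1) m \<alpha> \<beta> (stencil u (n+1) m))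
        (R n (m+1) \<alpha> \<beta> (stencil u n (m+1))) (R (n+1) (m+1) \<alpha> \<beta> (stencil u (n+1) (m+1)))
      + K n m (u n m) (u (n+1) m) (u n (m+1)) (u (n+1) (m+1)) = 0"
      by (simp add: K_def dquad_def on_quad_def D_eq add.assoc)
  qed
  obtain a b and \<psi> :: "int \<Rightarrow> int \<Rightarrow> complex \<Rightarrow> complex" where *: "\<And>n m v. v \<in> D n m \<alpha> \<beta> \<Longrightarrow> v $ East \<noteq> v $ West \<Longrightarrow> v $ North \<noteq> v $ South \<Longrightarrow>
    R n m \<alpha> \<beta> v = a n * rchar ca cb ck cee cll (n+m) (v $ Centre) (v $ East) (v $ West)
      + b m * rchar cb ca ck cee cll (n+m) (v $ Centre) (v $ North) (v $ South) + \<psi> n m (v $ Centre)"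
    using S.classification[OF D(3)] by blast
  show ?thesis
    \<comment> \<open>The factors \<open>kap\<close> and \<open>- kap\<close> convert
      \<open>rchar\<close> into \<open>Rn\<close> and \<open>Rm\<close>; the factor 2 compensates
      the one half in front of \<psi>.\<close>
    by (intro exI[of _ "\<lambda>n. a n * kap"] exI[of _ "\<lambda>m. - b m * kap"] exI[of _ "\<lambda>n m c. 2 * \<psi> n m c"])
      (auto simp: * rchar_Rn rchar_Rm dom_n_def dom_m_def)
qed

end

lemma depends_only_on_Rn: "depends_only_on {West, Centre, East} (Rn fam \<sigma> \<epsilon> \<delta>)"
  and depends_only_on_Rm: "depends_only_on {South, Centre, North} (Rm fam \<sigma> \<epsilon> \<delta>)"
  unfolding depends_only_on_def Rn_def Rm_def by simp_all

lemma infinitesimal_criterion_cong: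
  assumes "infinitesimal_criterion Q D R \<xi> \<zeta> \<alpha> \<beta>"
    and "\<And>n m. D' n m \<alpha> \<beta> \<subseteq> D n m \<alpha> \<beta>" "\<And>n m v. v \<in> D' n m \<alpha> \<beta> \<Longrightarrow> R n m \<alpha> \<beta> v = R' n m \<alpha> \<beta> v"
  shows "infinitesimal_criterion Q D' R' \<xi> \<zeta> \<alpha> \<beta>"
  unfolding infinitesimal_criterion_def
proof (intro allI impI)
  fix u n m
  assume u: "generic_solution Q \<alpha> \<beta> u" and s: "\<forall>i\<in>{0,1}. \<forall>j\<in>{0,1}. stencil u (n+i) (m+j) \<in> D' (n+i) (m+j) \<alpha> \<beta>"
  then have s: "stencil u n m \<in> D' n m \<alpha> \<beta>" "stencil u (n+1) m \<in> D' (n+1) m \<alpha> \<beta>"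
    "stencil u n (m+1) \<in> D' n (m+1) \<alpha> \<beta>" "stencil u (n+1) (m+1) \<in> D' (n+1) (m+1) \<alpha> \<beta>" by auto
  show "criterion_lhs Q R' \<xi> \<zeta> \<alpha> \<beta> u n m = 0"
    unfolding s[THEN assms(3), symmetric] using s assms(2) by (intro infinitesimal_criterionD[OF assms(1) u]) blast+
qed

text \<open>The classification is carried out for each pair of parameters separately and assembled
  by choice. The criterion for the assembled form is inherited from the given one, because shrinking
  the domains only removes instances.\<close>

theorem proposition5p1:
  fixes fam :: family and \<sigma> \<epsilon> \<delta> :: complex
  assumes "\<sigma> \<in> {1, -1}"
  shows "local_three_point_symmetry (\<E> fam \<sigma> \<epsilon> \<delta>) (generic_params fam) dom_n (Rn fam \<sigma> \<epsilon> \<delta>)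
    \<and> local_three_point_symmetry (\<E> fam \<sigma> \<epsilon> \<delta>) (generic_params fam) dom_m (Rm fam \<sigma> \<epsilon> \<delta>)
    \<and> (\<forall>P D R \<xi> \<zeta>. P \<subseteq> generic_params fam \<longrightarrow>
         five_point_symmetry (\<E> fam \<sigma> \<epsilon> \<delta>) P D R \<xi> \<zeta> \<longrightarrow>
         (\<exists>a b \<psi>. \<forall>(\<alpha>, \<beta>) \<in> P.
            (\<forall>n m. \<forall>v \<in> D n m \<alpha> \<beta> \<inter> dom_n n m \<alpha> \<beta> \<inter> dom_m n m \<alpha> \<beta>.
               R n m \<alpha> \<beta> v = five_point_form fam \<sigma> \<epsilon> \<delta> a b \<psi> n m \<alpha> \<beta> v) \<and>
            infinitesimal_criterion (\<E> fam \<sigma> \<epsilon> \<delta>)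
              (\<lambda>n m \<alpha> \<beta>. D n m \<alpha> \<beta> \<inter> dom_n n m \<alpha> \<beta> \<inter> dom_m n m \<alpha> \<beta>)
              (five_point_form fam \<sigma> \<epsilon> \<delta> a b \<psi>) \<xi> \<zeta> \<alpha> \<beta>))"
proof (intro conjI allI impI)
  have H: "deformed_H fam \<sigma> \<alpha> \<beta>" if "(\<alpha>, \<beta>) \<in> generic_params fam" for \<alpha> \<beta>
    using assms that by (rule deformed_H.intro)
  show "local_three_point_symmetry (\<E> fam \<sigma> \<epsilon> \<delta>) (generic_params fam) dom_n (Rn fam \<sigma> \<epsilon> \<delta>)"
    unfolding local_three_point_symmetry_def five_point_symmetry_def
    using deformed_H.horizontal_symmetry[OF H] depends_only_on_Rn by auto
  show "local_three_point_symmetry (\<E> fam \<sigma> \<epsilon> \<delta>) (generic_params fam) dom_m (Rm fam \<sigma> \<epsilon> \<delta>)"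
    unfolding local_three_point_symmetry_def five_point_symmetry_def
    using deformed_H.vertical_symmetry[OF H] depends_only_on_Rm by auto
  fix P D R \<xi> \<zeta>
  assume P: "P \<subseteq> generic_params fam" and sym: "five_point_symmetry (\<E> fam \<sigma> \<epsilon> \<delta>) P D R \<xi> \<zeta>"
  have crit: "infinitesimal_criterion (\<E> fam \<sigma> \<epsilon> \<delta>) D R \<xi> \<zeta> \<alpha> \<beta>" if "(\<alpha>, \<beta>) \<in> P" for \<alpha> \<beta>
    using sym that unfolding five_point_symmetry_def by blast
  have "\<exists>a b \<psi>. \<forall>n m. \<forall>v \<in> D n m \<alpha> \<beta> \<inter> dom_n n m \<alpha> \<beta> \<inter> dom_m n m \<alpha> \<beta>.
      R n m \<alpha> \<beta> v = a n * Rn fam \<sigma> \<epsilon> \<delta> n m \<alpha> \<beta> v + b m * Rm fam \<sigma> \<epsilon> \<delta> n m \<alpha> \<beta> v + 1/2 * \<psi> n m (v $ Centre)"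
    if "(\<alpha>, \<beta>) \<in> P" for \<alpha> \<beta>
    using deformed_H.five_point_classification[OF H, of \<alpha> \<beta> \<epsilon> \<delta> D R \<xi> \<zeta>] P that sym
    unfolding five_point_symmetry_def by blast
  \<comment> \<open>The membership in \<open>P\<close> is moved inside the existential quantifier so
    that choice yields total functions of the parameters.\<close>
  then have "\<forall>\<alpha> \<beta>. \<exists>a b \<psi>. (\<alpha>, \<beta>) \<in> P \<longrightarrow> (\<forall>n m. \<forall>v \<in> D n m \<alpha> \<beta> \<inter> dom_n n m \<alpha> \<beta> \<inter> dom_m n m \<alpha> \<beta>.
      R n m \<alpha> \<beta> v = a n * Rn fam \<sigma> \<epsilon> \<delta> n m \<alpha> \<beta> v + b m * Rm fam \<sigma> \<epsilon> \<delta> n m \<alpha> \<beta> v + 1/2 * \<psi> n m (v $ Centre))"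
    by blast
  then obtain a b \<psi> where form: "\<And>\<alpha> \<beta> n m v. (\<alpha>, \<beta>) \<in> P \<Longrightarrow> v \<in> D n m \<alpha> \<beta> \<inter> dom_n n m \<alpha> \<beta> \<inter> dom_m n m \<alpha> \<beta> \<Longrightarrow>
      R n m \<alpha> \<beta> v = a \<alpha> \<beta> n * Rn fam \<sigma> \<epsilon> \<delta> n m \<alpha> \<beta> v + b \<alpha> \<beta> m * Rm fam \<sigma> \<epsilon> \<delta> n m \<alpha> \<beta> v + 1/2 * \<psi> \<alpha> \<beta> n m (v $ Centre)"
    unfolding choice_iff by blast
  define a' where "a' = (\<lambda>n \<alpha> \<beta>. a \<alpha> \<beta> n)"
  define b' where "b' = (\<lambda>m \<alpha> \<beta>. b \<alpha> \<beta> m)"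
  define \<psi>' where "\<psi>' = (\<lambda>n m c \<alpha> \<beta>. \<psi> \<alpha> \<beta> n m c)"
  have form': "R n m \<alpha> \<beta> v = five_point_form fam \<sigma> \<epsilon> \<delta> a' b' \<psi>' n m \<alpha> \<beta> v"
    if "(\<alpha>, \<beta>) \<in> P" "v \<in> D n m \<alpha> \<beta> \<inter> dom_n n m \<alpha> \<beta> \<inter> dom_m n m \<alpha> \<beta>" for \<alpha> \<beta> n m v
    using form[OF that] by (simp add: five_point_form_def a'_def b'_def \<psi>'_def)
  have "infinitesimal_criterion (\<E> fam \<sigma> \<epsilon> \<delta>) (\<lambda>n m \<alpha> \<beta>. D n m \<alpha> \<beta> \<inter> dom_n n m \<alpha> \<beta> \<inter> dom_m n m \<alpha> \<beta>)
      (five_point_form fam \<sigma> \<epsilon> \<delta> a' b' \<psi>') \<xi> \<zeta> \<alpha> \<beta>" if "(\<alpha>, \<beta>) \<in> P" for \<alpha> \<beta>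
    by (rule infinitesimal_criterion_cong[OF crit[OF that]]) (use form'[OF that] in auto)
  then show "\<exists>a b \<psi>. \<forall>(\<alpha>, \<beta>) \<in> P.
            (\<forall>n m. \<forall>v \<in> D n m \<alpha> \<beta> \<inter> dom_n n m \<alpha> \<beta> \<inter> dom_m n m \<alpha> \<beta>.
               R n m \<alpha> \<beta> v = five_point_form fam \<sigma> \<epsilon> \<delta> a b \<psi> n m \<alpha> \<beta> v) \<and>
            infinitesimal_criterion (\<E> fam \<sigma> \<epsilon> \<delta>)
              (\<lambda>n m \<alpha> \<beta>. D n m \<alpha> \<beta> \<inter> dom_n n m \<alpha> \<beta> \<inter> dom_m n m \<alpha> \<beta>)
              (five_point_form fam \<sigma> \<epsilon> \<delta> a b \<psi>) \<xi> \<zeta> \<alpha> \<beta>"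
    using form' by (intro exI[of _ a'] exI[of _ b'] exI[of _ \<psi>']) blast
qed

end
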